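(* Let $\mathcal{A}\subset\mathbb{N}$ be a finite alphabet and $\delta=\delta_{\mathcal{A}}$. Then for any $\varepsilon>0$, $$\#\mathfrak{D}_{\mathcal{A}}(N)\gg_{\varepsilon} N^{\delta+\frac{(2\delta-1)(1-\delta)}{5-\delta}-\varepsilon}$$ as $N\to\infty$.
   Context: For $a_1,\dots,a_k\in\mathbb{N}$ write $[a_1,\dots,a_k]=\cfrac{1}{a_1+\cfrac{1}{a_2+\ddots+\cfrac{1}{a_k}}}$, and similarly for infinite continued fractions. For a finite set $\mathcal{A}\subset\mathbb{N}$: $\mathfrak{C}_{\mathcal{A}}=\{[a_1,a_2,\dots]: a_j\in\mathcal{A}\ \forall j\ge1\}\subset[0,1]$ and $\delta_{\mathcal{A}}$ is its Hausdorff dimension; $\mathfrak{R}_{\mathcal{A}}$ is the set of rationals $b/d$ which can be written as $[a_1,\dots,a_k]$ for some $k\ge1$ with all $a_j\in\mathcal{A}$; $\mathfrak{D}_{\mathcal{A}}=\{d\ge1:\exists\, b \text{ with }(b,d)=1,\ b/d\in\mathfrak{R}_{\mathcal{A}}\}$; $\mathfrak{D}_{\mathcal{A}}(N)=\mathfrak{D}_{\mathcal{A}}\cap[1,N]$. *)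

theory Defs
  imports "HOL-Analysis.Analysis" "HOL-Library.Landau_Symbols"
begin

(* The case distinction replaces (diameter U) powr s because Isabelle has 0 powr 0 = 0,
   while a nonempty set of diameter 0 must contribute 1 to the 0-dimensional measure. *)
definition diam_gauge :: "real \<Rightarrow> 'a::metric_space set \<Rightarrow> ennreal" where
  "diam_gauge s U =
     (if U = {} then 0 else if s = 0 then 1 else ennreal (diameter U powr s))"

(* Boundedness is required explicitly: diameter is unspecified on unbounded sets. *)
definition hausdorff_premeasure :: "real \<Rightarrow> real \<Rightarrow> 'a::metric_space set \<Rightarrow> ennreal" where
  "hausdorff_premeasure r s E =
     (INF U \<in> {U :: nat \<Rightarrow> 'a set. E \<subseteq> (\<Union>i. U i) \<and> (\<forall>i. bounded (U i) \<and> diameter (U i) \<le> r)}.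
        (\<Sum>i. diam_gauge s (U i)))"

definition hausdorff_measure :: "real \<Rightarrow> 'a::metric_space set \<Rightarrow> ennreal" where
  "hausdorff_measure s E = (SUP r \<in> {0<..}. hausdorff_premeasure r s E)"

definition hausdorff_dim :: "'a::metric_space set \<Rightarrow> ennreal" where
  "hausdorff_dim E = (INF s \<in> {s. 0 \<le> s \<and> hausdorff_measure s E = 0}. ennreal s)"

fun cfrac :: "nat list \<Rightarrow> real" where
  "cfrac [] = 0"
| "cfrac (a # as) = 1 / (real a + cfrac as)"

(* The partial quotients are a 0, a 1, ... (indexed from 0). *)
definition cfrac_inf :: "(nat \<Rightarrow> nat) \<Rightarrow> real" where
  "cfrac_inf a = lim (\<lambda>k. cfrac (map a [0..<k]))"

definition cf_set :: "nat set \<Rightarrow> real set" where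
  "cf_set A = {cfrac_inf a | a. \<forall>j. a j \<in> A}"

definition cf_dim :: "nat set \<Rightarrow> real" where
  "cf_dim A = enn2real (hausdorff_dim (cf_set A))"

definition cf_rationals :: "nat set \<Rightarrow> real set" where
  "cf_rationals A = {cfrac as | as. as \<noteq> [] \<and> set as \<subseteq> A}"

definition cf_denoms :: "nat set \<Rightarrow> nat set" where
  "cf_denoms A =
     {d. 1 \<le> d \<and> (\<exists>b::int. coprime b (int d) \<and> real_of_int b / real d \<in> cf_rationals A)}"

definition cf_denoms_upto :: "nat set \<Rightarrow> nat \<Rightarrow> nat set" where
  "cf_denoms_upto A N = cf_denoms A \<inter> {1..N}"

end

theory Submission
  imports Defs "HOL-Computational_Algebra.Primes" "HOL-Real_Asymp.Real_Asymp"
    "HOL-Library.Discrete_Functions"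
begin

text \<open>
  Write \<open>D\<close> for the set of denominators up to \<open>N\<close>. The Hausdorff dimension enters through covers by
  cylinders only: it yields a set \<open>B\<close> of words of equal length, all with continuant about \<open>H\<close>, of size
  at least \<open>H\<^sup>2\<^sup>\<sigma>\<close> with \<open>\<sigma>\<close> close to \<open>\<delta>\<close>, and concatenations of blocks from \<open>B\<close> then have multiplicative
  size and cardinality.

  A continuant of a concatenation is a scalar product of integer vectors \<open>v\<close> and \<open>w\<close> attached to the
  two halves. Take \<open>v\<close> of size \<open>N\<^sup>3\<^sup>/\<^sup>4\<close> and two families of vectors \<open>w\<close>, \<open>w'\<close> of size \<open>N\<^sup>1\<^sup>/\<^sup>4\<close> with different
  first letters, so that \<open>\<Delta> = \<bar>w \<times> w'\<bar>\<close> is about \<open>N\<^sup>1\<^sup>/\<^sup>2\<close>. Then \<open>v\<close> is determined by the pair of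
  denominators \<open>(v \<cdot> w, v \<cdot> w')\<close>, whose entries are proportional modulo \<open>\<Delta>\<close>; hence the number of \<open>v\<close> is at
  most the number of pairs in \<open>D\<close> congruent modulo \<open>\<Delta>\<close>. Fourier analysis writes \<open>\<Delta>\<close> times this number
  as the sum over \<open>q\<close> dividing \<open>\<Delta>\<close> of the energies \<open>G(q)\<close> of \<open>D\<close> at primitive fractions \<open>a/q\<close>.
  Averaging over \<open>w\<close> and \<open>w'\<close>, a modulus \<open>q\<close> divides \<open>\<Delta>\<close> with frequency at most \<open>q\<^sup>-\<^sup>\<sigma>\<close>, because the suffix
  of size \<open>q\<^sup>1\<^sup>/\<^sup>2\<close> of \<open>w'\<close> is determined by its class modulo \<open>q\<close>. Small \<open>q\<close> are handled by the divisor
  bound, large \<open>q\<close> by the large sieve. The outcome is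
  \<open>\<bar>D\<bar> \<ge> N\<close> to the power \<open>(5\<delta> - 1) / (2 (1 + \<delta>)) - \<epsilon>\<close>, which is at least the required exponent when \<open>\<delta> > 1/2\<close>.
  For \<open>\<delta> \<le> 1/2\<close> the bound \<open>\<bar>D\<bar> \<ge> N\<close> to the power \<open>\<delta> - \<epsilon>\<close> suffices; it holds because numerator and
  denominator of a fraction determine its word and both lie in \<open>D\<close>.
\<close>

section \<open>Continuants\<close>

text \<open>A word acts as the product, over its letters, of the symmetric matrices with rows (a, 1)
  and (1, 0). The ring is left open because integer vectors and real vectors (1,
  \<open>cfrac xs\<close>) are both acted on.\<close>

fun cf_act :: "nat list \<Rightarrow> 'a::comm_ring_1 \<times> 'a \<Rightarrow> 'a \<times> 'a" where
  "cf_act [] z = z"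
| "cf_act (a # as) z = (of_nat a * fst (cf_act as z) + snd (cf_act as z), fst (cf_act as z))"

definition dot :: "'a::comm_ring_1 \<times> 'a \<Rightarrow> 'a \<times> 'a \<Rightarrow> 'a" where
  "dot u v = fst u * fst v + snd u * snd v"

definition cross :: "'a::comm_ring_1 \<times> 'a \<Rightarrow> 'a \<times> 'a \<Rightarrow> 'a" where
  "cross u v = fst u * snd v - snd u * fst v"

text \<open>The top left entry of the matrix product; by \<open>cfrac_eq\<close> and
  \<open>coprime_cf_act\<close> it is the reduced denominator of \<open>cfrac as\<close> when no
  letter is 0.\<close>

definition continuant :: "nat list \<Rightarrow> int" where
  "continuant as = fst (cf_act as (1, 0))"

lemma cf_act_append: "cf_act (xs @ ys) z = cf_act xs (cf_act ys z)"
  by (induction xs) auto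

lemma fst_cf_act_linear:
  "fst (cf_act as (x, y)) = x * fst (cf_act as (1, 0)) + y * fst (cf_act as (0, 1))"
proof -
  have "fst (cf_act as (x, y)) = x * fst (cf_act as (1, 0)) + y * fst (cf_act as (0, 1)) \<and>
    snd (cf_act as (x, y)) = x * snd (cf_act as (1, 0)) + y * snd (cf_act as (0, 1))"
    by (induction as) (auto simp: algebra_simps)
  then show ?thesis by blast
qed

text \<open>\<open>cross\<close> is the determinant of two column vectors, and each letter matrix
  has determinant -1.\<close>

lemma cross_cf_act: "cross (cf_act as u) (cf_act as v) = (-1) ^ length as * cross u v"
proof (induction as)
  case (Cons a as)
  have "cross (cf_act (a # as) u) (cf_act (a # as) v) = - cross (cf_act as u) (cf_act as v)"
    by (simp add: cross_def algebra_simps)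
  with Cons show ?case by simp
qed simp

text \<open>Each letter matrix is symmetric, so transposing the product reverses the word.\<close>

lemma dot_cf_act_rev: "dot (cf_act (rev xs) u) v = dot u (cf_act xs v)"
proof (induction xs arbitrary: u)
  case (Cons x xs)
  have "dot (cf_act (rev (x # xs)) u) v = dot (cf_act [x] u) (cf_act xs v)"
    by (simp add: cf_act_append Cons.IH del: cf_act.simps(2))
  also have "\<dots> = dot u (cf_act (x # xs) v)"
    by (simp add: dot_def algebra_simps)
  finally show ?case .
qed simp

lemma of_int_cf_act:
  "fst (cf_act as (real_of_int x, real_of_int y)) = real_of_int (fst (cf_act as (x, y)))"
  "snd (cf_act as (real_of_int x, real_of_int y)) = real_of_int (snd (cf_act as (x, y)))"
  by (induction as) auto

text \<open>This cone is wide enough to contain both (0, 1) and (1, -1). By linearity the image of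
  (1, -1) compares the two entries of the top row, which is how \<open>fst_cf_act_01\<close> uses
  it.\<close>

lemma cf_act_cone:
  fixes z :: "'a::linordered_idom \<times> 'a"
  assumes "0 \<notin> set as" "0 \<le> fst z" "0 \<le> fst z + snd z"
  shows "0 \<le> fst (cf_act as z) \<and> 0 \<le> fst (cf_act as z) + snd (cf_act as z)"
  using assms(1)
proof (induction as)
  case (Cons a as)
  let ?x = "fst (cf_act as z)" and ?y = "snd (cf_act as z)"
  have IH: "0 \<le> ?x" "0 \<le> ?x + ?y" and "a \<ge> 1" using Cons by auto
  then have "1 * ?x \<le> of_nat a * ?x" by (intro mult_right_mono) auto
  then have "0 \<le> of_nat a * ?x + ?y" using IH by linarith
  with IH show ?case by auto
qed (use assms in auto)

lemma cf_act_mono_cone: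
  fixes z :: "int \<times> int"
  assumes "0 \<notin> set as" "0 < snd z" "snd z < fst z"
  shows "0 < snd (cf_act as z) \<and> snd (cf_act as z) < fst (cf_act as z) \<and> fst z \<le> fst (cf_act as z)
     \<and> (as \<noteq> [] \<longrightarrow> fst z < fst (cf_act as z))"
  using assms(1)
proof (induction as)
  case (Cons a as)
  let ?x = "fst (cf_act as z)" and ?y = "snd (cf_act as z)"
  have IH: "0 < ?y" "?y < ?x" "fst z \<le> ?x" and "a \<ge> 1" using Cons by auto
  then have "1 * ?x \<le> int a * ?x" by (intro mult_right_mono) auto
  then have "?x < int a * ?x + ?y" "fst z < int a * ?x + ?y" using IH by linarith+
  with IH show ?case by auto
qed (use assms in auto)

text \<open>The strict cone excludes the ambiguity \<open>[\<dots>, a, 1] = [\<dots>, a + 1]\<close> of finite expansions.\<close>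

lemma cf_act_inj:
  fixes z :: "int \<times> int"
  assumes "0 \<notin> set as" "0 \<notin> set bs" "0 < snd z" "snd z < fst z" "cf_act as z = cf_act bs z"
  shows "as = bs"
  using assms(1,2,5)
proof (induction as arbitrary: bs)
  case Nil
  \<comment> \<open>A nonempty word strictly enlarges the first entry of a vector in the strict
    cone, so it cannot fix \<open>z\<close>.\<close>
  then show ?case using cf_act_mono_cone[of bs z] assms(3,4) by (cases "bs = []") auto
next
  case (Cons a as)
  show ?case
  proof (cases bs)
    case Nil
    then show ?thesis using cf_act_mono_cone[of "a # as" z] assms(3,4) Cons.prems
      by (auto simp del: cf_act.simps(2))
  next
    case (Cons b bs')
    let ?u = "cf_act as z" and ?v = "cf_act bs' z"
    have eq: "int a * fst ?u + snd ?u = int b * fst ?v + snd ?v" "fst ?u = fst ?v"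
      using Cons.prems Cons by auto
    have u: "0 < snd ?u" "snd ?u < fst ?u" and v: "0 < snd ?v" "snd ?v < fst ?v"
      using cf_act_mono_cone[of as z] cf_act_mono_cone[of bs' z] assms(3,4) Cons.prems Cons by auto
    \<comment> \<open>In the strict cone the second entry is a positive proper remainder, so the
      first letter is an integer quotient.\<close>
    have "int a = (int a * fst ?u + snd ?u) div fst ?u" using u by simp
    also have "\<dots> = (int b * fst ?v + snd ?v) div fst ?v" using eq by simp
    also have "\<dots> = int b" using v by simp
    finally have "a = b" by simp
    with eq have "?u = ?v" by (simp add: prod_eq_iff)
    with \<open>a = b\<close> Cons.IH[of bs'] Cons.prems Cons show ?thesis by auto
  qed
qed

lemma coprime_cf_act:
  fixes z :: "int \<times> int"
  assumes "coprime (fst z) (snd z)"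
  shows "coprime (fst (cf_act as z)) (snd (cf_act as z))"
proof (induction as)
  case (Cons a as)
  then have "gcd (fst (cf_act as z)) (int a * fst (cf_act as z) + snd (cf_act as z)) = 1"
    using gcd_add_mult[of "fst (cf_act as z)" "int a" "snd (cf_act as z)"] by (simp add: coprime_iff_gcd_eq_1)
  then show ?case by (simp add: coprime_iff_gcd_eq_1 gcd.commute)
qed (use assms in auto)

section \<open>Size of continuants\<close>

lemma continuant_ge_1: "0 \<notin> set as \<Longrightarrow> continuant as \<ge> 1"
  and snd_cf_act_10: "0 \<notin> set as \<Longrightarrow> 0 \<le> snd (cf_act as (1, 0::int)) \<and> snd (cf_act as (1, 0::int)) \<le> continuant as"
proof -
  have "1 \<le> fst (cf_act as (1, 0::int)) \<and> 0 \<le> snd (cf_act as (1, 0::int))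
     \<and> snd (cf_act as (1, 0::int)) \<le> fst (cf_act as (1, 0::int))" if "0 \<notin> set as"
    using that
  proof (induction as)
    case (Cons a as)
    let ?x = "fst (cf_act as (1, 0::int))"
    have IH: "1 \<le> ?x" "0 \<le> snd (cf_act as (1, 0::int))" and "a \<ge> 1" using Cons by auto
    then have "1 * ?x \<le> int a * ?x" by (intro mult_right_mono) auto
    then have "?x \<le> int a * ?x + snd (cf_act as (1, 0::int))" using IH by linarith
    with IH show ?case by auto
  qed auto
  then show "0 \<notin> set as \<Longrightarrow> continuant as \<ge> 1"
    "0 \<notin> set as \<Longrightarrow> 0 \<le> snd (cf_act as (1, 0::int)) \<and> snd (cf_act as (1, 0::int)) \<le> continuant as"
    by (auto simp: continuant_def)
qed

lemma fst_cf_act_01: "0 \<notin> set as \<Longrightarrow> 0 \<le> fst (cf_act as (0, 1::int)) \<and> fst (cf_act as (0, 1::int)) \<le> continuant as"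
  using cf_act_cone[of as "(0, 1::int)"] cf_act_cone[of as "(1, -1::int)"]
    fst_cf_act_linear[of as 1 "-1::int"]
  by (auto simp: continuant_def)

text \<open>Linearity gives fst z * K + snd z * K', where the top row (K, K') satisfies 0 <= K' <=
  K. Hence continuants are multiplicative under concatenation up to a factor 2.\<close>

lemma continuant_mult_le:
  assumes "0 \<notin> set as" "0 \<le> snd z" "snd z \<le> fst z"
  shows "continuant as * fst z \<le> fst (cf_act as z)" "fst (cf_act as z) \<le> 2 * continuant as * fst z"
proof -
  have eq: "fst (cf_act as z) = fst z * continuant as + snd z * fst (cf_act as (0, 1))"
    using fst_cf_act_linear[of as "fst z" "snd z"] by (simp add: continuant_def)
  have b: "0 \<le> fst (cf_act as (0, 1::int))" "fst (cf_act as (0, 1::int)) \<le> continuant as"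
    using fst_cf_act_01[OF assms(1)] by auto
  have "0 \<le> snd z * fst (cf_act as (0, 1))" using b assms by simp
  then show "continuant as * fst z \<le> fst (cf_act as z)" using eq by (simp add: mult.commute)
  have "snd z * fst (cf_act as (0, 1)) \<le> fst z * continuant as" using b assms by (intro mult_mono) auto
  then show "fst (cf_act as z) \<le> 2 * continuant as * fst z" using eq by (simp add: algebra_simps)
qed

lemma continuant_Cons_Cons:
  "continuant (a # b # as) = int a * continuant (b # as) + continuant as"
  by (simp add: continuant_def)

lemma continuant_Cons_le:
  assumes "0 \<notin> set as" shows "continuant (a # as) \<le> (int a + 1) * continuant as"
  using snd_cf_act_10[OF assms] by (simp add: continuant_def algebra_simps)

text \<open>Two further positive letters at least double the continuant.\<close>

lemma continuant_growth:
  assumes "0 \<notin> set as" shows "2 ^ (length as div 2) \<le> continuant as"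
  using assms
proof (induction as rule: induct_list012)
  case (3 a b as)
  have ge: "continuant as \<ge> 1" using continuant_ge_1 3 by auto
  have s: "0 \<le> snd (cf_act as (1, 0::int))" using snd_cf_act_10 3 by auto
  have ab: "a \<ge> 1" "b \<ge> 1" using 3 by auto
  have "1 * continuant as \<le> int b * continuant as" using ab ge by (intro mult_right_mono) auto
  then have b1: "continuant as \<le> continuant (b # as)" using s by (simp add: continuant_def)
  have "1 * continuant (b # as) \<le> int a * continuant (b # as)" using ab b1 ge by (intro mult_right_mono) auto
  then have "2 * continuant as \<le> continuant (a # b # as)" using b1 by (simp add: continuant_Cons_Cons)
  moreover have "2 ^ (length as div 2) \<le> continuant as" using 3 by auto
  ultimately show ?case by (auto)
qed (auto simp: continuant_def)

lemma continuant_upper: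
  assumes "0 \<notin> set as" "\<And>a. a \<in> set as \<Longrightarrow> a \<le> M" shows "continuant as \<le> (int M + 1) ^ length as"
  using assms
proof (induction as)
  case (Cons a as)
  have "continuant (a # as) \<le> (int a + 1) * continuant as" using continuant_Cons_le Cons by auto
  also have "\<dots> \<le> (int M + 1) * (int M + 1) ^ length as"
    using Cons continuant_ge_1[of as] by (intro mult_mono) auto
  finally show ?case by simp
qed (auto simp: continuant_def)

text \<open>Prepending \<open>a\<close> sends the fraction y / x to x / (a x + y), which is
  \<open>cf_act\<close> in projective coordinates (x, y); the tail enters as (1,
  \<open>cfrac xs\<close>).\<close>

lemma cfrac_append:
  assumes "0 \<notin> set as"
  shows "cfrac (as @ xs) = snd (cf_act as (1, cfrac xs)) / fst (cf_act as (1, cfrac xs))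
     \<and> fst (cf_act as (1, cfrac xs)) > 0"
proof -
  have nn: "cfrac ys \<ge> 0" for ys by (induction ys) auto
  have "0 \<le> snd (cf_act as (1, cfrac xs)) \<and> cfrac (as @ xs) = snd (cf_act as (1, cfrac xs)) / fst (cf_act as (1, cfrac xs))
     \<and> fst (cf_act as (1, cfrac xs)) > 0"
    using assms
  proof (induction as)
    case (Cons a as)
    let ?x = "fst (cf_act as (1, cfrac xs))" and ?y = "snd (cf_act as (1, cfrac xs))"
    have IH: "cfrac (as @ xs) = ?y / ?x" "?x > 0" "?y \<ge> 0" and "a \<ge> 1" using Cons by auto
    then have "real a * ?x + ?y > 0" by (intro add_pos_nonneg) auto
    moreover have "1 / (real a + ?y / ?x) = ?x / (real a * ?x + ?y)" using IH(2)
      by (simp add: field_simps)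
    ultimately show ?case using IH by simp
  qed (use nn in auto)
  then show ?thesis by blast
qed

lemma cfrac_eq: "0 \<notin> set as \<Longrightarrow> cfrac as = of_int (snd (cf_act as (1, 0))) / of_int (continuant as)"
  using cfrac_append[of as "[]"] of_int_cf_act[of as 1 0] by (simp add: continuant_def)

lemma continuant_in_cf_denoms:
  assumes "as \<noteq> []" "set as \<subseteq> A" "0 \<notin> A"
  shows "nat (continuant as) \<in> cf_denoms A"
proof -
  have nz: "0 \<notin> set as" using assms by auto
  have c: "continuant as \<ge> 1" using continuant_ge_1[OF nz] .
  have "coprime (snd (cf_act as (1, 0))) (int (nat (continuant as)))"
    using coprime_cf_act[of "(1, 0)" as] c by (simp add: continuant_def coprime_commute)
  moreover have "real_of_int (snd (cf_act as (1, 0))) / real (nat (continuant as)) \<in> cf_rationals A"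
    using cfrac_eq[OF nz] c assms unfolding cf_rationals_def by force
  moreover have "1 \<le> nat (continuant as)" using c by linarith
  ultimately show ?thesis unfolding cf_denoms_def by blast
qed

lemma cfrac_bounds: "0 \<notin> set as \<Longrightarrow> 0 \<le> cfrac as \<and> cfrac as \<le> 1"
proof -
  assume a: "0 \<notin> set as"
  have "0 \<le> cfrac as" for as by (induction as) auto
  moreover have "cfrac as \<le> 1" using cfrac_eq[OF a] snd_cf_act_10[OF a] continuant_ge_1[OF a] by simp
  ultimately show ?thesis by blast
qed

text \<open>The difference of the two fractions is a cross product over the product of the
  denominators. The determinant leaves only the difference of the tails, at most 1, and both
  denominators are at least the continuant.\<close>

lemma cfrac_cylinder:
  assumes "0 \<notin> set as" "0 \<notin> set xs" "0 \<notin> set ys"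
  shows "\<bar>cfrac (as @ xs) - cfrac (as @ ys)\<bar> \<le> 1 / of_int (continuant as) ^ 2"
proof -
  let ?K = "of_int (continuant as) :: real"
  define t u where "t = cfrac xs" and "u = cfrac ys"
  define p q where "p = cf_act as (1, t)" and "q = cf_act as (1, u)"
  have tu: "0 \<le> t" "t \<le> 1" "0 \<le> u" "u \<le> 1" using cfrac_bounds assms t_def u_def by auto
  have K: "?K \<ge> 1" using continuant_ge_1[OF assms(1)] by simp
  have f: "fst (cf_act as (1, x)) \<ge> ?K" if "x \<ge> 0" for x :: real
  proof -
    have "fst (cf_act as (0, 1::real)) \<ge> 0"
      using fst_cf_act_01[OF assms(1)] of_int_cf_act[of as 0 1] by simp
    moreover have "fst (cf_act as (1, x)) = ?K + x * fst (cf_act as (0, 1))"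
      using fst_cf_act_linear[of as 1 x] of_int_cf_act[of as 1 0] by (simp add: continuant_def)
    ultimately show ?thesis using that by simp
  qed
  have fp: "fst p \<ge> ?K" "fst q \<ge> ?K" using f tu p_def q_def by auto
  have pos: "fst p > 0" "fst q > 0" using fp K by linarith+
  have "cfrac (as @ xs) - cfrac (as @ ys) = snd p / fst p - snd q / fst q"
    using cfrac_append[OF assms(1)] p_def q_def t_def u_def by auto
  also have "\<dots> = - cross p q / (fst p * fst q)" using pos by (simp add: cross_def field_simps)
  finally have "\<bar>cfrac (as @ xs) - cfrac (as @ ys)\<bar> = \<bar>cross p q\<bar> / (fst p * fst q)" using pos by simp
  also have "\<bar>cross p q\<bar> = \<bar>u - t\<bar>"
    unfolding p_def q_def cross_cf_act by (simp add: abs_mult cross_def)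
  also have "\<bar>u - t\<bar> / (fst p * fst q) \<le> 1 / (?K * ?K)"
    using tu fp K by (intro frac_le mult_mono) auto
  finally show ?thesis by (simp add: power2_eq_square)
qed

section \<open>Block sets from the Hausdorff dimension\<close>

lemma map_upt_split: "n \<le> k \<Longrightarrow> map a [0..<k] = map a [0..<n] @ map a [n..<k]"
  by (metis le_add_diff_inverse map_append upt_add_eq_append zero_le)

lemma cfrac_prefix_close:
  assumes "\<And>j. a j \<noteq> 0" "\<And>j. b j \<noteq> 0" "n \<le> k" "n \<le> k'" "map a [0..<n] = map b [0..<n]"
  shows "\<bar>cfrac (map a [0..<k]) - cfrac (map b [0..<k'])\<bar> \<le> 1 / of_int (continuant (map a [0..<n])) ^ 2"
proof -
  have "0 \<notin> set (map a [i..<j])" "0 \<notin> set (map b [i..<j])" for i j using assms(1,2) by (auto simp del: neq0_conv)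
  then show ?thesis
    unfolding map_upt_split[OF assms(3)] map_upt_split[OF assms(4)] assms(5)[symmetric]
    by (intro cfrac_cylinder)
qed

lemma inverse_continuant_sq_le:
  assumes "r > 0"
  obtains n0 where "\<And>as. 0 \<notin> set as \<Longrightarrow> length as \<ge> n0 \<Longrightarrow> 1 / real_of_int (continuant as) ^ 2 \<le> r"
proof -
  obtain n where n: "(1/2) ^ n < r" using real_arch_pow_inv[OF assms, of "1/2"] by auto
  have "1 / real_of_int (continuant as) ^ 2 \<le> r" if "0 \<notin> set as" "length as \<ge> 2 * n" for as
  proof -
    have "(2::int) ^ n \<le> 2 ^ (length as div 2)" using that by (intro power_increasing) auto
    also have "\<dots> \<le> continuant as" using continuant_growth[OF that(1)] .
    finally have c: "2 ^ n \<le> real_of_int (continuant as)" by (metis of_int_le_iff of_int_numeral of_int_power)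
    have c1: "1 \<le> real_of_int (continuant as)" using continuant_ge_1[OF that(1)] by simp
    have "real_of_int (continuant as) * 1 \<le> real_of_int (continuant as) ^ 2"
      unfolding power2_eq_square using c1 by (intro mult_left_mono) auto
    then have "2 ^ n \<le> real_of_int (continuant as) ^ 2" using c by linarith
    then have "1 / real_of_int (continuant as) ^ 2 \<le> 1 / 2 ^ n" by (intro frac_le) auto
    then show ?thesis using n by (simp add: power_one_over)
  qed
  then show ?thesis using that by blast
qed

text \<open>\<open>cfrac_inf\<close> is defined by \<open>lim\<close>, which says something only
  once convergence is known; the cylinder bound makes the convergents Cauchy.\<close>

lemma cfrac_inf_tendsto:
  assumes "\<And>j. a j \<noteq> 0"
  shows "(\<lambda>k. cfrac (map a [0..<k])) \<longlonglongrightarrow> cfrac_inf a"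
proof -
  have "Cauchy (\<lambda>k. cfrac (map a [0..<k]))"
  proof (rule metric_CauchyI)
    fix e :: real assume "e > 0"
    then obtain n0 where n0: "\<And>as. 0 \<notin> set as \<Longrightarrow> length as \<ge> n0 \<Longrightarrow> 1 / real_of_int (continuant as) ^ 2 \<le> e / 2"
      using inverse_continuant_sq_le[of "e / 2"] by auto
    have "dist (cfrac (map a [0..<m])) (cfrac (map a [0..<n])) < e" if "m \<ge> n0" "n \<ge> n0" for m n
    proof -
      have "0 \<notin> set (map a [0..<n0])" using assms by (auto simp del: neq0_conv)
      from n0[OF this] have "1 / real_of_int (continuant (map a [0..<n0])) ^ 2 \<le> e / 2" by simp
      then show ?thesis using cfrac_prefix_close[of a a n0 m n, OF assms assms that refl] \<open>e > 0\<close>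
        unfolding dist_real_def by linarith
    qed
    then show "\<exists>M. \<forall>m\<ge>M. \<forall>n\<ge>M. dist (cfrac (map a [0..<m])) (cfrac (map a [0..<n])) < e" by blast
  qed
  then show ?thesis unfolding cfrac_inf_def
    by (simp add: real_Cauchy_convergent convergent_LIMSEQ_iff[symmetric])
qed

lemma cfrac_inf_prefix_close:
  assumes "\<And>j. a j \<noteq> 0" "\<And>j. b j \<noteq> 0" "map a [0..<n] = map b [0..<n]"
  shows "\<bar>cfrac_inf a - cfrac_inf b\<bar> \<le> 1 / of_int (continuant (map a [0..<n])) ^ 2"
proof (rule tendsto_upperbound)
  show "(\<lambda>k. \<bar>cfrac (map a [0..<k]) - cfrac (map b [0..<k])\<bar>) \<longlonglongrightarrow> \<bar>cfrac_inf a - cfrac_inf b\<bar>"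
    by (intro tendsto_intros cfrac_inf_tendsto assms)
  show "\<forall>\<^sub>F k in sequentially. \<bar>cfrac (map a [0..<k]) - cfrac (map b [0..<k])\<bar>
      \<le> 1 / of_int (continuant (map a [0..<n])) ^ 2"
    using eventually_ge_at_top[of n] by eventually_elim (rule cfrac_prefix_close[OF assms(1,2) _ _ assms(3)])
qed simp

text \<open>An exponent below the dimension is missing from the set of the infimum, so its measure
  is nonzero, and this measure is a supremum of premeasures.\<close>

lemma hausdorff_premeasure_nonzero:
  assumes "0 < s" "s < enn2real (hausdorff_dim E)"
  obtains r where "r > 0" "hausdorff_premeasure r s E \<noteq> 0"
proof -
  have "hausdorff_measure s E \<noteq> 0"
  proof
    assume "hausdorff_measure s E = 0"
    then have "hausdorff_dim E \<le> ennreal s"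
      unfolding hausdorff_dim_def using assms(1) by (intro INF_lower) auto
    then have "enn2real (hausdorff_dim E) \<le> s" using assms(1) by (intro enn2real_leI) auto
    with assms(2) show False by simp
  qed
  then have "\<exists>r>0. hausdorff_premeasure r s E \<noteq> 0"
    unfolding hausdorff_measure_def by (metis (no_types, lifting) SUP_least bot.extremum_uniqueI bot_ennreal greaterThan_iff order_refl)
  then show ?thesis using that by blast
qed

text \<open>The cylinders of level \<open>n\<close> cover the limit set, with diameters at most the
  inverse squared continuants. Once these are below the scale \<open>r\<close>, the sum bounds the
  premeasure from above, so a nonzero premeasure is a lower bound uniform in
  \<open>n\<close>.\<close>

lemma sum_continuant_powr_ge:
  assumes A: "finite A" "0 \<notin> A" and s: "0 < s" "s < cf_dim A"
  obtains c n0 where "c > 0"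
    "\<And>n. n \<ge> n0 \<Longrightarrow> c \<le> (\<Sum>as\<in>{as. set as \<subseteq> A \<and> length as = n}. real_of_int (continuant as) powr (- 2 * s))"
proof -
  obtain r where r: "r > 0" "hausdorff_premeasure r s (cf_set A) \<noteq> 0"
    using hausdorff_premeasure_nonzero[OF s(1)] s(2) unfolding cf_dim_def by blast
  obtain n0 where n0: "\<And>as. 0 \<notin> set as \<Longrightarrow> length as \<ge> n0 \<Longrightarrow> 1 / real_of_int (continuant as) ^ 2 \<le> r"
    using inverse_continuant_sq_le[OF r(1)] by blast
  define p where "p = hausdorff_premeasure r s (cf_set A)"
  have main: "p \<le> ennreal (\<Sum>as\<in>{as. set as \<subseteq> A \<and> length as = n}. real_of_int (continuant as) powr (- 2 * s))"
    if n: "n \<ge> n0" for n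
  proof -
    define W where "W = {as. set as \<subseteq> A \<and> length as = n}"
    have finW: "finite W" unfolding W_def using A finite_lists_length_eq by blast
    obtain h where h: "bij_betw h {0..<card W} W" using ex_bij_betw_nat_finite[OF finW] by blast
    define Cyl where "Cyl as = {cfrac_inf a | a. (\<forall>j. a j \<in> A) \<and> map a [0..<n] = as}" for as
    \<comment> \<open>The premeasure asks for a sequence of sets; the empty sets after the last
      cylinder have gauge 0.\<close>
    define U where "U i = (if i < card W then Cyl (h i) else {})" for i
    have nz: "0 \<notin> set as" if "as \<in> W" for as using that A unfolding W_def by auto
    have c1: "real_of_int (continuant as) \<ge> 1" if "as \<in> W" for as using continuant_ge_1[OF nz[OF that]] by simp
    have close: "\<bar>x - y\<bar> \<le> 1 / real_of_int (continuant as) ^ 2" if "as \<in> W" "x \<in> Cyl as" "y \<in> Cyl as" for as x y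
    proof -
      obtain a b where ab: "x = cfrac_inf a" "y = cfrac_inf b" "\<forall>j. a j \<in> A" "\<forall>j. b j \<in> A"
        "map a [0..<n] = as" "map b [0..<n] = as" using \<open>x \<in> Cyl as\<close> \<open>y \<in> Cyl as\<close> unfolding Cyl_def by blast
      have "a j \<noteq> 0" for j using ab(3) A(2) by metis
      moreover have "b j \<noteq> 0" for j using ab(4) A(2) by metis
      moreover have "map a [0..<n] = map b [0..<n]" using ab(5,6) by simp
      ultimately show ?thesis using cfrac_inf_prefix_close[of a b n] unfolding ab(1,2,5) by blast
    qed
    have diam: "diameter (Cyl as) \<le> 1 / real_of_int (continuant as) ^ 2" if "as \<in> W" for as
      using close[OF that] by (intro diameter_le) auto
    have bnd: "bounded (Cyl as)" if "as \<in> W" for as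
    proof (cases "Cyl as = {}")
      case False
      then obtain x where "x \<in> Cyl as" by blast
      then show ?thesis using close[OF that] unfolding bounded_def dist_real_def by blast
    qed simp
    have hW: "h i \<in> W" if "i < card W" for i using h that bij_betwE by fastforce
    have "cf_set A \<subseteq> (\<Union>i. U i)"
    proof
      fix x assume "x \<in> cf_set A"
      then obtain a where a: "x = cfrac_inf a" "\<forall>j. a j \<in> A" unfolding cf_set_def by blast
      have "map a [0..<n] \<in> W" using a unfolding W_def by auto
      then obtain i where i: "i < card W" "h i = map a [0..<n]"
        using h unfolding bij_betw_def by (metis atLeastLessThan_iff imageE)
      then have "x \<in> U i" using a unfolding U_def Cyl_def by auto
      then show "x \<in> (\<Union>i. U i)" by blast
    qed
    moreover have "bounded (U i) \<and> diameter (U i) \<le> r" for i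
    proof (cases "i < card W")
      case True
      have "1 / real_of_int (continuant (h i)) ^ 2 \<le> r"
        using n0[OF nz[OF hW[OF True]]] hW[OF True] n unfolding W_def by auto
      then have "diameter (Cyl (h i)) \<le> r" using diam[OF hW[OF True]] by linarith
      then show ?thesis using True bnd[OF hW[OF True]] by (simp add: U_def)
    qed (use r in \<open>simp add: U_def\<close>)
    ultimately have "p \<le> (\<Sum>i. diam_gauge s (U i))"
      unfolding p_def hausdorff_premeasure_def by (intro INF_lower) auto
    also have "\<dots> = (\<Sum>i\<in>{0..<card W}. diam_gauge s (U i))"
      by (intro suminf_finite) (auto simp: U_def diam_gauge_def)
    also have "\<dots> \<le> (\<Sum>i\<in>{0..<card W}. ennreal (real_of_int (continuant (h i)) powr (- 2 * s)))"
    proof (intro sum_mono)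
      fix i assume i: "i \<in> {0..<card W}"
      then have w: "h i \<in> W" using hW by auto
      have "diameter (Cyl (h i)) powr s \<le> (1 / real_of_int (continuant (h i)) ^ 2) powr s"
        using diam[OF w] bnd[OF w] s(1) by (intro powr_mono2) (auto simp: diameter_ge_0)
      also have "1 / real_of_int (continuant (h i)) ^ 2 = real_of_int (continuant (h i)) powr (- 2)"
        using c1[OF w] by (simp add: powr_minus powr_numeral divide_inverse)
      also have "\<dots> powr s = real_of_int (continuant (h i)) powr (- 2 * s)" by (simp only: powr_powr)
      finally show "diam_gauge s (U i) \<le> ennreal (real_of_int (continuant (h i)) powr (- 2 * s))"
        using i s(1) unfolding U_def diam_gauge_def by (auto intro: ennreal_leI)
    qed
    also have "\<dots> = (\<Sum>as\<in>W. ennreal (real_of_int (continuant as) powr (- 2 * s)))"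
      by (rule sum.reindex_bij_betw[OF h])
    also have "\<dots> = ennreal (\<Sum>as\<in>W. real_of_int (continuant as) powr (- 2 * s))" by (simp add: sum_ennreal)
    finally show ?thesis unfolding W_def .
  qed
  \<comment> \<open>\<open>enn2real\<close> sends infinity to 0, so positivity over the reals needs
    a finite premeasure; the bound at level \<open>n0\<close> supplies this.\<close>
  have ptop: "p \<noteq> top" using main[OF order_refl] by (rule neq_top_trans[OF ennreal_neq_top])
  have "enn2real p > 0" using r(2) ptop unfolding p_def[symmetric]
    by (simp add: enn2real_positive_iff less_top[symmetric] zero_less_iff_neq_zero)
  moreover have "enn2real p \<le> (\<Sum>as\<in>{as. set as \<subseteq> A \<and> length as = n}. real_of_int (continuant as) powr (- 2 * s))"
    if "n \<ge> n0" for n using main[OF that] by (intro enn2real_leI sum_nonneg) auto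
  ultimately show ?thesis using that by blast
qed

text \<open>Pigeonhole over dyadic size classes: continuants of words of length \<open>n\<close> lie
  between exponential bounds, so there are only O(n) classes and one of them carries a share of
  order 1/n of the sum. Constants and the factor n are absorbed by the loss
  \<open>z\<close>.\<close>

lemma exists_block_set:
  assumes A: "finite A" "0 \<notin> A" and z: "0 < z" "z < cf_dim A"
  obtains B l H where "H \<ge> H0" "H \<ge> 1" "B \<subseteq> {as. set as \<subseteq> A \<and> length as = l}"
    "\<And>as. as \<in> B \<Longrightarrow> H powr (1 - z) \<le> real_of_int (continuant as)"
    "\<And>as. as \<in> B \<Longrightarrow> 2 * real_of_int (continuant as) \<le> H"
    "H powr (2 * (cf_dim A - z)) \<le> real (card B)"
proof -
  \<comment> \<open>Half of the loss \<open>z\<close> separates the exponent of the sum from the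
    dimension; the other half pays for the number of classes.\<close>
  define s where "s = cf_dim A - z / 2"
  have s: "0 < s" "s < cf_dim A" using z by (auto simp: s_def)
  obtain c n0 where c: "c > 0" "\<And>n. n \<ge> n0 \<Longrightarrow> c \<le> (\<Sum>as\<in>{as. set as \<subseteq> A \<and> length as = n}. real_of_int (continuant as) powr (- 2 * s))"
    using sum_continuant_powr_ge[OF A s] by blast
  obtain M where M: "\<And>a. a \<in> A \<Longrightarrow> a \<le> M" using A(1) finite_nat_set_iff_bounded_le by auto
  define p where "p = Suc M"
  have p: "M + 1 \<le> 2 ^ p" unfolding p_def using less_exp[of "Suc M"] by simp
  have pow2: "(2::real) ^ j = 2 powr real j" for j by (simp add: powr_realpow)
  have "\<forall>\<^sub>F j in sequentially. (4 * 2 ^ j :: real) \<ge> H0"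
    by real_asymp
  moreover have "\<forall>\<^sub>F j in sequentially. (4 * 2 ^ j :: real) powr (1 - z) \<le> 2 ^ j"
  proof -
    have "\<forall>\<^sub>F j::nat in sequentially. 4 \<le> 2 powr (z * (real j + 2))" using z by real_asymp
    then show ?thesis
    proof eventually_elim
      case (elim j)
      have e: "(4 * 2 ^ j :: real) = 2 powr (real j + 2)" by (simp add: powr_add powr_realpow)
      have "(4 * 2 ^ j :: real) powr (1 - z) * 4 \<le> 2 powr (real j + 2 - z * (real j + 2)) * 2 powr (z * (real j + 2))"
        unfolding e powr_powr by (intro mult_mono elim) (auto simp: algebra_simps)
      also have "\<dots> = 4 * 2 ^ j" unfolding e powr_add[symmetric] by simp
      finally show ?case by simp
    qed
  qed
  moreover have "\<forall>\<^sub>F j in sequentially. (4 * 2 ^ j :: real) powr (2 * (cf_dim A - z)) \<le> c * 2 powr (2 * s * real j) / (real p * (2 * real j + 1) + 1)"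
  proof -
    define K where "K = 4 powr (2 * (cf_dim A - z))"
    have "((\<lambda>j::nat. K * (real p * (2 * real j + 1) + 1) * 2 powr (- z * real j)) \<longlongrightarrow> 0) sequentially"
      using z by real_asymp
    then have "\<forall>\<^sub>F j in sequentially. K * (real p * (2 * real j + 1) + 1) * 2 powr (- z * real j) < c"
      using c(1) by (rule order_tendstoD(2))
    then show ?thesis
    proof eventually_elim
      case (elim j)
      have pos: "real p * (2 * real j + 1) + 1 > 0" by (simp add: add_nonneg_pos)
      have "(4 * 2 ^ j :: real) powr (2 * (cf_dim A - z)) = K * 2 powr (2 * (cf_dim A - z) * real j)"
        unfolding K_def pow2 powr_mult powr_powr by (simp only: mult.commute)
      also have "2 * (cf_dim A - z) * real j = 2 * s * real j + (- z * real j)" by (simp add: s_def algebra_simps)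
      also have "K * 2 powr (2 * s * real j + (- z * real j)) * (real p * (2 * real j + 1) + 1)
          = 2 powr (2 * s * real j) * (K * (real p * (2 * real j + 1) + 1) * 2 powr (- z * real j))"
        unfolding powr_add by (simp only: ac_simps)
      also have "\<dots> \<le> 2 powr (2 * s * real j) * c" using elim by (intro mult_left_mono) auto
      finally have "(4 * 2 ^ j :: real) powr (2 * (cf_dim A - z)) * (real p * (2 * real j + 1) + 1)
          \<le> 2 powr (2 * s * real j) * c" .
      then show ?case using pos by (simp add: le_divide_eq mult.commute)
    qed
  qed
  ultimately have "\<forall>\<^sub>F j in sequentially. (4 * 2 ^ j :: real) \<ge> H0 \<and> (4 * 2 ^ j :: real) powr (1 - z) \<le> 2 ^ j \<and>
     (4 * 2 ^ j :: real) powr (2 * (cf_dim A - z)) \<le> c * 2 powr (2 * s * real j) / (real p * (2 * real j + 1) + 1)"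
    by eventually_elim auto
  \<comment> \<open>From \<open>j0\<close> on, the value H = 4 * 2^j meets all size
    requirements.\<close>
  then obtain j0 where j0: "\<And>j. j \<ge> j0 \<Longrightarrow> (4 * 2 ^ j :: real) \<ge> H0 \<and> (4 * 2 ^ j :: real) powr (1 - z) \<le> 2 ^ j \<and>
     (4 * 2 ^ j :: real) powr (2 * (cf_dim A - z)) \<le> c * 2 powr (2 * s * real j) / (real p * (2 * real j + 1) + 1)"
    unfolding eventually_sequentially by blast
  \<comment> \<open>Length at least 2 * \<open>j0\<close> makes every occurring size exponent at
    least \<open>j0\<close>, by \<open>continuant_growth\<close>.\<close>
  define n where "n = max n0 (2 * j0)"
  define W where "W = {as. set as \<subseteq> A \<and> length as = n}"
  have finW: "finite W" unfolding W_def using A finite_lists_length_eq by blast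
  define g where "g as = floor_log (nat (continuant as))" for as
  define B where "B j = {as\<in>W. g as = j}" for j
  have W: "0 \<notin> set as" "length as = n" "continuant as \<ge> 1" "\<And>a. a \<in> set as \<Longrightarrow> a \<le> M" if "as \<in> W" for as
  proof -
    show "0 \<notin> set as" "length as = n" "\<And>a. a \<in> set as \<Longrightarrow> a \<le> M" using that A M unfolding W_def by auto
    then show "continuant as \<ge> 1" using continuant_ge_1 by blast
  qed
  have g: "2 ^ g as \<le> real_of_int (continuant as)" "real_of_int (continuant as) < 2 * 2 ^ g as" if "as \<in> W" for as
  proof -
    have k: "nat (continuant as) > 0" "real_of_int (continuant as) = real (nat (continuant as))" using W[OF that] by auto
    have "2 ^ g as \<le> nat (continuant as)" "nat (continuant as) < 2 * 2 ^ g as"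
      unfolding g_def using floor_log_exp2_le[OF k(1)] floor_log_exp2_gt[of "nat (continuant as)"] by auto
    then have "real (2 ^ g as) \<le> real (nat (continuant as))" "real (nat (continuant as)) < real (2 * 2 ^ g as)"
      unfolding of_nat_le_iff of_nat_less_iff by auto
    then show "2 ^ g as \<le> real_of_int (continuant as)" "real_of_int (continuant as) < 2 * 2 ^ g as"
      unfolding k(2) by (simp_all only: of_nat_power of_nat_mult of_nat_numeral)
  qed
  have gle: "g as \<le> p * n" if "as \<in> W" for as
  proof -
    have "(2::int) ^ g as \<le> (int M + 1) ^ n"
      using g(1)[OF that] continuant_upper[of as M] W[OF that]
      by (metis of_int_le_iff of_int_numeral of_int_power order_trans)
    also have "\<dots> \<le> (2 ^ p) ^ n"
    proof (rule power_mono)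
      have "int (M + 1) \<le> int (2 ^ p)" using p by (simp only: of_nat_le_iff)
      then show "int M + 1 \<le> 2 ^ p" by simp
    qed simp
    finally have "(2::int) ^ g as \<le> 2 ^ (p * n)" by (simp add: power_mult)
    then show ?thesis by (simp only: power_increasing_iff[of "2::int"])
  qed
  \<comment> \<open>If each of the p n + 1 classes fell short of its equal share, the sum over all
    words would be below \<open>c\<close>.\<close>
  have "\<exists>j. B j \<noteq> {} \<and> c / (real p * real n + 1) \<le> real (card (B j)) * 2 powr (- 2 * s * real j)"
  proof (rule ccontr)
    assume neg: "\<not> ?thesis"
    have lt: "real (card (B j)) * 2 powr (- 2 * s * real j) < c / (real p * real n + 1)" for j
    proof (cases "B j = {}")
      case True
      then show ?thesis using c(1) by (simp add: add_nonneg_pos)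
    qed (use neg in force)
    have "c \<le> (\<Sum>as\<in>W. real_of_int (continuant as) powr (- 2 * s))" unfolding W_def by (rule c(2)) (simp add: n_def)
    also have "\<dots> = (\<Sum>j\<in>{..p * n}. \<Sum>as\<in>B j. real_of_int (continuant as) powr (- 2 * s))"
      unfolding B_def using gle by (intro sum.group[symmetric] finW) auto
    also have "\<dots> \<le> (\<Sum>j\<in>{..p * n}. \<Sum>as\<in>B j. 2 powr (- 2 * s * real j))"
    proof (intro sum_mono)
      fix j as assume "as \<in> B j"
      then have as: "as \<in> W" "g as = j" unfolding B_def by auto
      have "real_of_int (continuant as) powr (- 2 * s) \<le> (2 ^ j) powr (- 2 * s)"
        using g(1)[OF as(1)] as(2) s(1) by (intro powr_mono2') auto
      also have "\<dots> = 2 powr (- 2 * s * real j)" unfolding pow2 powr_powr by (simp only: mult.commute)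
      finally show "real_of_int (continuant as) powr (- 2 * s) \<le> 2 powr (- 2 * s * real j)" .
    qed
    also have "\<dots> = (\<Sum>j\<in>{..p * n}. real (card (B j)) * 2 powr (- 2 * s * real j))" by simp
    also have "\<dots> < (\<Sum>j\<in>{..p * n}. c / (real p * real n + 1))" using lt by (intro sum_strict_mono) auto
    also have "\<dots> = c"
    proof -
      have "real p * real n + 1 \<noteq> 0" by (metis add.commute of_nat_Suc of_nat_mult of_nat_neq_0)
      then show ?thesis by (simp add: field_simps)
    qed
    finally show False by simp
  qed
  then obtain j where j: "B j \<noteq> {}" "c / (real p * real n + 1) \<le> real (card (B j)) * 2 powr (- 2 * s * real j)" by blast
  have "n div 2 \<le> j"
  proof -
    obtain as where as: "as \<in> W" "g as = j" using j(1) unfolding B_def by auto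
    have "(2::real) ^ (n div 2) \<le> real_of_int (continuant as)"
      using continuant_growth[of as] W[OF as(1)] by (metis of_int_le_iff of_int_numeral of_int_power)
    also have "\<dots> < 2 ^ Suc j" using g(2)[OF as(1)] as(2) by simp
    finally have "n div 2 < Suc j" by (subst (asm) power_strict_increasing_iff) auto
    then show ?thesis by simp
  qed
  then have nj: "n \<le> 2 * j + 1" "j0 \<le> j" unfolding n_def by auto
  \<comment> \<open>The class has continuants below 2 * 2^j; the further factor 2 anticipates the
    loss in \<open>continuant_mult_le\<close>.\<close>
  define H where "H = (4 * 2 ^ j :: real)"
  have "H powr (2 * (cf_dim A - z)) \<le> c * 2 powr (2 * s * real j) / (real p * (2 * real j + 1) + 1)"
    using j0[OF nj(2)] unfolding H_def by blast
  also have "\<dots> \<le> c * 2 powr (2 * s * real j) / (real p * real n + 1)"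
    using c(1) nj(1) by (intro divide_left_mono mult_pos_pos add_right_mono mult_left_mono) (auto intro: add_nonneg_pos)
  also have "\<dots> = c / (real p * real n + 1) * 2 powr (2 * s * real j)" by simp
  also have "\<dots> \<le> (real (card (B j)) * 2 powr (- 2 * s * real j)) * 2 powr (2 * s * real j)"
    by (intro mult_right_mono j(2)) auto
  also have "\<dots> = real (card (B j))" by (simp add: mult.assoc flip: powr_add)
  finally have card: "H powr (2 * (cf_dim A - z)) \<le> real (card (B j))" .
  show ?thesis
  proof (rule that[of H "B j" n])
    show "H \<ge> H0" using j0[OF nj(2)] H_def by simp
    have "(1::real) \<le> 2 ^ j" by (rule one_le_power) simp
    then show "H \<ge> 1" unfolding H_def by linarith
    show "B j \<subseteq> {as. set as \<subseteq> A \<and> length as = n}" unfolding B_def W_def by auto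
    show "H powr (1 - z) \<le> real_of_int (continuant as)" if "as \<in> B j" for as
    proof -
      have "as \<in> W" "g as = j" using that unfolding B_def by auto
      moreover have "H powr (1 - z) \<le> 2 ^ j" using j0[OF nj(2)] unfolding H_def by blast
      ultimately show ?thesis using g(1)[of as] by (metis order_trans)
    qed
    show "2 * real_of_int (continuant as) \<le> H" if "as \<in> B j" for as
      using g(2)[of as] that unfolding H_def B_def by auto
  qed (fact card)
qed

section \<open>The large sieve\<close>

definition expsum :: "nat set \<Rightarrow> real \<Rightarrow> complex" where
  "expsum D x = (\<Sum>d\<in>D. cis (2 * pi * real d * x))"

text \<open>Concavity places the sine above its chord on [0, pi/2], which gives even the lower bound
  2 t.\<close>

lemma le_sin_pi_mult: "0 \<le> t \<Longrightarrow> t \<le> 1/2 \<Longrightarrow> t \<le> sin (pi * t)"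
proof -
  assume t: "0 \<le> t" "t \<le> 1/2"
  have "concave_on {0..pi/2} sin"
    unfolding concave_on_def
  proof (rule f''_ge0_imp_convex[where f' = "\<lambda>x. - cos x" and f'' = "\<lambda>x. sin x"])
    show "0 \<le> sin x" if "x \<in> {0..pi/2}" for x using that by (intro sin_ge_zero) auto
  qed (auto intro!: derivative_eq_intros)
  then have "(1 - 2*t) * sin 0 + (2*t) * sin (pi/2) \<le> sin ((1 - 2*t) *\<^sub>R 0 + (2*t) *\<^sub>R (pi/2))"
    using t unfolding concave_on_iff by (metis (no_types, lifting) atLeastAtMost_iff diff_add_cancel diff_ge_0_iff_ge divide_nonneg_pos half_gt_zero_iff le_divide_eq_numeral1(1) less_eq_real_def mult.commute mult_nonneg_nonneg order_refl pi_gt_zero zero_le_numeral)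
  then show ?thesis using t by (simp add: mult.commute)
qed

lemma norm_cis_minus_1: "cmod (cis x - 1) = 2 * \<bar>sin (x / 2)\<bar>"
proof -
  have "(cmod (cis x - 1))\<^sup>2 = (cos x - 1)\<^sup>2 + (sin x)\<^sup>2" by (simp add: cmod_power2)
  also have "\<dots> = 2 - 2 * cos x" using sin_cos_squared_add[of x] by (simp add: power2_eq_square algebra_simps)
  also have "\<dots> = (2 * \<bar>sin (x / 2)\<bar>)\<^sup>2"
    using cos_double_sin[of "x / 2"] by (simp add: power_mult_distrib)
  finally show ?thesis by (rule power2_eq_imp_eq) auto
qed

text \<open>The geometric sum is at most 1 / sin (pi t). Adding both reciprocals replaces the
  distance to the nearest integer and lets the two terms be summed separately.\<close>

lemma norm_geometric_cis_le:
  assumes "0 < t" "t < 1"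
  shows "cmod (\<Sum>n=1..N. cis (2 * pi * real n * t)) \<le> 1 / t + 1 / (1 - t)"
proof -
  define z where "z = cis (2 * pi * t)"
  define s where "s = (\<Sum>n=1..N. cis (2 * pi * real n * t))"
  have s: "s = (\<Sum>n=1..N. z ^ n)" unfolding s_def z_def
    by (intro sum.cong) (simp_all only: Complex.DeMoivre, simp_all add: ac_simps)
  have "(z - 1) * s = z ^ Suc N - z" unfolding s
    by (induction N) (auto simp: algebra_simps)
  then have "cmod (z - 1) * cmod s = cmod (z ^ Suc N - z)" by (simp only: norm_mult[symmetric])
  also have "\<dots> \<le> cmod (z ^ Suc N) + cmod z" by (rule norm_triangle_ineq4)
  also have "\<dots> = 2" by (simp add: z_def norm_power norm_mult)
  finally have "cmod (z - 1) * cmod s \<le> 2" .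
  moreover have sin: "sin (pi * t) > 0" using assms by (intro sin_gt_zero) auto
  moreover have "cmod (z - 1) = 2 * sin (pi * t)" unfolding z_def norm_cis_minus_1 using sin by simp
  ultimately have le: "sin (pi * t) * cmod s \<le> 1" by simp
  show ?thesis
  proof (cases "t \<le> 1/2")
    case True
    then have "t * cmod s \<le> sin (pi * t) * cmod s" using le_sin_pi_mult assms by (intro mult_right_mono) auto
    then have "cmod s \<le> 1 / t" using le assms by (simp add: field_simps)
    then show ?thesis using assms s_def by (simp add: add_increasing2)
  next
    case False
    have "sin (pi * t) = sin (pi * (1 - t))" by (simp add: right_diff_distrib)
    then have "(1 - t) * cmod s \<le> sin (pi * t) * cmod s"
      using le_sin_pi_mult[of "1 - t"] assms False by (intro mult_right_mono) auto
    then have "cmod s \<le> 1 / (1 - t)" using le assms by (simp add: field_simps)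
    then show ?thesis using assms s_def by (simp add: add_increasing)
  qed
qed

text \<open>Scaled by \<open>K\<close>, the points are at least 1 apart and have distinct integer
  parts in 1..K; each 1/t is compared with the reciprocal of its integer part.\<close>

lemma sum_inverse_separated_le:
  fixes Y :: "real set" and K :: nat
  assumes "finite Y" "K > 0" and range: "\<And>t. t \<in> Y \<Longrightarrow> 1 / real K \<le> t \<and> t \<le> 1"
    and sep: "\<And>t u. t \<in> Y \<Longrightarrow> u \<in> Y \<Longrightarrow> t \<noteq> u \<Longrightarrow> 1 / real K \<le> \<bar>t - u\<bar>"
  shows "(\<Sum>t\<in>Y. 1 / t) \<le> real K * harm K"
proof -
  define k where "k t = nat \<lfloor>t * real K\<rfloor>" for t
  have tK: "1 \<le> t * real K" "t * real K \<le> real K" if "t \<in> Y" for t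
    using range[OF that] assms(2) by (auto simp: field_simps)
  have k: "k t \<in> {1..K}" "real (k t) \<le> t * real K" if "t \<in> Y" for t
    using tK[OF that] unfolding k_def by (auto simp: le_nat_iff le_floor_iff nat_le_iff floor_le_iff)
  have inj: "inj_on k Y"
  proof (rule inj_onI, rule ccontr)
    fix t u assume tu: "t \<in> Y" "u \<in> Y" "k t = k u" "t \<noteq> u"
    have fl: "\<lfloor>t * real K\<rfloor> = \<lfloor>u * real K\<rfloor>"
      using tu(3) tK[OF tu(1)] tK[OF tu(2)] unfolding k_def by (subst (asm) eq_nat_nat_iff) auto
    have "\<bar>t * real K - u * real K\<bar> < 1" using fl by linarith
    moreover have "\<bar>t * real K - u * real K\<bar> = \<bar>t - u\<bar> * real K"
      by (simp add: left_diff_distrib[symmetric] abs_mult)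
    moreover have "1 \<le> \<bar>t - u\<bar> * real K" using sep[OF tu(1,2,4)] assms(2) by (simp add: field_simps)
    ultimately show False by linarith
  qed
  have "(\<Sum>t\<in>Y. 1 / t) \<le> (\<Sum>t\<in>Y. real K / real (k t))"
  proof (rule sum_mono)
    fix t assume t: "t \<in> Y"
    have "0 < k t" "0 < t" using k[OF t] range[OF t] assms(2) by (auto intro: less_le_trans[of 0 "1 / real K"])
    then show "1 / t \<le> real K / real (k t)" using k(2)[OF t] by (simp add: field_simps)
  qed
  also have "\<dots> = (\<Sum>j\<in>k ` Y. real K / real j)" using inj by (simp add: sum.reindex)
  also have "\<dots> \<le> (\<Sum>j\<in>{1..K}. real K / real j)"
    using k by (intro sum_mono2) auto
  also have "\<dots> = real K * harm K" by (simp add: harm_def sum_distrib_left divide_inverse)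
  finally show ?thesis .
qed

text \<open>By duality it suffices to bound the Gram matrix of the points, which the Schur test does at the
  cost of a logarithm.\<close>

lemma large_sieve:
  fixes P :: "real set" and K N :: nat
  assumes "finite P" "K > 0" "D \<subseteq> {1..N}"
    and sep: "\<And>x y. x \<in> P \<Longrightarrow> y \<in> P \<Longrightarrow> x \<noteq> y \<Longrightarrow> 1 / real K \<le> \<bar>x - y\<bar> \<and> \<bar>x - y\<bar> \<le> 1 - 1 / real K"
  shows "(\<Sum>x\<in>P. (cmod (expsum D x))\<^sup>2) \<le> (real N + 4 * (real K * harm K)) * real (card D)"
proof -
  \<comment> \<open>The entry of the Gram matrix of the exponentials on 1..N at two points with
    difference \<open>t\<close>.\<close>
  define \<kappa> where "\<kappa> t = (\<Sum>n=1..N. cis (2 * pi * real n * t))" for t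
  define R where "R = real N + 4 * (real K * harm K)"
  have R0: "R \<ge> 0" unfolding R_def by (simp add: harm_nonneg)
  have K1: "1 / real K > 0" using assms(2) by simp
  have \<kappa>_minus: "cmod (\<kappa> (- t)) = cmod (\<kappa> t)" for t
  proof -
    have "\<kappa> (- t) = cnj (\<kappa> t)" unfolding \<kappa>_def by (simp add: cis_cnj)
    then show ?thesis by simp
  qed
  have row: "(\<Sum>y\<in>P. cmod (\<kappa> (x - y))) \<le> R" if x: "x \<in> P" for x
  proof -
    \<comment> \<open>On either side of \<open>x\<close> the differences lie in (0, 1). The
      separation is modulo 1, so it serves both reciprocals.\<close>
    define Pl Pr where "Pl = {y\<in>P. y < x}" and "Pr = {y\<in>P. x < y}"
    have P: "P = insert x (Pl \<union> Pr)" "x \<notin> Pl \<union> Pr" "Pl \<inter> Pr = {}" "finite Pl" "finite Pr"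
      using x assms(1) unfolding Pl_def Pr_def by auto
    have seps: "1 / real K \<le> \<bar>y - y'\<bar>" if "y \<in> P" "y' \<in> P" "y \<noteq> y'" for y y'
      using sep[OF that] by simp
    have l: "(\<Sum>y\<in>Pl. cmod (\<kappa> (x - y))) \<le> 2 * (real K * harm K)"
    proof -
      have "(\<Sum>y\<in>Pl. cmod (\<kappa> (x - y))) \<le> (\<Sum>y\<in>Pl. 1 / (x - y) + 1 / (1 - (x - y)))"
      proof (rule sum_mono)
        fix y assume "y \<in> Pl"
        then have "y \<in> P" "y \<noteq> x" "0 < x - y" unfolding Pl_def by auto
        then have "0 < x - y" "x - y < 1" using sep[OF x, of y] K1 by linarith+
        then show "cmod (\<kappa> (x - y)) \<le> 1 / (x - y) + 1 / (1 - (x - y))"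
          unfolding \<kappa>_def by (rule norm_geometric_cis_le)
      qed
      also have "\<dots> = (\<Sum>t\<in>(\<lambda>y. x - y) ` Pl. 1 / t) + (\<Sum>t\<in>(\<lambda>y. 1 - (x - y)) ` Pl. 1 / t)"
        by (simp add: sum.distrib sum.reindex inj_on_def)
      also have "\<dots> \<le> real K * harm K + real K * harm K"
      proof (intro add_mono sum_inverse_separated_le)
        fix t assume "t \<in> (\<lambda>y. x - y) ` Pl"
        then obtain y where y: "y \<in> P" "y \<noteq> x" "0 < x - y" "t = x - y" unfolding Pl_def by auto
        then show "1 / real K \<le> t \<and> t \<le> 1" using sep[OF x, of y] K1 by linarith
      next
        fix t assume "t \<in> (\<lambda>y. 1 - (x - y)) ` Pl"
        then obtain y where y: "y \<in> P" "y \<noteq> x" "0 < x - y" "t = 1 - (x - y)" unfolding Pl_def by auto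
        then show "1 / real K \<le> t \<and> t \<le> 1" using sep[OF x, of y] K1 by linarith
      qed (use P(4,5) assms(2) seps in \<open>auto simp: Pl_def\<close>)
      finally show ?thesis by linarith
    qed
    have r: "(\<Sum>y\<in>Pr. cmod (\<kappa> (x - y))) \<le> 2 * (real K * harm K)"
    proof -
      have "(\<Sum>y\<in>Pr. cmod (\<kappa> (x - y))) \<le> (\<Sum>y\<in>Pr. 1 / (y - x) + 1 / (1 - (y - x)))"
      proof (rule sum_mono)
        fix y assume "y \<in> Pr"
        then have "y \<in> P" "y \<noteq> x" "0 < y - x" unfolding Pr_def by auto
        then have "0 < y - x" "y - x < 1" using sep[OF x, of y] K1 by linarith+
        then have "cmod (\<kappa> (y - x)) \<le> 1 / (y - x) + 1 / (1 - (y - x))"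
          unfolding \<kappa>_def by (rule norm_geometric_cis_le)
        then show "cmod (\<kappa> (x - y)) \<le> 1 / (y - x) + 1 / (1 - (y - x))" using \<kappa>_minus[of "y - x"] by simp
      qed
      also have "\<dots> = (\<Sum>t\<in>(\<lambda>y. y - x) ` Pr. 1 / t) + (\<Sum>t\<in>(\<lambda>y. 1 - (y - x)) ` Pr. 1 / t)"
        by (simp add: sum.distrib sum.reindex inj_on_def)
      also have "\<dots> \<le> real K * harm K + real K * harm K"
      proof (intro add_mono sum_inverse_separated_le)
        fix t assume "t \<in> (\<lambda>y. y - x) ` Pr"
        then obtain y where y: "y \<in> P" "y \<noteq> x" "0 < y - x" "t = y - x" unfolding Pr_def by auto
        then show "1 / real K \<le> t \<and> t \<le> 1" using sep[OF x, of y] K1 by linarith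
      next
        fix t assume "t \<in> (\<lambda>y. 1 - (y - x)) ` Pr"
        then obtain y where y: "y \<in> P" "y \<noteq> x" "0 < y - x" "t = 1 - (y - x)" unfolding Pr_def by auto
        then show "1 / real K \<le> t \<and> t \<le> 1" using sep[OF x, of y] K1 by linarith
      qed (use P(4,5) assms(2) seps in \<open>auto simp: Pr_def\<close>)
      finally show ?thesis by linarith
    qed
    have "(\<Sum>y\<in>P. cmod (\<kappa> (x - y))) = cmod (\<kappa> 0) + ((\<Sum>y\<in>Pl. cmod (\<kappa> (x - y))) + (\<Sum>y\<in>Pr. cmod (\<kappa> (x - y))))"
      using P(2-5) by (subst P(1)) (simp add: sum.union_disjoint)
    also have "cmod (\<kappa> 0) = real N" unfolding \<kappa>_def by simp
    finally show ?thesis using l r unfolding R_def by simp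
  qed
  \<comment> \<open>With the conjugate values as coefficients, the linear form in
    \<open>expsum\<close> becomes the very sum \<open>Z\<close> to be bounded.\<close>
  define c where "c x = cnj (expsum D x)" for x
  define Z where "Z = (\<Sum>x\<in>P. (cmod (c x))\<^sup>2)"
  define g where "g n = (\<Sum>x\<in>P. c x * cis (2 * pi * real n * x))" for n :: nat
  have Z0: "Z \<ge> 0" unfolding Z_def by (simp add: sum_nonneg)
  have finD: "finite D" using assms(3) finite_subset by blast
  have "complex_of_real Z = (\<Sum>x\<in>P. c x * expsum D x)"
    unfolding Z_def c_def of_real_sum by (intro sum.cong refl) (simp only: complex_mod_cnj complex_norm_square mult.commute)
  also have "\<dots> = (\<Sum>x\<in>P. \<Sum>d\<in>D. c x * cis (2 * pi * real d * x))"
    unfolding expsum_def by (simp add: sum_distrib_left)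
  also have "\<dots> = (\<Sum>d\<in>D. g d)" unfolding g_def by (rule sum.swap)
  finally have "Z = cmod (\<Sum>d\<in>D. g d)" using Z0 by (metis abs_of_nonneg norm_of_real)
  also have "\<dots> \<le> (\<Sum>d\<in>D. cmod (g d))" by (rule norm_sum)
  finally have "Z\<^sup>2 \<le> (\<Sum>d\<in>D. cmod (g d) * 1)\<^sup>2" using Z0 by (simp add: power_mono)
  also have "\<dots> \<le> (\<Sum>d\<in>D. (cmod (g d))\<^sup>2) * (\<Sum>d\<in>D. 1\<^sup>2)" by (rule Cauchy_Schwarz_ineq_sum)
  also have "\<dots> \<le> (\<Sum>n=1..N. (cmod (g n))\<^sup>2) * real (card D)"
    using assms(3) by (simp add: mult_right_mono sum_mono2)
  \<comment> \<open>The dual inequality: the quadratic form of the Gram matrix is controlled by the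
    bound \<open>R\<close> on its row sums.\<close>
  also have "(\<Sum>n=1..N. (cmod (g n))\<^sup>2) \<le> R * Z"
  proof -
    have "complex_of_real (\<Sum>n=1..N. (cmod (g n))\<^sup>2) = (\<Sum>n=1..N. g n * cnj (g n))"
      unfolding of_real_sum by (intro sum.cong refl) (simp only: complex_norm_square)
    also have "\<dots> = (\<Sum>n=1..N. \<Sum>x\<in>P. \<Sum>y\<in>P. (c x * cnj (c y)) * cis (2 * pi * real n * (x - y)))"
    proof (intro sum.cong refl)
      fix n :: nat
      have e: "cis (2 * pi * real n * (x - y)) = cis (2 * pi * real n * x) * cnj (cis (2 * pi * real n * y))" for x y
        by (simp add: cis_cnj cis_mult right_diff_distrib)
      show "g n * cnj (g n) = (\<Sum>x\<in>P. \<Sum>y\<in>P. (c x * cnj (c y)) * cis (2 * pi * real n * (x - y)))"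
        unfolding g_def cnj_sum sum_product e by (intro sum.cong refl) (simp add: ac_simps)
    qed
    also have "\<dots> = (\<Sum>x\<in>P. \<Sum>y\<in>P. (c x * cnj (c y)) * \<kappa> (x - y))"
      unfolding \<kappa>_def sum_distrib_left
      by (subst sum.swap, intro sum.cong refl, rule sum.swap)
    finally have eq: "complex_of_real (\<Sum>n=1..N. (cmod (g n))\<^sup>2) = (\<Sum>x\<in>P. \<Sum>y\<in>P. (c x * cnj (c y)) * \<kappa> (x - y))" .
    have "(\<Sum>n=1..N. (cmod (g n))\<^sup>2) = cmod (complex_of_real (\<Sum>n=1..N. (cmod (g n))\<^sup>2))"
      by (subst norm_of_real) (simp add: sum_nonneg)
    also have "\<dots> \<le> (\<Sum>x\<in>P. \<Sum>y\<in>P. cmod ((c x * cnj (c y)) * \<kappa> (x - y)))"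
      unfolding eq by (intro sum_norm_le norm_sum)
    \<comment> \<open>Schur test: the product of two coefficients is at most the mean of their
      squares, and by symmetry both halves reduce to row sums.\<close>
    also have "\<dots> \<le> (\<Sum>x\<in>P. \<Sum>y\<in>P. ((cmod (c x))\<^sup>2 * cmod (\<kappa> (x - y)) + (cmod (c y))\<^sup>2 * cmod (\<kappa> (x - y))) / 2)"
    proof (intro sum_mono)
      fix x y
      have "cmod (c x) * cmod (c y) \<le> ((cmod (c x))\<^sup>2 + (cmod (c y))\<^sup>2) / 2"
        using sum_squares_bound[of "cmod (c x)" "cmod (c y)"] by simp
      then have "cmod (c x) * cmod (c y) * cmod (\<kappa> (x - y)) \<le> ((cmod (c x))\<^sup>2 + (cmod (c y))\<^sup>2) / 2 * cmod (\<kappa> (x - y))"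
        by (intro mult_right_mono) auto
      then show "cmod ((c x * cnj (c y)) * \<kappa> (x - y)) \<le> ((cmod (c x))\<^sup>2 * cmod (\<kappa> (x - y)) + (cmod (c y))\<^sup>2 * cmod (\<kappa> (x - y))) / 2"
        by (simp add: norm_mult algebra_simps)
    qed
    also have "\<dots> = ((\<Sum>x\<in>P. \<Sum>y\<in>P. (cmod (c x))\<^sup>2 * cmod (\<kappa> (x - y))) + (\<Sum>x\<in>P. \<Sum>y\<in>P. (cmod (c y))\<^sup>2 * cmod (\<kappa> (x - y)))) / 2"
      by (simp add: sum.distrib sum_divide_distrib add_divide_distrib)
    also have "(\<Sum>x\<in>P. \<Sum>y\<in>P. (cmod (c y))\<^sup>2 * cmod (\<kappa> (x - y))) = (\<Sum>x\<in>P. \<Sum>y\<in>P. (cmod (c x))\<^sup>2 * cmod (\<kappa> (x - y)))"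
    proof (subst sum.swap, intro sum.cong refl)
      fix x y
      show "(cmod (c x))\<^sup>2 * cmod (\<kappa> (y - x)) = (cmod (c x))\<^sup>2 * cmod (\<kappa> (x - y))"
        using \<kappa>_minus[of "x - y"] by simp
    qed
    also have "((\<Sum>x\<in>P. \<Sum>y\<in>P. (cmod (c x))\<^sup>2 * cmod (\<kappa> (x - y))) + (\<Sum>x\<in>P. \<Sum>y\<in>P. (cmod (c x))\<^sup>2 * cmod (\<kappa> (x - y)))) / 2
       = (\<Sum>x\<in>P. (cmod (c x))\<^sup>2 * (\<Sum>y\<in>P. cmod (\<kappa> (x - y))))"
      unfolding sum_distrib_left by (simp only: field_sum_of_halves add_divide_distrib)
    also have "\<dots> \<le> (\<Sum>x\<in>P. (cmod (c x))\<^sup>2 * R)"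
      using row by (intro sum_mono mult_left_mono) auto
    also have "\<dots> = R * Z" unfolding Z_def by (simp add: sum_distrib_left mult.commute)
    finally show ?thesis .
  qed
  finally have "Z * Z \<le> (R * real (card D)) * Z" by (simp add: power2_eq_square mult_right_mono ac_simps)
  then have "Z \<le> R * real (card D)"
    using Z0 R0 by (cases "Z = 0") (auto simp: mult_le_cancel_right)
  then show ?thesis unfolding Z_def c_def R_def by simp
qed

section \<open>The divisor bound\<close>

lemma Suc_le_powr:
  assumes "\<epsilon> > 0"
  shows "real (Suc k) \<le> (1 + 1 / \<epsilon>) * exp (\<epsilon> * real k)"
proof -
  have "real k = (\<epsilon> * real k) / \<epsilon>" using assms by simp
  also have "\<dots> \<le> exp (\<epsilon> * real k) / \<epsilon>"
    using assms exp_ge_add_one_self[of "\<epsilon> * real k"] by (intro divide_right_mono) linarith+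
  finally have "real k \<le> exp (\<epsilon> * real k) / \<epsilon>" .
  moreover have "1 \<le> exp (\<epsilon> * real k)" using assms by simp
  ultimately have "1 + real k \<le> exp (\<epsilon> * real k) + exp (\<epsilon> * real k) / \<epsilon>" by linarith
  then show ?thesis by (simp add: distrib_right)
qed

lemma card_divisors_mult_prime_power:
  fixes p m :: nat
  assumes "prime p" "\<not> p dvd m" "m > 0"
  shows "card {d. d dvd p ^ k * m} \<le> Suc k * card {d. d dvd m}"
proof -
  have fin: "finite ({..k} \<times> {d. d dvd m})" using assms by auto
  have "{d. d dvd p ^ k * m} \<subseteq> (\<lambda>(i, d). p ^ i * d) ` ({..k} \<times> {d. d dvd m})"
  proof
    fix d assume "d \<in> {d. d dvd p ^ k * m}"
    then obtain a b where "d = a * b" "a dvd p ^ k" "b dvd m" using division_decomp by blast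
    moreover then obtain i where "i \<le> k" "a = p ^ i" using divides_primepow_nat[OF assms(1)] by auto
    ultimately show "d \<in> (\<lambda>(i, d). p ^ i * d) ` ({..k} \<times> {d. d dvd m})" by auto
  qed
  from surj_card_le[OF fin this] show ?thesis by (simp add: card_cartesian_product)
qed

text \<open>A prime power p^k contributes k + 1 divisors. For p >= P this is at most p^(k
  \<epsilon>), because \<epsilon> ln p >= 1; each prime below P costs a further constant, whence the
  exponent.\<close>

lemma divisor_bound_aux:
  fixes \<epsilon> :: real
  assumes "\<epsilon> > 0" "n > 0" "real P \<ge> exp (1 / \<epsilon>)"
  shows "real (card {d. d dvd n}) \<le> (1 + 1 / (\<epsilon> * ln 2)) ^ card {p. prime p \<and> p < P \<and> p dvd n} * real n powr \<epsilon>"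
  using assms(2)
proof (induction n rule: less_induct)
  case (less n)
  define C where "C = 1 + 1 / (\<epsilon> * ln 2)"
  have C: "C \<ge> 1" using assms by (simp add: C_def)
  show ?case
  proof (cases "n = 1")
    case True
    then show ?thesis using C by (simp add: C_def[symmetric])
  next
    case False
    then obtain p where p: "prime p" "p dvd n" using prime_factor_nat by blast
    define k where "k = multiplicity p n"
    obtain m where m: "n = p ^ k * m" "\<not> p dvd m"
      using multiplicity_decompose'[of n p] p less.prems k_def prime_gt_1_nat[of p] by auto
    have k: "k \<ge> 1" using m p by (cases k) auto
    have m0: "m > 0" using m less.prems by (cases m) auto
    have p2: "p \<ge> 2" using p prime_ge_2_nat by auto
    have "p ^ k \<ge> 2 ^ 1" using p2 k by (metis le_trans power_increasing power_mono one_le_numeral zero_le)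
    then have "m < n" using m m0 by simp
    define S where "S x = {q. prime q \<and> q < P \<and> q dvd x}" for x
    have finS: "finite (S x)" for x unfolding S_def by (rule finite_subset[of _ "{..<P}"]) auto
    have sub: "S m \<subseteq> S n" unfolding S_def m(1) by auto
    have IH: "real (card {d. d dvd m}) \<le> C ^ card (S m) * real m powr \<epsilon>"
      using less.IH[OF \<open>m < n\<close> m0] unfolding C_def S_def .
    have "real (card {d. d dvd n}) \<le> real (Suc k * card {d. d dvd m})"
      using card_divisors_mult_prime_power[OF p(1) m(2) m0, of k] unfolding m(1) of_nat_le_iff .
    also have "\<dots> = real (Suc k) * real (card {d. d dvd m})" by (rule of_nat_mult)
    also have "\<dots> \<le> real (Suc k) * (C ^ card (S m) * real m powr \<epsilon>)" by (intro mult_left_mono IH) auto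
    also have "\<dots> \<le> C ^ card (S n) * real (p ^ k) powr \<epsilon> * real m powr \<epsilon>"
    proof -
      have pk: "real (p ^ k) powr \<epsilon> = exp (\<epsilon> * ln (real p) * real k)" 
        using p2 by (simp add: powr_def ln_realpow ac_simps)
      have "real (Suc k) * C ^ card (S m) \<le> C ^ card (S n) * real (p ^ k) powr \<epsilon>"
      proof (cases "p < P")
        case True
        then have "p \<in> S n" "p \<notin> S m" using p m unfolding S_def by auto
        then have "card (S m) < card (S n)" using sub finS by (intro psubset_card_mono) auto
        then have c: "C * C ^ card (S m) \<le> C ^ card (S n)"
          using C power_increasing[of "Suc (card (S m))" "card (S n)" C] by simp
        have "real (Suc k) \<le> C * exp (\<epsilon> * ln 2 * real k)"
          using Suc_le_powr[of "\<epsilon> * ln 2" k] assms unfolding C_def by simp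
        also have "\<dots> \<le> C * exp (\<epsilon> * ln (real p) * real k)"
          using p2 C assms by (intro mult_left_mono) (auto intro!: mult_right_mono)
        finally have "real (Suc k) \<le> C * real (p ^ k) powr \<epsilon>" unfolding pk .
        then have "real (Suc k) * C ^ card (S m) \<le> (C * real (p ^ k) powr \<epsilon>) * C ^ card (S m)"
          using C by (intro mult_right_mono) auto
        also have "\<dots> = (C * C ^ card (S m)) * real (p ^ k) powr \<epsilon>" by simp
        also have "\<dots> \<le> C ^ card (S n) * real (p ^ k) powr \<epsilon>" using c by (intro mult_right_mono) auto
        finally show ?thesis .
      next
        case False
        then have "exp (1 / \<epsilon>) \<le> real p" using assms(3) by linarith
        then have "1 / \<epsilon> \<le> ln (real p)" using p2 by (simp add: ln_ge_iff)
        then have "1 \<le> \<epsilon> * ln (real p)" using assms by (simp add: field_simps)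
        then have "1 * real k \<le> \<epsilon> * ln (real p) * real k" by (intro mult_right_mono) auto
        then have "real (Suc k) \<le> exp (\<epsilon> * ln (real p) * real k)"
          using exp_ge_add_one_self[of "\<epsilon> * ln (real p) * real k"] unfolding of_nat_Suc by linarith
        moreover have "C ^ card (S m) \<le> C ^ card (S n)"
          using C sub finS by (intro power_increasing card_mono) auto
        ultimately have "real (Suc k) * C ^ card (S m) \<le> real (p ^ k) powr \<epsilon> * C ^ card (S n)"
          using C unfolding pk by (intro mult_mono) auto
        then show ?thesis by (simp add: mult.commute)
      qed
      then show ?thesis by (simp only: mult.assoc[symmetric]) (intro mult_right_mono, auto)
    qed
    also have "\<dots> = C ^ card (S n) * real n powr \<epsilon>" using m by (simp add: powr_mult)
    finally show ?thesis unfolding C_def S_def .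
  qed
qed

lemma divisor_bound:
  fixes \<epsilon> :: real
  assumes "\<epsilon> > 0"
  obtains C where "C > 0" "\<And>n. n > 0 \<Longrightarrow> real (card {d. d dvd n}) \<le> C * real n powr \<epsilon>"
proof -
  obtain P :: nat where P: "real P \<ge> exp (1 / \<epsilon>)" using real_arch_simple by blast
  define C where "C = 1 + 1 / (\<epsilon> * ln 2)"
  have C: "C \<ge> 1" using assms by (simp add: C_def)
  have "real (card {d. d dvd n}) \<le> C ^ P * real n powr \<epsilon>" if "n > 0" for n
  proof -
    have "card {p. prime p \<and> p < P \<and> p dvd n} \<le> card {..<P}" by (intro card_mono) auto
    then have "C ^ card {p. prime p \<and> p < P \<and> p dvd n} \<le> C ^ P" using C by (intro power_increasing) auto
    then show ?thesis using divisor_bound_aux[OF assms that P] unfolding C_def[symmetric]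
      by (meson mult_right_mono order_trans powr_ge_zero)
  qed
  moreover have "C ^ P > 0" using C by simp
  ultimately show ?thesis using that by blast
qed

section \<open>Energies at primitive fractions\<close>

definition cong_pairs :: "nat set \<Rightarrow> nat \<Rightarrow> nat" where
  "cong_pairs D m = card {(d, d'). d \<in> D \<and> d' \<in> D \<and> d mod m = d' mod m}"

text \<open>The Fourier energy of \<open>D\<close> at the fractions of exact denominator
  \<open>q\<close>. For q = 1 the only fraction is 0/1, and the value is \<open>card D\<close>
  squared.\<close>

definition primitive_energy :: "nat set \<Rightarrow> nat \<Rightarrow> real" where
  "primitive_energy D q = (\<Sum>a | a < q \<and> coprime a q. (cmod (expsum D (real a / real q)))\<^sup>2)"

lemma primitive_energy_nonneg: "primitive_energy D q \<ge> 0"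
  unfolding primitive_energy_def by (intro sum_nonneg) auto

text \<open>Orthogonality of the additive characters modulo \<open>m\<close>.\<close>

lemma sum_cis_residues:
  assumes "m > 0"
  shows "(\<Sum>u<m. cis (2 * pi * (real d - real d') * (real u / real m))) = (if d mod m = d' mod m then of_nat m else 0)"
proof -
  define z where "z = cis (2 * pi * ((real d - real d') / real m))"
  have eq: "(\<Sum>u<m. cis (2 * pi * (real d - real d') * (real u / real m))) = (\<Sum>u<m. z ^ u)"
    unfolding z_def Complex.DeMoivre by (intro sum.cong refl arg_cong[where f = cis]) simp
  have zm: "z ^ m = 1"
  proof -
    have "z ^ m = cis (2 * pi * (real d - real d'))"
      unfolding z_def Complex.DeMoivre using assms by (intro arg_cong[where f = cis]) simp
    also have "\<dots> = 1" by (intro cis_multiple_2pi) auto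
    finally show ?thesis .
  qed
  show ?thesis
  proof (cases "d mod m = d' mod m")
    case True
    then have "int m dvd int d - int d'" by (metis mod_eq_dvd_iff zmod_int)
    then obtain k where k: "int d - int d' = int m * k" by blast
    have "real d - real d' = real_of_int (int d - int d')" by simp
    also have "\<dots> = real m * of_int k" unfolding k by simp
    finally have "(real d - real d') / real m = of_int k" using assms by simp
    then have "z = 1" unfolding z_def by (simp add: cis_multiple_2pi)
    then show ?thesis using eq True by simp
  next
    case False
    have "z \<noteq> 1"
    proof
      assume "z = 1"
      then have "cos (2 * pi * ((real d - real d') / real m)) = 1" unfolding z_def by (simp add: complex_eq_iff)
      then obtain k :: int where "2 * pi * ((real d - real d') / real m) = of_int k * 2 * pi"
        using cos_one_2pi_int by auto
      then have "(2 * pi) * ((real d - real d') / real m) = (2 * pi) * of_int k" by (simp only: mult_ac)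
      then have "(real d - real d') / real m = of_int k" by (subst (asm) mult_left_cancel) auto
      then have "real d - real d' = real m * of_int k" using assms by (simp add: field_simps)
      then have "real_of_int (int d - int d') = real_of_int (int m * k)" by simp
      then have "int d - int d' = int m * k" by (simp only: of_int_eq_iff)
      then have "int m dvd int d - int d'" by simp
      then have "int d mod int m = int d' mod int m" by (simp add: mod_eq_dvd_iff)
      with False show False by (metis of_nat_eq_iff zmod_int)
    qed
    then have "(\<Sum>u<m. z ^ u) = 0" using geometric_sum[of z m] zm by simp
    then show ?thesis using eq False by simp
  qed
qed

text \<open>Parseval: after the squares are expanded, orthogonality leaves the pairs congruent
  modulo \<open>m\<close>.\<close>

lemma cong_pairs_eq_sum:
  assumes "finite D" "m > 0"
  shows "real m * real (cong_pairs D m) = (\<Sum>u<m. (cmod (expsum D (real u / real m)))\<^sup>2)"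
proof -
  have "complex_of_real (\<Sum>u<m. (cmod (expsum D (real u / real m)))\<^sup>2)
      = (\<Sum>u<m. \<Sum>d\<in>D. \<Sum>d'\<in>D. cis (2 * pi * (real d - real d') * (real u / real m)))"
    unfolding of_real_sum
  proof (intro sum.cong refl)
    fix u
    have e: "cis (2 * pi * (real d - real d') * (real u / real m))
        = cis (2 * pi * real d * (real u / real m)) * cnj (cis (2 * pi * real d' * (real u / real m)))" for d d'
      by (simp add: cis_cnj cis_mult algebra_simps diff_divide_distrib)
    show "complex_of_real ((cmod (expsum D (real u / real m)))\<^sup>2)
        = (\<Sum>d\<in>D. \<Sum>d'\<in>D. cis (2 * pi * (real d - real d') * (real u / real m)))"
      unfolding complex_norm_square expsum_def cnj_sum sum_product e ..
  qed
  also have "\<dots> = (\<Sum>d\<in>D. \<Sum>u<m. \<Sum>d'\<in>D. cis (2 * pi * (real d - real d') * (real u / real m)))"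
    by (rule sum.swap)
  also have "\<dots> = (\<Sum>d\<in>D. \<Sum>d'\<in>D. \<Sum>u<m. cis (2 * pi * (real d - real d') * (real u / real m)))"
    by (rule sum.cong[OF refl], rule sum.swap)
  also have "\<dots> = (\<Sum>d\<in>D. \<Sum>d'\<in>D. if d mod m = d' mod m then of_nat m else 0)"
    unfolding sum_cis_residues[OF assms(2)] ..
  also have "\<dots> = (\<Sum>p\<in>D\<times>D. if fst p mod m = snd p mod m then of_nat m else 0)"
    by (simp add: sum.cartesian_product case_prod_beta)
  also have "\<dots> = (\<Sum>p\<in>{p\<in>D\<times>D. fst p mod m = snd p mod m}. of_nat m)"
    using assms(1) by (subst sum.inter_filter[symmetric]) auto
  also have "{p\<in>D\<times>D. fst p mod m = snd p mod m} = {(d, d'). d \<in> D \<and> d' \<in> D \<and> d mod m = d' mod m}" by auto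
  finally have "complex_of_real (\<Sum>u<m. (cmod (expsum D (real u / real m)))\<^sup>2) = complex_of_real (real m * real (cong_pairs D m))"
    unfolding cong_pairs_def by simp
  then show ?thesis by (simp only: of_real_eq_iff)
qed

text \<open>Each u/m has one reduced form, and its denominator divides \<open>m\<close>.\<close>

lemma sum_fractions_by_denominator:
  fixes f :: "real \<Rightarrow> real"
  assumes "m > 0"
  shows "(\<Sum>u<m. f (real u / real m)) = (\<Sum>q | q dvd m. \<Sum>a | a < q \<and> coprime a q. f (real a / real q))"
proof -
  have fin: "finite {q. q dvd m}" using assms by simp
  have "(\<Sum>q | q dvd m. \<Sum>a | a < q \<and> coprime a q. f (real a / real q))
     = (\<Sum>p\<in>(SIGMA q:{q. q dvd m}. {a. a < q \<and> coprime a q}). f (real (snd p) / real (fst p)))"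
    using fin by (subst sum.Sigma) (auto simp: case_prod_beta)
  also have "\<dots> = (\<Sum>u<m. f (real u / real m))"
  \<comment> \<open>\<open>gcd 0 m\<close> is \<open>m\<close>, so u = 0 corresponds to the pair (1,
    0).\<close>
  proof (rule sum.reindex_bij_witness[where i = "\<lambda>u. (m div gcd u m, u div gcd u m)" and j = "\<lambda>p. snd p * (m div fst p)"])
    fix p assume "p \<in> (SIGMA q:{q. q dvd m}. {a. a < q \<and> coprime a q})"
    then obtain q a where p: "p = (q, a)" "q dvd m" "a < q" "coprime a q" by auto
    then obtain k where k: "m = q * k" by blast
    have kq: "k > 0" "q > 0" using assms k p by auto
    have g: "gcd (a * k) m = k"
    proof -
      have "gcd (k * a) (k * q) = k * gcd a q" by (metis gcd_mult_distrib_nat)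
      moreover have "gcd a q = 1" using p(4) by (rule coprime_imp_gcd_eq_1)
      ultimately show ?thesis unfolding k by (simp only: mult.commute[of a k] mult.commute[of q k] mult_1_right)
    qed
    show "(m div gcd (snd p * (m div fst p)) m, snd p * (m div fst p) div gcd (snd p * (m div fst p)) m) = p"
      using p(1) k kq g by simp
    show "snd p * (m div fst p) \<in> {..<m}" using p k kq by simp
    show "f (real (snd p * (m div fst p)) / real m) = f (real (snd p) / real (fst p))"
      using p k kq by simp
  next
    fix u assume u: "u \<in> {..<m}"
    have g: "gcd u m > 0" using assms by simp
    have "coprime (u div gcd u m) (m div gcd u m)" using assms by (intro div_gcd_coprime) auto
    moreover have "u div gcd u m < m div gcd u m"
      using u g by (metis dvd_div_mult_self gcd_dvd1 gcd_dvd2 lessThan_iff mult_less_cancel2)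
    moreover have "m div gcd u m dvd m" by (metis dvd_div_mult_self dvd_triv_left gcd_dvd2)
    ultimately show "(m div gcd u m, u div gcd u m) \<in> (SIGMA q:{q. q dvd m}. {a. a < q \<and> coprime a q})" by auto
    show "snd (m div gcd u m, u div gcd u m) * (m div fst (m div gcd u m, u div gcd u m)) = u"
    proof -
      obtain k where "m = gcd u m * k" using gcd_dvd2 by blast
      then have "m div (m div gcd u m) = gcd u m" using assms g
        by (metis mult_0_right nonzero_mult_div_cancel_left nonzero_mult_div_cancel_right less_nat_zero_code)
      then show ?thesis by simp
    qed
  qed
  finally show ?thesis ..
qed

lemma cong_pairs_eq_energy:
  assumes "finite D" "m > 0"
  shows "real m * real (cong_pairs D m) = (\<Sum>q | q dvd m. primitive_energy D q)"
  unfolding cong_pairs_eq_sum[OF assms] primitive_energy_def by (rule sum_fractions_by_denominator[OF assms(2)])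

text \<open>With k = R div q, the multiples q (k + 1), ..., q (2 k) lie in the range, and R <= 2 q k
  because k >= 1.\<close>

lemma card_multiples_ge:
  assumes "1 \<le> q" "q \<le> R"
  shows "real R / (2 * real q) \<le> real (card {m\<in>{R<..2*R}. q dvd m})"
proof -
  define k where "k = R div q"
  have k1: "k \<ge> 1" using assms unfolding k_def by (metis One_nat_def Suc_leI div_greater_zero_iff le_less_trans less_le_not_le nat_less_le neq0_conv not_one_le_zero)
  have kR: "q * k \<le> R" "R < q * (k + 1)" unfolding k_def using assms dividend_less_times_div[of q R] by auto
  have "(\<lambda>j. q * (k + j)) ` {1..k} \<subseteq> {m\<in>{R<..2*R}. q dvd m}"
  proof safe
    fix j assume j: "j \<in> {1..k}"
    have "q * (k + 1) \<le> q * (k + j)" "q * (k + j) \<le> q * (k + k)" using j by (intro mult_le_mono; simp)+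
    moreover have "q * (k + k) = q * k + q * k" by (rule distrib_left)
    ultimately show "q * (k + j) \<in> {R<..2*R}" using kR
      by (intro greaterThanAtMost_iff[THEN iffD2] conjI) linarith+
  qed simp
  then have "card ((\<lambda>j. q * (k + j)) ` {1..k}) \<le> card {m\<in>{R<..2*R}. q dvd m}" by (intro card_mono) auto
  moreover have "card ((\<lambda>j. q * (k + j)) ` {1..k}) = k" using assms by (subst card_image) (auto simp: inj_on_def)
  ultimately have "real k \<le> real (card {m\<in>{R<..2*R}. q dvd m})" by simp
  moreover have "real R / (2 * real q) \<le> real k"
  proof -
    have "R \<le> q * (k + k)" using kR k1 by (meson add_left_mono le_trans less_imp_le_nat mult_le_mono2)
    then have "real R \<le> real (q * (k + k))" by (simp only: of_nat_le_iff)
    then show ?thesis using assms by (simp add: field_simps)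
  qed
  ultimately show ?thesis by linarith
qed

text \<open>The congruent pairs are averaged over the moduli in \<open>(R, 2R]\<close>, which sees each \<open>q \<le> R\<close> about \<open>R/q\<close>
  times; off the diagonal, a pair is congruent only modulo divisors of its difference.\<close>

lemma sum_energy_over_modulus_le:
  assumes D: "D \<subseteq> {1..N}" and R: "R \<ge> 1" and \<tau>: "\<And>h. 1 \<le> h \<Longrightarrow> h \<le> N \<Longrightarrow> real (card {m. m dvd h}) \<le> \<tau>"
    and \<tau>0: "\<tau> \<ge> 0"
  shows "(\<Sum>q=1..R. primitive_energy D q / real q) \<le> 4 * (real R * real (card D) + (real (card D))\<^sup>2 * \<tau>)"
proof -
  have finD: "finite D" using D finite_subset by blast
  \<comment> \<open>By \<open>card_multiples_ge\<close>, 1 / (4 q) is at most the number of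
    multiples of \<open>q\<close> in (R, 2R] divided by 2R.\<close>
  have "(\<Sum>q=1..R. primitive_energy D q / real q) / 4
      \<le> (\<Sum>q=1..R. primitive_energy D q * (real (card {m\<in>{R<..2*R}. q dvd m}) / (2 * real R)))"
    unfolding sum_divide_distrib
  proof (intro sum_mono)
    fix q assume q: "q \<in> {1..R}"
    have "1 / (4 * real q) = (real R / (2 * real q)) / (2 * real R)" using R by simp
    also have "\<dots> \<le> real (card {m\<in>{R<..2*R}. q dvd m}) / (2 * real R)"
      using q by (intro divide_right_mono card_multiples_ge) auto
    finally have "primitive_energy D q * (1 / (4 * real q)) \<le> primitive_energy D q * (real (card {m\<in>{R<..2*R}. q dvd m}) / (2 * real R))"
      by (intro mult_left_mono primitive_energy_nonneg)
    then show "primitive_energy D q / real q / 4 \<le> primitive_energy D q * (real (card {m\<in>{R<..2*R}. q dvd m}) / (2 * real R))"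
      by simp
  qed
  also have "\<dots> = (\<Sum>q=1..R. \<Sum>m\<in>{R<..2*R}. if q dvd m then primitive_energy D q / (2 * real R) else 0)"
    by (intro sum.cong refl) (simp add: sum.inter_filter[symmetric])
  also have "\<dots> = (\<Sum>m\<in>{R<..2*R}. \<Sum>q\<in>{q\<in>{1..R}. q dvd m}. primitive_energy D q / (2 * real R))"
    by (subst sum.swap) (simp add: sum.inter_filter[symmetric])
  \<comment> \<open>As m <= 2R, the weight 1 / (2R) is at most 1 / m, and with this weight all
    divisors of \<open>m\<close> together give \<open>cong_pairs D m\<close>.\<close>
  also have "\<dots> \<le> (\<Sum>m\<in>{R<..2*R}. real (cong_pairs D m))"
  proof (intro sum_mono)
    fix m assume m: "m \<in> {R<..2*R}"
    have m0: "m > 0" using m by auto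
    have "(\<Sum>q\<in>{q\<in>{1..R}. q dvd m}. primitive_energy D q / (2 * real R)) \<le> (\<Sum>q\<in>{q\<in>{1..R}. q dvd m}. primitive_energy D q / real m)"
      using m by (intro sum_mono divide_left_mono primitive_energy_nonneg) (auto simp flip: of_nat_mult)
    also have "\<dots> \<le> (\<Sum>q\<in>{q. q dvd m}. primitive_energy D q / real m)"
      using m0 by (intro sum_mono2) (auto simp: primitive_energy_nonneg)
    also have "\<dots> = real (cong_pairs D m)"
      unfolding sum_divide_distrib[symmetric] cong_pairs_eq_energy[OF finD m0, symmetric] using m0 by simp
    finally show "(\<Sum>q\<in>{q\<in>{1..R}. q dvd m}. primitive_energy D q / (2 * real R)) \<le> real (cong_pairs D m)" .
  qed
  also have "\<dots> = (\<Sum>m\<in>{R<..2*R}. \<Sum>p\<in>D\<times>D. if fst p mod m = snd p mod m then 1 else 0)"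
  proof (intro sum.cong refl)
    fix m
    have "{(d, d'). d \<in> D \<and> d' \<in> D \<and> d mod m = d' mod m} = {p\<in>D\<times>D. fst p mod m = snd p mod m}" by auto
    then show "real (cong_pairs D m) = (\<Sum>p\<in>D\<times>D. if fst p mod m = snd p mod m then 1 else 0)"
      unfolding cong_pairs_def using finD by (simp add: sum.inter_filter[symmetric])
  qed
  also have "\<dots> = (\<Sum>p\<in>D\<times>D. real (card {m\<in>{R<..2*R}. fst p mod m = snd p mod m}))"
    by (subst sum.swap) (simp add: sum.inter_filter[symmetric])
  also have "\<dots> \<le> (\<Sum>p\<in>D\<times>D. (if fst p = snd p then real R else 0) + \<tau>)"
  proof (intro sum_mono)
    fix p assume "p \<in> D \<times> D"
    then obtain d d' where p: "p = (d, d')" "d \<in> D" "d' \<in> D" by auto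
    show "real (card {m\<in>{R<..2*R}. fst p mod m = snd p mod m}) \<le> (if fst p = snd p then real R else 0) + \<tau>"
    proof (cases "d = d'")
      case True
      have "card {m\<in>{R<..2*R}. fst p mod m = snd p mod m} \<le> card {R<..2*R}" by (intro card_mono) auto
      then show ?thesis using p True \<tau>0 by simp
    next
      case False
      define h where "h = nat \<bar>int d - int d'\<bar>"
      have "d \<in> {1..N}" "d' \<in> {1..N}" using D p(2,3) by auto
      then have h: "1 \<le> h" "h \<le> N" using False unfolding h_def by auto
      have "{m\<in>{R<..2*R}. d mod m = d' mod m} \<subseteq> {m. m dvd h}"
      proof safe
        fix m assume "d mod m = d' mod m"
        then have "int m dvd int d - int d'" by (metis mod_eq_dvd_iff zmod_int)
        then show "m dvd h" unfolding h_def by (simp only: dvd_nat_abs_iff)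
      qed
      then have "card {m\<in>{R<..2*R}. d mod m = d' mod m} \<le> card {m. m dvd h}" using h by (intro card_mono) auto
      also have "real \<dots> \<le> \<tau>" by (rule \<tau>[OF h])
      finally show ?thesis using p False by simp
    qed
  qed
  also have "\<dots> = real R * real (card D) + (real (card D))\<^sup>2 * \<tau>"
  proof -
    have "(\<Sum>p\<in>D\<times>D. if fst p = snd p then real R else 0) = (\<Sum>d\<in>D. \<Sum>d'\<in>D. if d = d' then real R else 0)"
      by (simp add: sum.cartesian_product case_prod_beta)
    also have "\<dots> = real R * real (card D)" using finD by simp
    finally show ?thesis by (simp add: sum.distrib card_cartesian_product power2_eq_square)
  qed
  finally show ?thesis by simp
qed

text \<open>Distinct reduced fractions with denominators at most \<open>R\<close> are 1/R^2 apart,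
  also modulo 1, so the large sieve applies with \<open>K = R\<^sup>2\<close>.\<close>

lemma sum_energy_le:
  assumes D: "D \<subseteq> {1..N}" and R: "R \<ge> 1"
  shows "(\<Sum>q=1..R. primitive_energy D q) \<le> (real N + 4 * (real (R\<^sup>2) * harm (R\<^sup>2))) * real (card D)"
proof -
  define S where "S = (SIGMA q:{1..R}. {a. a < q \<and> coprime a q})"
  define fr where "fr p = real (snd p) / real (fst p)" for p :: "nat \<times> nat"
  have finS: "finite S" unfolding S_def by auto
  have sep: "1 / real (R\<^sup>2) \<le> \<bar>fr p - fr p'\<bar> \<and> \<bar>fr p - fr p'\<bar> \<le> 1 - 1 / real (R\<^sup>2)"
    if "p \<in> S" "p' \<in> S" "p \<noteq> p'" for p p'
  proof -
    obtain q a q' a' where p: "p = (q, a)" "p' = (q', a')" by (cases p, cases p')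
    have qa: "1 \<le> q" "q \<le> R" "a < q" "coprime a q" "1 \<le> q'" "q' \<le> R" "a' < q'" "coprime a' q'"
      using that p unfolding S_def by auto
    have ne: "a * q' \<noteq> a' * q"
    proof
      assume eq: "a * q' = a' * q"
      then have "q dvd a * q'" "q' dvd a' * q" by simp_all (metis dvd_triv_right)
      then have "q dvd q'" "q' dvd q" using qa(4,8) by (simp_all add: coprime_commute coprime_dvd_mult_right_iff)
      then have "q = q'" by (rule dvd_antisym)
      then show False using eq qa that p by simp
    qed
    have "1 \<le> \<bar>int (a * q') - int (a' * q)\<bar>" using ne by linarith
    then have "1 \<le> \<bar>real_of_int (int (a * q') - int (a' * q))\<bar>" by linarith
    then have n1: "1 \<le> \<bar>real a * real q' - real a' * real q\<bar>" by simp
    have qq: "q * q' \<le> R\<^sup>2" unfolding power2_eq_square using qa by (intro mult_le_mono) auto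
    then have qq': "real q * real q' \<le> real (R\<^sup>2)" by (metis of_nat_le_iff of_nat_mult)
    have "fr p - fr p' = (real a * real q' - real a' * real q) / (real q * real q')"
      using qa unfolding fr_def p by (simp add: field_simps)
    then have "\<bar>fr p - fr p'\<bar> = \<bar>real a * real q' - real a' * real q\<bar> / (real q * real q')" using qa by simp
    also have "\<dots> \<ge> 1 / real (R\<^sup>2)" using n1 qq' qa by (intro frac_le) auto
    finally have lower: "1 / real (R\<^sup>2) \<le> \<bar>fr p - fr p'\<bar>" .
    \<comment> \<open>All the fractions lie in [0, 1 - 1/R^2], which is the separation across the
      integers.\<close>
    have up: "0 \<le> real b / real r \<and> real b / real r \<le> 1 - 1 / real (R\<^sup>2)" if "b < r" "1 \<le> r" "r \<le> R" for b r
    proof -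
      have "real b + 1 \<le> real r" using that by simp
      then have "real b / real r \<le> 1 - 1 / real r" using that by (simp add: field_simps)
      moreover have "real r \<le> real (R\<^sup>2)"
        using that by (metis le_trans of_nat_le_iff power2_nat_le_imp_le le_square power2_eq_square)
      then have "1 / real (R\<^sup>2) \<le> 1 / real r" using that by (intro frac_le) auto
      ultimately show ?thesis by simp
    qed
    have "\<bar>fr p - fr p'\<bar> \<le> 1 - 1 / real (R\<^sup>2)"
      using up[OF qa(3,1,2)] up[OF qa(7,5,6)] unfolding fr_def p fst_conv snd_conv by linarith
    with lower show ?thesis by blast
  qed
  have R2: "R\<^sup>2 > 0" using R by simp
  have pos: "1 / real (R\<^sup>2) > 0" using R2 by (intro divide_pos_pos) simp_all
  have inj: "inj_on fr S"
  proof (rule inj_onI, rule ccontr)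
    fix p p' assume "p \<in> S" "p' \<in> S" "fr p = fr p'" "p \<noteq> p'"
    then show False using sep[of p p'] pos by simp
  qed
  have "(\<Sum>q=1..R. primitive_energy D q) = (\<Sum>p\<in>S. (cmod (expsum D (fr p)))\<^sup>2)"
    unfolding primitive_energy_def S_def fr_def by (subst sum.Sigma) (auto simp: case_prod_beta)
  also have "\<dots> = (\<Sum>x\<in>fr ` S. (cmod (expsum D x))\<^sup>2)" using inj by (simp add: sum.reindex)
  also have "\<dots> \<le> (real N + 4 * (real (R\<^sup>2) * harm (R\<^sup>2))) * real (card D)"
  proof (rule large_sieve[OF _ R2 D])
    show "finite (fr ` S)" using finS by simp
    fix x y assume "x \<in> fr ` S" "y \<in> fr ` S" "x \<noteq> y"
    then show "1 / real (R\<^sup>2) \<le> \<bar>x - y\<bar> \<and> \<bar>x - y\<bar> \<le> 1 - 1 / real (R\<^sup>2)" using sep by blast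
  qed
  finally show ?thesis .
qed

section \<open>Counting vectors by congruent pairs\<close>

text \<open>Modulo \<open>q\<close> a primitive \<open>w\<close> spans a line, and two vectors
  parallel to \<open>w\<close> are parallel to each other. Bezout coefficients of \<open>w\<close>
  turn this into an identity valid for composite \<open>q\<close>.\<close>

lemma dvd_cross_trans:
  fixes w :: "int \<times> int"
  assumes "coprime (fst w) (snd w)" "q dvd cross w u" "q dvd cross w v"
  shows "q dvd cross u v"
proof -
  obtain \<alpha> \<beta> where ab: "\<alpha> * fst w + \<beta> * snd w = 1"
    using assms(1) bezout_int[of "fst w" "snd w"] by (metis coprime_imp_gcd_eq_1)
  have "cross u v = (\<alpha> * fst w + \<beta> * snd w) * cross u v" using ab by simp
  also have "\<dots> = (\<alpha> * fst u + \<beta> * snd u) * cross w v - (\<alpha> * fst v + \<beta> * snd v) * cross w u"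
    by (simp add: cross_def algebra_simps)
  finally show ?thesis using assms(2,3) by simp
qed

text \<open>Multiplication by the unit \<open>t\<close> permutes the residue classes modulo
  \<open>m\<close>, and a sum of products of class sizes along a permutation is at most the sum of
  their squares.\<close>

lemma card_scaled_residue_pairs_le:
  assumes "finite D" "m > 0" "coprime t (int m)"
  shows "card {(d, d'). d \<in> D \<and> d' \<in> D \<and> int m dvd int d' - t * int d} \<le> cong_pairs D m"
proof -
  define Dc where "Dc c = {d\<in>D. d mod m = c}" for c
  define \<pi> where "\<pi> c = nat ((t * int c) mod int m)" for c
  have finDc: "finite (Dc c)" for c using assms(1) unfolding Dc_def by auto
  have inj: "inj_on \<pi> {..<m}"
  proof (rule inj_onI)
    fix c c' assume c: "c \<in> {..<m}" "c' \<in> {..<m}" "\<pi> c = \<pi> c'"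
    then have "(t * int c) mod int m = (t * int c') mod int m"
      using assms(2) unfolding \<pi>_def by (subst (asm) eq_nat_nat_iff) auto
    then have "int m dvd t * (int c - int c')" by (simp add: mod_eq_dvd_iff right_diff_distrib)
    then have "int m dvd int c - int c'" using assms(3) by (simp add: coprime_commute coprime_dvd_mult_right_iff)
    then have "int c mod int m = int c' mod int m" by (simp add: mod_eq_dvd_iff)
    then show "c = c'" using c by simp
  qed
  have \<pi>: "\<pi> ` {..<m} \<subseteq> {..<m}" using assms(2) unfolding \<pi>_def by (auto simp: nat_less_iff)
  have cp: "cong_pairs D m = (\<Sum>c<m. (card (Dc c))\<^sup>2)"
  proof -
    have "{(d, d'). d \<in> D \<and> d' \<in> D \<and> d mod m = d' mod m} = (\<Union>c<m. Dc c \<times> Dc c)"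
      unfolding Dc_def using assms(2) by auto
    then have "cong_pairs D m = card (\<Union>c<m. Dc c \<times> Dc c)" unfolding cong_pairs_def by simp
    also have "\<dots> = (\<Sum>c<m. card (Dc c \<times> Dc c))"
      using finDc by (intro card_UN_disjoint) (auto simp: Dc_def)
    finally show ?thesis by (simp add: card_cartesian_product power2_eq_square)
  qed
  have "{(d, d'). d \<in> D \<and> d' \<in> D \<and> int m dvd int d' - t * int d} \<subseteq> (\<Union>c<m. Dc c \<times> Dc (\<pi> c))"
  proof safe
    fix d d' assume d: "d \<in> D" "d' \<in> D" "int m dvd int d' - t * int d"
    have "int d' mod int m = (t * int d) mod int m" using d(3) by (simp add: mod_eq_dvd_iff)
    also have "\<dots> = (t * int (d mod m)) mod int m" by (simp add: zmod_int mod_mult_right_eq)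
    finally have "d' mod m = \<pi> (d mod m)" unfolding \<pi>_def by (metis nat_int zmod_int)
    then have "d' \<in> Dc (\<pi> (d mod m))" "d \<in> Dc (d mod m)" "d mod m < m" using d assms(2) unfolding Dc_def by auto
    then show "(d, d') \<in> (\<Union>c<m. Dc c \<times> Dc (\<pi> c))" by blast
  qed
  then have "card {(d, d'). d \<in> D \<and> d' \<in> D \<and> int m dvd int d' - t * int d} \<le> card (\<Union>c<m. Dc c \<times> Dc (\<pi> c))"
    using finDc by (intro card_mono) auto
  also have "\<dots> \<le> (\<Sum>c<m. card (Dc c) * card (Dc (\<pi> c)))"
    using card_UN_le[of "{..<m}" "\<lambda>c. Dc c \<times> Dc (\<pi> c)"] by (simp add: card_cartesian_product)
  finally have "2 * card {(d, d'). d \<in> D \<and> d' \<in> D \<and> int m dvd int d' - t * int d}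
      \<le> (\<Sum>c<m. 2 * (card (Dc c) * card (Dc (\<pi> c))))" by (simp add: sum_distrib_left[symmetric])
  also have "\<dots> \<le> (\<Sum>c<m. (card (Dc c))\<^sup>2 + (card (Dc (\<pi> c)))\<^sup>2)"
  proof (intro sum_mono)
    fix c
    have "2 * (a * b) \<le> a\<^sup>2 + b\<^sup>2" for a b :: nat
    proof -
      have "int (2 * (a * b)) \<le> int (a\<^sup>2 + b\<^sup>2)" using zero_le_power2[of "int a - int b"] by (simp add: power2_diff)
      then show ?thesis by (simp only: of_nat_le_iff)
    qed
    then show "2 * (card (Dc c) * card (Dc (\<pi> c))) \<le> (card (Dc c))\<^sup>2 + (card (Dc (\<pi> c)))\<^sup>2" .
  qed
  also have "\<dots> = cong_pairs D m + (\<Sum>c<m. (card (Dc (\<pi> c)))\<^sup>2)" unfolding cp by (simp add: sum.distrib)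
  also have "(\<Sum>c<m. (card (Dc (\<pi> c)))\<^sup>2) = (\<Sum>c\<in>\<pi> ` {..<m}. (card (Dc c))\<^sup>2)"
    using inj by (simp add: sum.reindex)
  also have "\<dots> \<le> cong_pairs D m" unfolding cp using \<pi> by (intro sum_mono2) auto
  finally show ?thesis by simp
qed

text \<open>Modulo the determinant of \<open>w\<close> and \<open>w'\<close> the two primitive
  vectors are proportional by a unit \<open>t\<close>, so their products with a vector of
  \<open>V\<close> are proportional as well; over the integers these products determine the vector
  by Cramer's rule.\<close>

lemma card_le_cong_pairs:
  fixes V :: "(int \<times> int) set" and w w' :: "int \<times> int"
  assumes "finite D" "m > 0" "int m = \<bar>cross w w'\<bar>" "coprime (fst w) (snd w)" "coprime (fst w') (snd w')"
    and V: "\<And>v. v \<in> V \<Longrightarrow> 0 \<le> dot v w \<and> nat (dot v w) \<in> D" "\<And>v. v \<in> V \<Longrightarrow> 0 \<le> dot v w' \<and> nat (dot v w') \<in> D"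
  shows "card V \<le> cong_pairs D m"
proof -
  let ?E = "\<lambda>t. {(d, d'). d \<in> D \<and> d' \<in> D \<and> int m dvd int d' - t * int d}"
  obtain \<alpha> \<beta> where ab: "\<alpha> * fst w + \<beta> * snd w = 1"
    using assms(4) bezout_int[of "fst w" "snd w"] by (metis coprime_imp_gcd_eq_1)
  \<comment> \<open>Bezout coefficients of \<open>w\<close> read off the factor from
    \<open>w'\<close>; the two differences below are multiples of the determinant.\<close>
  define t where "t = \<alpha> * fst w' + \<beta> * snd w'"
  have mc: "int m dvd cross w w'" using assms(3) by simp
  have "fst w' - t * fst w = fst w' * (\<alpha> * fst w + \<beta> * snd w) - t * fst w" using ab by simp
  then have t1: "fst w' - t * fst w = - \<beta> * cross w w'" by (simp add: t_def cross_def algebra_simps)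
  have "snd w' - t * snd w = snd w' * (\<alpha> * fst w + \<beta> * snd w) - t * snd w" using ab by simp
  then have t2: "snd w' - t * snd w = \<alpha> * cross w w'" by (simp add: t_def cross_def algebra_simps)
  \<comment> \<open>A common divisor of \<open>t\<close> and the determinant divides both entries of
    the primitive vector \<open>w'\<close>.\<close>
  have cop: "coprime t (int m)"
  proof (rule coprimeI)
    fix g assume g: "g dvd t" "g dvd int m"
    then have "g dvd cross w w'" using mc dvd_trans by blast
    then have "g dvd (fst w' - t * fst w) + t * fst w" "g dvd (snd w' - t * snd w) + t * snd w"
      unfolding t1 t2 using g(1) by simp_all
    then have "g dvd fst w'" "g dvd snd w'" by simp_all
    then show "is_unit g" using assms(5) coprime_common_divisor by blast
  qed
  define \<phi> where "\<phi> v = (nat (dot v w), nat (dot v w'))" for v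
  have "inj_on \<phi> V"
  proof (rule inj_onI)
    fix u v assume uv: "u \<in> V" "v \<in> V" "\<phi> u = \<phi> v"
    then have eq: "dot u w = dot v w" "dot u w' = dot v w'" using V unfolding \<phi>_def by (auto simp: eq_nat_nat_iff)
    have "(fst u - fst v) * cross w w' = (dot u w - dot v w) * snd w' - (dot u w' - dot v w') * snd w"
      by (simp add: cross_def dot_def algebra_simps)
    moreover have "(snd u - snd v) * cross w w' = (dot u w' - dot v w') * fst w - (dot u w - dot v w) * fst w'"
      by (simp add: cross_def dot_def algebra_simps)
    moreover have "cross w w' \<noteq> 0" using assms(2,3) by auto
    ultimately show "u = v" using eq by (simp add: prod_eq_iff)
  qed
  moreover have "\<phi> ` V \<subseteq> ?E t"
  proof safe
    fix v d d' assume v: "v \<in> V" "(d, d') = \<phi> v"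
    then show "d \<in> D" "d' \<in> D" using V unfolding \<phi>_def by auto
    have dd: "int d = dot v w" "int d' = dot v w'" using v V unfolding \<phi>_def by auto
    have "dot v w' - t * dot v w = fst v * (fst w' - t * fst w) + snd v * (snd w' - t * snd w)"
      by (simp add: dot_def algebra_simps)
    also have "\<dots> = (- fst v * \<beta> + snd v * \<alpha>) * cross w w'" unfolding t1 t2 by (simp add: algebra_simps)
    finally show "int m dvd int d' - t * int d" unfolding dd using mc by simp
  qed
  moreover have "finite (?E t)" by (rule finite_subset[of _ "D \<times> D"]) (use assms(1) in auto)
  ultimately have "card V \<le> card (?E t)" by (rule card_inj_on_le)
  also have "\<dots> \<le> cong_pairs D m" by (rule card_scaled_residue_pairs_le[OF assms(1,2) cop])
  finally show ?thesis .
qed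

text \<open>Each pair (w, w') bounds \<open>card V\<close> by the congruent pairs modulo its
  determinant. Summed over all pairs and expanded in energies, a modulus \<open>q\<close> is counted
  as often as it divides a determinant; \<open>F q\<close> bounds this number, and \<open>lo\<close>
  replaces the determinant on the left.\<close>

lemma counting_inequality:
  fixes V W W' :: "(int \<times> int) set" and lo :: real
  assumes D: "D \<subseteq> {1..N}" and fin: "finite W" "finite W'"
    and cop: "\<And>w. w \<in> W \<union> W' \<Longrightarrow> coprime (fst w) (snd w)"
    and V: "\<And>v w. v \<in> V \<Longrightarrow> w \<in> W \<union> W' \<Longrightarrow> 0 \<le> dot v w \<and> nat (dot v w) \<in> D"
    and lo: "lo > 0" "\<And>w w'. w \<in> W \<Longrightarrow> w' \<in> W' \<Longrightarrow> lo \<le> real_of_int \<bar>cross w w'\<bar>"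
    and hi: "\<And>w w'. w \<in> W \<Longrightarrow> w' \<in> W' \<Longrightarrow> \<bar>cross w w'\<bar> \<le> int R"
    and F: "\<And>q. 1 \<le> q \<Longrightarrow> q \<le> R \<Longrightarrow> real (card {(w, w'). w \<in> W \<and> w' \<in> W' \<and> int q dvd cross w w'}) \<le> F q"
  shows "lo * real (card V) * real (card W * card W') \<le> (\<Sum>q=1..R. primitive_energy D q * F q)"
proof -
  have finD: "finite D" using D finite_subset by blast
  define mm where "mm p = nat \<bar>cross (fst p) (snd p)\<bar>" for p :: "(int \<times> int) \<times> (int \<times> int)"
  have "lo * real (card V) * real (card W * card W') = (\<Sum>p\<in>W\<times>W'. lo * real (card V))"
    by (simp add: card_cartesian_product)
  also have "\<dots> \<le> (\<Sum>p\<in>W\<times>W'. \<Sum>q\<in>{q\<in>{1..R}. q dvd mm p}. primitive_energy D q)"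
  proof (intro sum_mono)
    fix p assume "p \<in> W \<times> W'"
    then obtain w w' where p: "p = (w, w')" "w \<in> W" "w' \<in> W'" by auto
    have m: "int (mm p) = \<bar>cross w w'\<bar>" unfolding mm_def p by simp
    have lom: "lo \<le> real (mm p)" using lo(2)[OF p(2,3)] m by (metis of_int_of_nat_eq)
    then have m0: "mm p > 0" using lo(1) by (cases "mm p") auto
    have "card V \<le> cong_pairs D (mm p)"
      using p cop V by (intro card_le_cong_pairs[OF finD m0 m]) auto
    then have "lo * real (card V) \<le> real (mm p) * real (cong_pairs D (mm p))"
      using lom lo(1) by (intro mult_mono) auto
    also have "\<dots> = (\<Sum>q | q dvd mm p. primitive_energy D q)" by (rule cong_pairs_eq_energy[OF finD m0])
    also have "{q. q dvd mm p} = {q\<in>{1..R}. q dvd mm p}"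
    proof -
      have "mm p \<le> R" using hi[OF p(2,3)] m by linarith
      then show ?thesis using m0 dvd_imp_le[of _ "mm p"] dvd_pos_nat[of "mm p"]
        by (auto simp: Suc_le_eq) (metis le_trans)
    qed
    finally show "lo * real (card V) \<le> (\<Sum>q\<in>{q\<in>{1..R}. q dvd mm p}. primitive_energy D q)" .
  qed
  also have "\<dots> = (\<Sum>p\<in>W\<times>W'. \<Sum>q=1..R. if q dvd mm p then primitive_energy D q else 0)"
    by (rule sum.cong[OF refl], rule sum.inter_filter) simp
  also have "\<dots> = (\<Sum>q=1..R. \<Sum>p\<in>W\<times>W'. if q dvd mm p then primitive_energy D q else 0)" by (rule sum.swap)
  also have "\<dots> = (\<Sum>q=1..R. primitive_energy D q * real (card {p\<in>W\<times>W'. q dvd mm p}))"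
    using fin by (intro sum.cong refl) (simp add: sum.inter_filter[symmetric])
  also have "\<dots> \<le> (\<Sum>q=1..R. primitive_energy D q * F q)"
  proof (intro sum_mono mult_left_mono primitive_energy_nonneg)
    fix q assume q: "q \<in> {1..R}"
    have "{p\<in>W\<times>W'. q dvd mm p} = {(w, w'). w \<in> W \<and> w' \<in> W' \<and> int q dvd cross w w'}"
      unfolding mm_def by (auto simp: dvd_nat_abs_iff)
    then show "real (card {p\<in>W\<times>W'. q dvd mm p}) \<le> F q" using F[of q] q by simp
  qed
  finally show ?thesis .
qed

text \<open>The weight is split at a threshold \<open>L\<close>: below it the average with weight
  1/q takes over, above it the large sieve with constant weight.\<close>

lemma powr_minus_split:
  fixes L \<sigma> :: real
  assumes "L > 0" "0 \<le> \<sigma>" "\<sigma> \<le> 1" "x > 0"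
  shows "x powr - \<sigma> \<le> L powr (1 - \<sigma>) / x + L powr - \<sigma>"
proof (cases "x \<le> L")
  case True
  have "x powr - \<sigma> = x powr (1 - \<sigma>) / x" using assms by (simp add: powr_diff powr_minus field_simps)
  also have "\<dots> \<le> L powr (1 - \<sigma>) / x" using assms True by (intro divide_right_mono powr_mono2) auto
  finally show ?thesis by (simp add: add_increasing2)
next
  case False
  have "x powr - \<sigma> \<le> L powr - \<sigma>" using assms False by (intro powr_mono2') auto
  then show ?thesis using assms by (simp add: add_increasing)
qed

lemma weighted_energy_le:
  fixes \<sigma> \<tau> :: real
  assumes D: "D \<subseteq> {1..N}" "D \<noteq> {}" and R: "R \<ge> 1" and \<sigma>: "0 \<le> \<sigma>" "\<sigma> \<le> 1"
    and \<tau>: "\<And>h. 1 \<le> h \<Longrightarrow> h \<le> N \<Longrightarrow> real (card {m. m dvd h}) \<le> \<tau>" "\<tau> \<ge> 0"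
  defines "d \<equiv> real (card D)"
  shows "(\<Sum>q=1..R. primitive_energy D q * real q powr - \<sigma>)
    \<le> (real N / d) powr (1 - \<sigma>) * (4 * (real R * d + d\<^sup>2 * \<tau>))
     + (real N / d) powr - \<sigma> * ((real N + 4 * (real (R\<^sup>2) * harm (R\<^sup>2))) * d)"
proof -
  \<comment> \<open>The choice of \<open>L\<close> balances the two bounds.\<close>
  define L where "L = real N / d"
  have "finite D" using D(1) finite_subset by blast
  then have "d > 0" using D(2) unfolding d_def by (simp add: card_gt_0_iff)
  moreover have "N > 0" using D by fastforce
  ultimately have L: "L > 0" unfolding L_def by simp
  have "(\<Sum>q=1..R. primitive_energy D q * real q powr - \<sigma>)
      \<le> (\<Sum>q=1..R. primitive_energy D q * (L powr (1 - \<sigma>) / real q + L powr - \<sigma>))"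
    using L \<sigma> by (intro sum_mono mult_left_mono primitive_energy_nonneg powr_minus_split) auto
  also have "\<dots> = L powr (1 - \<sigma>) * (\<Sum>q=1..R. primitive_energy D q / real q) + L powr - \<sigma> * (\<Sum>q=1..R. primitive_energy D q)"
    by (simp add: sum.distrib sum_distrib_left algebra_simps)
  also have "\<dots> \<le> L powr (1 - \<sigma>) * (4 * (real R * d + d\<^sup>2 * \<tau>))
     + L powr - \<sigma> * ((real N + 4 * (real (R\<^sup>2) * harm (R\<^sup>2))) * d)"
    unfolding d_def
    by (intro add_mono mult_left_mono sum_energy_over_modulus_le[OF D(1) R \<tau>] sum_energy_le[OF D(1) R]) auto
  finally show ?thesis unfolding L_def .
qed

section \<open>Concatenations of blocks\<close>

fun word_power :: "nat list set \<Rightarrow> nat \<Rightarrow> nat list set" where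
  "word_power B 0 = {[]}"
| "word_power B (Suc k) = (\<lambda>(x, y). x @ y) ` (B \<times> word_power B k)"

lemma word_power_add: "word_power B (i + j) = (\<lambda>(x, y). x @ y) ` (word_power B i \<times> word_power B j)"
proof (induction i)
  case (Suc i)
  have "word_power B (Suc i + j) = (\<lambda>(x, y). x @ y) ` (B \<times> (\<lambda>(x, y). x @ y) ` (word_power B i \<times> word_power B j))"
    by (simp add: Suc)
  also have "\<dots> = (\<lambda>(x, y). x @ y) ` (word_power B (Suc i) \<times> word_power B j)"
    by (auto simp: image_iff) (metis append.assoc)+
  finally show ?case .
qed force

lemma finite_word_power: "finite B \<Longrightarrow> finite (word_power B k)"
  by (induction k) auto

lemma set_word_power:
  assumes "\<And>x. x \<in> B \<Longrightarrow> set x \<subseteq> A" "as \<in> word_power B k"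
  shows "set as \<subseteq> A"
  using assms(2)
proof (induction k arbitrary: as)
  case (Suc k)
  then obtain x y where "as = x @ y" "x \<in> B" "y \<in> word_power B k" by auto
  then show ?case using Suc.IH assms(1) by auto
qed auto

text \<open>The common length \<open>l\<close> makes the division of a word into blocks
  unique.\<close>

lemma card_word_power:
  assumes "\<And>x. x \<in> B \<Longrightarrow> length x = l"
  shows "card (word_power B k) = card B ^ k"
proof (induction k)
  case (Suc k)
  have "inj_on (\<lambda>(x, y). x @ y) (B \<times> word_power B k)"
    using assms by (auto simp: inj_on_def)
  then show ?case using Suc by (simp add: card_image card_cartesian_product)
qed auto

lemma cf_act_weak_cone:
  fixes z :: "int \<times> int"
  assumes "0 \<notin> set as" "0 \<le> snd z" "snd z \<le> fst z"
  shows "0 \<le> snd (cf_act as z) \<and> snd (cf_act as z) \<le> fst (cf_act as z)"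
  using assms(1)
proof (induction as)
  case (Cons a as)
  let ?x = "fst (cf_act as z)" and ?y = "snd (cf_act as z)"
  have IH: "0 \<le> ?y" "?y \<le> ?x" and "a \<ge> 1" using Cons by auto
  then have "1 * ?x \<le> int a * ?x" by (intro mult_right_mono) auto
  then have "?x \<le> int a * ?x + ?y" using IH by linarith
  with IH show ?case by auto
qed (use assms in auto)

text \<open>Each block multiplies the first entry by its continuant up to a factor 2. The bound
  \<open>H\<close> on twice the continuant absorbs this factor, so no constant accumulates with
  \<open>k\<close>.\<close>

lemma word_power_size:
  fixes z :: "int \<times> int" and T H :: real
  assumes B: "\<And>x. x \<in> B \<Longrightarrow> 0 \<notin> set x \<and> T \<le> real_of_int (continuant x) \<and> 2 * real_of_int (continuant x) \<le> H"
    and T: "T \<ge> 0" and as: "as \<in> word_power B k" and z: "0 \<le> snd z" "snd z \<le> fst z"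
  shows "T ^ k * of_int (fst z) \<le> of_int (fst (cf_act as z)) \<and> of_int (fst (cf_act as z)) \<le> H ^ k * of_int (fst z)"
  using as
proof (induction k arbitrary: as)
  case (Suc k)
  then obtain x y where xy: "as = x @ y" "x \<in> B" "y \<in> word_power B k" by auto
  have "set z \<subseteq> - {0}" if "z \<in> B" for z using B that by auto
  then have "set y \<subseteq> - {0}" using set_word_power xy(3) by blast
  then have nz: "0 \<notin> set x" "0 \<notin> set y" using B xy(2) by auto
  define u where "u = cf_act y z"
  have u: "0 \<le> snd u" "snd u \<le> fst u" using cf_act_weak_cone[OF nz(2) z] u_def by auto
  have IH: "T ^ k * of_int (fst z) \<le> of_int (fst u)" "of_int (fst u) \<le> H ^ k * of_int (fst z)"
    using Suc.IH[OF xy(3)] u_def by auto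
  have Bx: "T \<le> real_of_int (continuant x)" "2 * real_of_int (continuant x) \<le> H" using B xy by auto
  have as: "cf_act as z = cf_act x u" unfolding xy(1) cf_act_append u_def ..
  have "real_of_int (continuant x * fst u) \<le> of_int (fst (cf_act x u))"
    using continuant_mult_le(1)[OF nz(1) u] by (simp only: of_int_le_iff)
  moreover have "T * (T ^ k * of_int (fst z)) \<le> real_of_int (continuant x) * of_int (fst u)"
    using IH Bx T z by (intro mult_mono) auto
  moreover have "real_of_int (fst (cf_act x u)) \<le> of_int (2 * continuant x * fst u)"
    using continuant_mult_le(2)[OF nz(1) u] by (simp only: of_int_le_iff)
  moreover have "2 * real_of_int (continuant x) * of_int (fst u) \<le> H * (H ^ k * of_int (fst z))"
    using IH Bx T u by (intro mult_mono) auto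
  ultimately show ?case unfolding as by simp
qed auto

text \<open>Every word is closed by \<open>[a0, a0]\<close> on both sides: the vector \<open>e\<close> of this palindrome lies in the strict
  cone, and the scalar products below remain continuants of words over \<open>A\<close>.\<close>

locale cf_blocks =
  fixes A :: "nat set" and B :: "nat list set" and l M a0 :: nat and T H :: real
  assumes A0: "0 \<notin> A" and a0: "a0 \<in> A" and M: "\<And>a. a \<in> A \<Longrightarrow> a \<le> M"
    and BA: "\<And>x. x \<in> B \<Longrightarrow> set x \<subseteq> A" and Bl: "\<And>x. x \<in> B \<Longrightarrow> length x = l"
    and BT: "\<And>x. x \<in> B \<Longrightarrow> T \<le> of_int (continuant x)" and BH: "\<And>x. x \<in> B \<Longrightarrow> 2 * of_int (continuant x) \<le> H"
    and T1: "T \<ge> 1" and H1: "H \<ge> 1"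
begin

definition e :: "int \<times> int" where "e = (int a0 * int a0 + 1, int a0)"

abbreviation "E \<equiv> real_of_int (fst e)"

section \<open>Closed words as vectors of a cone\<close>

lemma a0_pos: "a0 \<ge> 1" using a0 A0 by (metis One_nat_def Suc_leI gr0I)

lemma e_eq: "e = cf_act [a0, a0] (1, 0)" by (simp add: e_def)

lemma e_cone: "0 < snd e" "snd e < fst e"
proof -
  show "0 < snd e" using a0_pos by (simp add: e_def)
  have "int a0 * 1 \<le> int a0 * int a0" using a0_pos by (intro mult_left_mono) auto
  then show "snd e < fst e" by (simp add: e_def)
qed

lemma E1: "E \<ge> 1" using e_cone by simp

lemma e_coprime: "coprime (fst e) (snd e)"
  unfolding e_eq by (rule coprime_cf_act) simp

lemma nz: "set as \<subseteq> A \<Longrightarrow> 0 \<notin> set as" using A0 by auto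

lemma finB: assumes "finite A" shows "finite B"
  by (rule finite_subset[OF _ finite_lists_length_eq[OF assms, of l]]) (use BA Bl in auto)

lemma word_power_A: "as \<in> word_power B k \<Longrightarrow> set as \<subseteq> A"
  using set_word_power[of B A] BA by blast

lemma size:
  assumes "as \<in> word_power B k" "0 \<le> snd z" "snd z \<le> fst z"
  shows "T ^ k * of_int (fst z) \<le> of_int (fst (cf_act as z))" "of_int (fst (cf_act as z)) \<le> H ^ k * of_int (fst z)"
  using word_power_size[of B T H as k z] assms BT BH BA nz T1 by auto

text \<open>The last bound makes the two entries comparable: their quotient is at most the leading
  letter plus 1, and for the empty word \<open>a0\<close> takes the part of this letter.\<close>

lemma cone:
  assumes "set as \<subseteq> A"
  shows "0 < snd (cf_act as e)" "snd (cf_act as e) < fst (cf_act as e)"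
    "fst (cf_act as e) \<le> (int M + 1) * snd (cf_act as e)"
proof -
  show c: "0 < snd (cf_act as e)" "snd (cf_act as e) < fst (cf_act as e)"
    using cf_act_mono_cone[OF nz[OF assms] e_cone] by auto
  show "fst (cf_act as e) \<le> (int M + 1) * snd (cf_act as e)"
  proof (cases as)
    case Nil
    have "int a0 * int a0 \<le> int M * int a0" using M[OF a0] by (intro mult_right_mono) auto
    then have "int a0 * int a0 + 1 \<le> (int M + 1) * int a0" unfolding distrib_right using a0_pos by linarith
    then show ?thesis using Nil by (simp add: e_def)
  next
    case (Cons a bs)
    then have bs: "set bs \<subseteq> A" "a \<in> A" using assms by auto
    let ?u = "cf_act bs e"
    have u: "0 < snd ?u" "snd ?u < fst ?u" using cf_act_mono_cone[OF nz[OF bs(1)] e_cone] by auto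
    have "int a * fst ?u \<le> int M * fst ?u" using u M[OF bs(2)] by (intro mult_right_mono) auto
    then have "int a * fst ?u + snd ?u \<le> (int M + 1) * fst ?u" unfolding distrib_right using u by linarith
    then show ?thesis using Cons by simp
  qed
qed

lemma inj_cf_act: "inj_on (\<lambda>as. cf_act as e) {as. set as \<subseteq> A}"
  using cf_act_inj[OF nz nz e_cone] by (intro inj_onI) auto

text \<open>The entries of \<open>cf_act as e\<close> are the continuants of the closed word and of
  the same word without its first letter. Both lie in \<open>cf_denoms_upto A N\<close>, and
  together they determine the word.\<close>

lemma card_squared_ge:
  assumes "H ^ k * E \<le> real N"
  shows "card B ^ k \<le> (card (cf_denoms_upto A N))\<^sup>2"
proof -
  have fin: "finite (cf_denoms_upto A N)" unfolding cf_denoms_upto_def by auto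
  define \<phi> where "\<phi> as = (nat (fst (cf_act as e)), nat (snd (cf_act as e)))" for as
  have "inj_on \<phi> (word_power B k)"
  proof (rule inj_onI)
    fix x y assume xy: "x \<in> word_power B k" "y \<in> word_power B k" "\<phi> x = \<phi> y"
    have "0 \<le> fst (cf_act x e)" "0 \<le> snd (cf_act x e)" "0 \<le> fst (cf_act y e)" "0 \<le> snd (cf_act y e)"
      using cone[OF word_power_A[OF xy(1)]] cone[OF word_power_A[OF xy(2)]] by auto
    then have "cf_act x e = cf_act y e" using xy(3) unfolding \<phi>_def by (auto simp: prod_eq_iff eq_nat_nat_iff)
    then show "x = y" using inj_cf_act word_power_A xy by (auto dest: inj_onD)
  qed
  moreover have "\<phi> ` word_power B k \<subseteq> cf_denoms_upto A N \<times> cf_denoms_upto A N"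
  proof
    fix p assume "p \<in> \<phi> ` word_power B k"
    then obtain as where as: "as \<in> word_power B k" "p = \<phi> as" by auto
    have asA: "set as \<subseteq> A" using word_power_A as by auto
    \<comment> \<open>The closing letters keep the tail \<open>r\<close> nonempty even if
      \<open>as\<close> is empty, so its continuant is a denominator too.\<close>
    obtain a r where ar: "as @ [a0, a0] = a # r" "r \<noteq> []" by (cases as) auto
    have "set (as @ [a0, a0]) \<subseteq> A" using asA a0 by auto
    then have rA: "set (a # r) \<subseteq> A" "set r \<subseteq> A" unfolding ar by auto
    have eq: "cf_act as e = cf_act (a # r) (1, 0)" unfolding e_eq cf_act_append[symmetric] ar ..
    then have fs: "fst (cf_act as e) = continuant (a # r)" "snd (cf_act as e) = continuant r"
      by (auto simp: continuant_def)
    have "real_of_int (fst (cf_act as e)) \<le> real N" using size(2)[OF as(1), of e] e_cone assms by linarith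
    then have le: "fst (cf_act as e) \<le> int N" by linarith
    have "nat (continuant (a # r)) \<in> cf_denoms A" "nat (continuant r) \<in> cf_denoms A"
      using continuant_in_cf_denoms[OF _ rA(1) A0] continuant_in_cf_denoms[OF ar(2) rA(2) A0] by auto
    moreover have "nat (continuant (a # r)) \<in> {1..N}" "nat (continuant r) \<in> {1..N}"
      using cone(1,2)[OF asA] le fs by auto
    ultimately show "p \<in> cf_denoms_upto A N \<times> cf_denoms_upto A N"
      unfolding as(2) \<phi>_def fs cf_denoms_upto_def by auto
  qed
  ultimately have "card (word_power B k) \<le> card (cf_denoms_upto A N \<times> cf_denoms_upto A N)"
    by (rule card_inj_on_le) (use fin in auto)
  then show ?thesis by (simp add: card_word_power[OF Bl] card_cartesian_product power2_eq_square)
qed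

text \<open>The fixed first letter confines the direction of the vectors; different letters later
  keep the determinants away from 0.\<close>

definition W :: "nat \<Rightarrow> nat \<Rightarrow> (int \<times> int) set" where
  "W a m = (\<lambda>ys. cf_act (a # ys) e) ` word_power B m"

text \<open>Words are reversed so that, by \<open>dot_cf_act_rev\<close>, the product with a vector
  of \<open>W a m\<close> is the continuant of one concatenated word.\<close>

definition V :: "nat \<Rightarrow> (int \<times> int) set" where
  "V k = (\<lambda>xs. cf_act (rev xs) e) ` word_power B k"

lemma card_W: "a \<in> A \<Longrightarrow> card (W a m) = card B ^ m"
proof -
  assume a: "a \<in> A"
  have "inj_on (\<lambda>ys. cf_act (a # ys) e) (word_power B m)"
  proof (rule inj_onI)
    fix x y assume xy: "x \<in> word_power B m" "y \<in> word_power B m" "cf_act (a # x) e = cf_act (a # y) e"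
    have "set (a # x) \<subseteq> A" "set (a # y) \<subseteq> A" using a word_power_A xy by auto
    then have "a # x = a # y" using inj_onD[OF inj_cf_act xy(3)] by blast
    then show "x = y" by simp
  qed
  then show ?thesis unfolding W_def by (simp add: card_image card_word_power[OF Bl])
qed

lemma card_V: "card (V k) = card B ^ k"
proof -
  have "inj_on (\<lambda>xs. cf_act (rev xs) e) (word_power B k)"
  proof (rule inj_onI)
    fix x y assume xy: "x \<in> word_power B k" "y \<in> word_power B k" "cf_act (rev x) e = cf_act (rev y) e"
    have "set (rev x) \<subseteq> A" "set (rev y) \<subseteq> A" using word_power_A xy by auto
    then have "rev x = rev y" using inj_onD[OF inj_cf_act xy(3)] by blast
    then show "x = y" by simp
  qed
  then show ?thesis unfolding V_def by (simp add: card_image card_word_power[OF Bl])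
qed

lemma coprime_W: "w \<in> W a m \<Longrightarrow> coprime (fst w) (snd w)"
  unfolding W_def using coprime_cf_act[OF e_coprime] by blast

text \<open>Since [a0, a0] is a palindrome, \<open>dot v w\<close> is the continuant of the word
  made of [a0, a0], \<open>xs\<close>, \<open>a\<close>, \<open>ys\<close> and [a0, a0]. The closing
  words account for E^2 and a factor 2, the letter \<open>a\<close> for M + 1.\<close>

lemma dot_in_denoms:
  assumes v: "v \<in> V k" and w: "w \<in> W a m" and a: "a \<in> A" and N: "2 * (real M + 1) * E\<^sup>2 * H ^ (k + m) \<le> real N"
  shows "0 \<le> dot v w \<and> nat (dot v w) \<in> cf_denoms_upto A N"
proof -
  obtain xs ys where xs: "v = cf_act (rev xs) e" "xs \<in> word_power B k" and ys: "w = cf_act (a # ys) e" "ys \<in> word_power B m"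
    using v w unfolding V_def W_def by auto
  let ?zs = "[a0, a0] @ (xs @ (a # ys)) @ [a0, a0]"
  have A': "set xs \<subseteq> A" "set ys \<subseteq> A" "set (a # ys) \<subseteq> A" "set (xs @ a # ys) \<subseteq> A"
    using word_power_A xs ys a by auto
  have "dot v w = dot e (cf_act (xs @ a # ys) e)" unfolding xs ys dot_cf_act_rev cf_act_append ..
  also have "\<dots> = dot (cf_act (rev [a0, a0]) (1, 0)) (cf_act (xs @ a # ys) e)" by (simp add: e_def)
  also have "\<dots> = dot (1, 0) (cf_act ?zs (1, 0))"
    unfolding dot_cf_act_rev cf_act_append e_eq ..
  also have "\<dots> = continuant ?zs" by (simp add: dot_def continuant_def)
  finally have cont: "dot v w = continuant ?zs" .
  have zsA: "set ?zs \<subseteq> A" using A' a0 by auto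
  have den: "nat (dot v w) \<in> cf_denoms A" "dot v w \<ge> 1"
    unfolding cont using continuant_in_cf_denoms[OF _ zsA A0] continuant_ge_1[OF nz[OF zsA]] by auto
  let ?u = "cf_act ys e" and ?p = "cf_act (xs @ a # ys) e"
  note cu = cone[OF A'(2)] and cau = cone[OF A'(3)] and cp = cone[OF A'(4)]
  have pu: "?p = cf_act xs (cf_act (a # ys) e)" by (simp only: cf_act_append)
  have "dot v w = fst e * fst ?p + snd e * snd ?p"
    unfolding xs ys dot_cf_act_rev by (simp add: dot_def cf_act_append)
  also have "snd e * snd ?p \<le> fst e * fst ?p" using e_cone cp by (intro mult_mono) auto
  finally have "dot v w \<le> 2 * (fst e * fst ?p)" by simp
  then have "real_of_int (dot v w) \<le> real_of_int (2 * (fst e * fst ?p))" by (simp only: of_int_le_iff)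
  then have d1: "real_of_int (dot v w) \<le> 2 * E * of_int (fst ?p)" by simp
  have p1: "real_of_int (fst ?p) \<le> H ^ k * of_int (fst (cf_act (a # ys) e))"
    unfolding pu using cau by (intro size(2)[OF xs(2)]) auto
  have "int a * fst ?u + snd ?u \<le> int M * fst ?u + fst ?u"
    using M[OF a] cu by (intro add_mono mult_right_mono) auto
  then have "fst (cf_act (a # ys) e) \<le> (int M + 1) * fst ?u" by (simp add: algebra_simps)
  then have "real_of_int (fst (cf_act (a # ys) e)) \<le> real_of_int ((int M + 1) * fst ?u)" by (simp only: of_int_le_iff)
  then have p2: "real_of_int (fst (cf_act (a # ys) e)) \<le> (real M + 1) * of_int (fst ?u)" by simp
  have p3: "real_of_int (fst ?u) \<le> H ^ m * E" using e_cone by (intro size(2)[OF ys(2)]) auto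
  have "real_of_int (dot v w) \<le> 2 * E * (H ^ k * ((real M + 1) * (H ^ m * E)))"
  proof -
    have "(real M + 1) * real_of_int (fst ?u) \<le> (real M + 1) * (H ^ m * E)" using p3 by (intro mult_left_mono) auto
    with p2 have "real_of_int (fst (cf_act (a # ys) e)) \<le> (real M + 1) * (H ^ m * E)" by linarith
    then have "H ^ k * of_int (fst (cf_act (a # ys) e)) \<le> H ^ k * ((real M + 1) * (H ^ m * E))"
      by (rule mult_left_mono) (use H1 in simp)
    then have "2 * E * of_int (fst ?p) \<le> 2 * E * (H ^ k * ((real M + 1) * (H ^ m * E)))"
      using p1 E1 by (intro mult_left_mono) linarith+
    then show ?thesis using d1 by linarith
  qed
  also have "\<dots> = 2 * (real M + 1) * E\<^sup>2 * H ^ (k + m)" by (simp add: power_add power2_eq_square)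
  also have "\<dots> \<le> real N" by (rule N)
  finally have "dot v w \<le> int N" by linarith
  then show ?thesis using den unfolding cf_denoms_upto_def by auto
qed

text \<open>Up to sign the determinant is (a' - a) x x' + x y' - y x'. As y < x and a' - a >= 1, it
  is at least x y', and y' is comparable to x' by \<open>cone\<close>.\<close>

lemma cross_bounds:
  assumes w: "w \<in> W a m" "w' \<in> W a' m" and a: "a \<in> A" "a' \<in> A" "a < a'"
  shows "T ^ (2 * m) / (real M + 1) \<le> real_of_int \<bar>cross w w'\<bar>"
    "real_of_int \<bar>cross w w'\<bar> \<le> (real M + 1) * E\<^sup>2 * H ^ (2 * m)"
proof -
  obtain ys ys' where ys: "w = cf_act (a # ys) e" "ys \<in> word_power B m" and ys': "w' = cf_act (a' # ys') e" "ys' \<in> word_power B m"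
    using w unfolding W_def by auto
  define x y x' y' where "x = fst (cf_act ys e)" and "y = snd (cf_act ys e)"
    and "x' = fst (cf_act ys' e)" and "y' = snd (cf_act ys' e)"
  have c: "0 < y" "y < x" "0 < y'" "y' < x'" "x' \<le> (int M + 1) * y'"
    using cone[OF word_power_A[OF ys(2)]] cone[OF word_power_A[OF ys'(2)]] x_def y_def x'_def y'_def by auto
  have cr: "cross w w' = (int a * x + y) * x' - x * (int a' * x' + y')"
    unfolding ys ys' x_def y_def x'_def y'_def cross_def by simp
  have sx: "T ^ m * E \<le> of_int x" "of_int x \<le> H ^ m * E" "T ^ m * E \<le> of_int x'" "of_int x' \<le> H ^ m * E"
    using size[OF ys(2), of e] size[OF ys'(2), of e] e_cone x_def x'_def by auto
  have "(int a + 1) * (x * x') \<le> int a' * (x * x')" using a c by (intro mult_right_mono) auto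
  moreover have "y * x' \<le> x * x'" using c by (intro mult_right_mono) auto
  ultimately have neg: "x * y' \<le> - cross w w'" unfolding cr by (simp add: algebra_simps)
  have xy0: "0 \<le> x * y'" using c by simp
  have "x * x' \<le> x * ((int M + 1) * y')" using c by (intro mult_left_mono) auto
  also have "\<dots> = (int M + 1) * (x * y')" by simp
  also have "\<dots> \<le> (int M + 1) * \<bar>cross w w'\<bar>" using neg xy0 by (intro mult_left_mono) auto
  finally have "real_of_int (x * x') \<le> real_of_int ((int M + 1) * \<bar>cross w w'\<bar>)" by (simp only: of_int_le_iff)
  then have l1: "real_of_int x * of_int x' \<le> (real M + 1) * real_of_int \<bar>cross w w'\<bar>" by simp
  have TE: "T ^ m \<le> T ^ m * E" using mult_left_mono[OF E1, of "T ^ m"] T1 by simp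
  have Tx: "T ^ m \<le> of_int x" "T ^ m \<le> of_int x'" using sx TE by linarith+
  have "T ^ (2 * m) = T ^ m * T ^ m" by (simp add: mult_2 power_add)
  also have "\<dots> \<le> real_of_int x * of_int x'" using Tx T1 c by (intro mult_mono) auto
  finally show "T ^ (2 * m) / (real M + 1) \<le> real_of_int \<bar>cross w w'\<bar>"
    using l1 by (simp add: divide_le_eq mult.commute add_nonneg_pos)
  have "x * (int a' * x' + y') \<le> x * ((int M + 1) * x')"
  proof (intro mult_left_mono)
    have "int a' * x' \<le> int M * x'" using M[OF a(2)] c by (intro mult_right_mono) auto
    then show "int a' * x' + y' \<le> (int M + 1) * x'" unfolding distrib_right using c by linarith
  qed (use c in auto)
  moreover have "0 \<le> (int a * x + y) * x'" using c by (intro mult_nonneg_nonneg add_nonneg_nonneg) auto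
  ultimately have "\<bar>cross w w'\<bar> \<le> x * ((int M + 1) * x')" using neg xy0 unfolding cr by linarith
  then have "real_of_int \<bar>cross w w'\<bar> \<le> real_of_int (x * ((int M + 1) * x'))" by (simp only: of_int_le_iff)
  also have "\<dots> = (real M + 1) * (of_int x * of_int x')" by simp
  also have "\<dots> \<le> (real M + 1) * ((H ^ m * E) * (H ^ m * E))"
    using sx c H1 E1 by (intro mult_left_mono mult_mono) auto
  also have "\<dots> = (real M + 1) * E\<^sup>2 * H ^ (2 * m)" by (simp add: mult_2 power_add power2_eq_square)
  finally show "real_of_int \<bar>cross w w'\<bar> \<le> (real M + 1) * E\<^sup>2 * H ^ (2 * m)" .
qed

text \<open>Both vectors are parallel to \<open>w\<close> modulo \<open>q\<close>, hence to each
  other. The common prefix \<open>\<gamma>\<close> has determinant 1 or -1 and drops out. The suffix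
  vectors are too short for a nonzero determinant divisible by \<open>q\<close>, so they are
  parallel over the integers; being primitive and positive, they agree.\<close>

lemma suffix_determined:
  assumes w: "coprime (fst w) (snd w)" and g: "set \<gamma> \<subseteq> A" and y: "y \<in> word_power B j" "y' \<in> word_power B j"
    and q: "E\<^sup>2 * H ^ (2 * j) \<le> real q"
    and d: "int q dvd cross w (cf_act (\<gamma> @ y) e)" "int q dvd cross w (cf_act (\<gamma> @ y') e)"
  shows "y = y'"
proof -
  define u u' where "u = cf_act y e" and "u' = cf_act y' e"
  note yA = word_power_A[OF y(1)] and yA' = word_power_A[OF y(2)]
  have c: "0 < snd u" "snd u < fst u" "0 < snd u'" "snd u' < fst u'"
    using cone[OF yA] cone[OF yA'] u_def u'_def by auto
  have "int q dvd cross (cf_act (\<gamma> @ y) e) (cf_act (\<gamma> @ y') e)" by (rule dvd_cross_trans[OF w d])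
  then have "int q dvd (-1) ^ length \<gamma> * cross u u'" unfolding cf_act_append cross_cf_act u_def u'_def .
  then have dv: "int q dvd cross u u'" by (cases "even (length \<gamma>)") auto
  have s: "real_of_int (fst u) \<le> H ^ j * E" "real_of_int (fst u') \<le> H ^ j * E"
    using size[OF y(1), of e] size[OF y(2), of e] e_cone u_def u'_def by auto
  have "real_of_int (fst u) * of_int (fst u') \<le> (H ^ j * E) * (H ^ j * E)"
    using s c H1 E1 by (intro mult_mono) auto
  also have "\<dots> = E\<^sup>2 * H ^ (2 * j)" by (simp add: mult_2 power_add power2_eq_square)
  also have "\<dots> \<le> real q" by (rule q)
  finally have "real_of_int (fst u * fst u') \<le> real_of_int (int q)" by simp
  then have le: "fst u * fst u' \<le> int q" by (simp only: of_int_le_iff)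
  \<comment> \<open>The determinant is a difference of two numbers in [0, q), so its absolute value
    is below q without a factor 2.\<close>
  have "fst u * snd u' < fst u * fst u'" "snd u * fst u' < fst u * fst u'" using c by simp_all
  moreover have "0 \<le> fst u * snd u'" "0 \<le> snd u * fst u'" using c by simp_all
  ultimately have "\<bar>cross u u'\<bar> < int q" using le unfolding cross_def by linarith
  then have "cross u u' = 0" using dv by (metis dvd_imp_le_int not_le abs_of_nat)
  then have eq: "fst u * snd u' = snd u * fst u'" unfolding cross_def by simp
  have cop: "coprime (fst u) (snd u)" "coprime (fst u') (snd u')"
    using coprime_cf_act[OF e_coprime] u_def u'_def by auto
  have "fst u dvd snd u * fst u'" "fst u' dvd fst u * snd u'" using eq by (metis dvd_triv_left, metis dvd_triv_right)
  then have "fst u dvd fst u'" "fst u' dvd fst u"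
    using cop by (simp_all add: coprime_dvd_mult_right_iff coprime_dvd_mult_left_iff coprime_commute)
  then have f: "fst u = fst u'" using c by (intro zdvd_antisym_nonneg) auto
  then have "snd u = snd u'" using eq c by simp
  with f have "cf_act y e = cf_act y' e" unfolding u_def u'_def by (simp add: prod_eq_iff)
  then show ?thesis using inj_onD[OF inj_cf_act] yA yA' by blast
qed

text \<open>For fixed \<open>w\<close>, the first m - j blocks of \<open>w'\<close> determine the
  remaining \<open>j\<close> by \<open>suffix_determined\<close>. The case j = 0 is the trivial
  count, which serves moduli below the first scale.\<close>

lemma card_divisible_le:
  assumes fA: "finite A" and a: "a \<in> A" "a' \<in> A" and j: "j \<le> m" "j = 0 \<or> E\<^sup>2 * H ^ (2 * j) \<le> real q"
  shows "card {(w, w'). w \<in> W a m \<and> w' \<in> W a' m \<and> int q dvd cross w w'} \<le> card B ^ m * card B ^ (m - j)"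
proof -
  have finW: "finite (W b m)" for b unfolding W_def using finite_word_power[OF finB[OF fA]] by simp
  have bound: "card {w'\<in>W a' m. int q dvd cross w w'} \<le> card B ^ (m - j)" if w: "w \<in> W a m" for w
  proof (cases "j = 0")
    case True
    have "card {w'\<in>W a' m. int q dvd cross w w'} \<le> card (W a' m)" using finW by (intro card_mono) auto
    then show ?thesis using card_W[OF a(2)] True by simp
  next
    case False
    then have q: "E\<^sup>2 * H ^ (2 * j) \<le> real q" using j by simp
    have split: "\<exists>x\<in>word_power B (m - j). \<exists>y\<in>word_power B j. w' = cf_act ((a' # x) @ y) e" if "w' \<in> W a' m" for w'
    proof -
      obtain ys where ys: "w' = cf_act (a' # ys) e" "ys \<in> word_power B m" using \<open>w' \<in> W a' m\<close> unfolding W_def by auto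
      have "ys \<in> word_power B ((m - j) + j)" using ys j(1) by simp
      then obtain x y where "x \<in> word_power B (m - j)" "y \<in> word_power B j" "ys = x @ y"
        unfolding word_power_add by auto
      then show ?thesis using ys(1) by auto
    qed
    then obtain fx fy where f: "\<And>w'. w' \<in> W a' m \<Longrightarrow> fx w' \<in> word_power B (m - j) \<and> fy w' \<in> word_power B j \<and> w' = cf_act ((a' # fx w') @ fy w') e"
      by metis
    have "inj_on fx {w'\<in>W a' m. int q dvd cross w w'}"
    proof (rule inj_onI)
      fix u v assume uv: "u \<in> {w'\<in>W a' m. int q dvd cross w w'}" "v \<in> {w'\<in>W a' m. int q dvd cross w w'}" "fx u = fx v"
      have fu: "fx u \<in> word_power B (m - j)" "fy u \<in> word_power B j" "u = cf_act ((a' # fx u) @ fy u) e"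
        and fv: "fy v \<in> word_power B j" "v = cf_act ((a' # fx u) @ fy v) e"
        using f[of u] f[of v] uv by auto
      have gA: "set (a' # fx u) \<subseteq> A" using word_power_A[OF fu(1)] a by auto
      have "int q dvd cross w u" "int q dvd cross w v" using uv by auto
      then have "fy u = fy v"
        using suffix_determined[OF coprime_W[OF w] gA fu(2) fv(1) q] fu(3) fv(2) by metis
      then show "u = v" using fu(3) fv(2) by metis
    qed
    moreover have "fx ` {w'\<in>W a' m. int q dvd cross w w'} \<subseteq> word_power B (m - j)" using f by auto
    ultimately have "card {w'\<in>W a' m. int q dvd cross w w'} \<le> card (word_power B (m - j))"
      by (rule card_inj_on_le) (rule finite_word_power[OF finB[OF fA]])
    then show ?thesis by (simp add: card_word_power[OF Bl])
  qed
  have "{(w, w'). w \<in> W a m \<and> w' \<in> W a' m \<and> int q dvd cross w w'} = (SIGMA w:W a m. {w'\<in>W a' m. int q dvd cross w w'})"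
    by auto
  then have "card {(w, w'). w \<in> W a m \<and> w' \<in> W a' m \<and> int q dvd cross w w'} = (\<Sum>w\<in>W a m. card {w'\<in>W a' m. int q dvd cross w w'})"
    using finW by (simp add: card_SigmaI)
  also have "\<dots> \<le> (\<Sum>w\<in>W a m. card B ^ (m - j))" using bound by (intro sum_mono) auto
  finally show ?thesis by (simp add: card_W[OF a(1)])
qed

text \<open>The largest admissible scale is taken: if the scale m + 1 exceeds \<open>q\<close>, the
  hypothesis already holds with \<open>m\<close> and the induction descends.\<close>

lemma exists_scale:
  assumes "real q \<le> ((real M + 1) * E\<^sup>2 * H\<^sup>2) * H ^ (2 * m)"
  shows "\<exists>j\<le>m. (j = 0 \<or> E\<^sup>2 * H ^ (2 * j) \<le> real q) \<and> real q \<le> ((real M + 1) * E\<^sup>2 * H\<^sup>2) * H ^ (2 * j)"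
  using assms
proof (induction m)
  case (Suc m)
  show ?case
  proof (cases "E\<^sup>2 * H ^ (2 * Suc m) \<le> real q")
    case True
    then show ?thesis using Suc.prems by blast
  next
    case False
    have "1 * (E\<^sup>2 * H ^ (2 * Suc m)) \<le> (real M + 1) * (E\<^sup>2 * H ^ (2 * Suc m))"
      using E1 H1 by (intro mult_right_mono) auto
    then have "real q \<le> (real M + 1) * (E\<^sup>2 * H ^ (2 * Suc m))" using False by linarith
    also have "\<dots> = ((real M + 1) * E\<^sup>2 * H\<^sup>2) * H ^ (2 * m)" by (simp add: power2_eq_square)
    finally show ?thesis using Suc.IH by (meson le_SucI)
  qed
qed auto

text \<open>At the scale \<open>j\<close> matching \<open>q\<close>, divisibility has frequency at
  most \<open>card B\<close> to the power -j. As \<open>card B\<close> is at least H^(2 \<sigma>),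
  this is at most a constant times q to the power -\<sigma>. The cardinalities of the two families
  \<open>W\<close> then cancel.\<close>

lemma main_inequality:
  fixes \<sigma> :: real
  assumes fA: "finite A" and a: "a \<in> A" "a' \<in> A" "a < a'" and \<sigma>: "0 \<le> \<sigma>" "H powr (2 * \<sigma>) \<le> real (card B)"
    and N: "2 * (real M + 1) * E\<^sup>2 * H ^ (k + m) \<le> real N"
  defines "R \<equiv> nat \<lfloor>(real M + 1) * E\<^sup>2 * H ^ (2 * m)\<rfloor>"
  shows "T ^ (2 * m) * real (card B) ^ k
    \<le> (real M + 1) * ((real M + 1) * E\<^sup>2 * H\<^sup>2) powr \<sigma> * (\<Sum>q=1..R. primitive_energy (cf_denoms_upto A N) q * real q powr - \<sigma>)"
proof -
  let ?D = "cf_denoms_upto A N"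
  define C where "C = (real M + 1) * E\<^sup>2 * H\<^sup>2"
  define b where "b = real (card B)"
  have HH: "H powr (2 * \<sigma>) > 0" using H1 by simp
  have b: "b > 0" using \<sigma>(2) HH unfolding b_def by linarith
  have C0: "C > 0" unfolding C_def using E1 H1 by (intro mult_pos_pos) auto
  have finW: "finite (W c m)" for c unfolding W_def using finite_word_power[OF finB[OF fA]] by simp
  have "T ^ (2 * m) / (real M + 1) * real (card (V k)) * real (card (W a m) * card (W a' m))
      \<le> (\<Sum>q=1..R. primitive_energy ?D q * (C powr \<sigma> * real q powr - \<sigma> * (b ^ m * b ^ m)))"
  proof (rule counting_inequality)
    show "?D \<subseteq> {1..N}" unfolding cf_denoms_upto_def by auto
    show "coprime (fst w) (snd w)" if "w \<in> W a m \<union> W a' m" for w using that coprime_W by auto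
    show "0 \<le> dot v w \<and> nat (dot v w) \<in> ?D" if "v \<in> V k" "w \<in> W a m \<union> W a' m" for v w
      using that(2) dot_in_denoms[OF that(1) _ a(1) N, of w] dot_in_denoms[OF that(1) _ a(2) N, of w] by (elim UnE) simp_all
    show "T ^ (2 * m) / (real M + 1) > 0" using T1 by (simp add: add_nonneg_pos)
    fix w w' assume ww: "w \<in> W a m" "w' \<in> W a' m"
    show "T ^ (2 * m) / (real M + 1) \<le> real_of_int \<bar>cross w w'\<bar>" by (rule cross_bounds(1)[OF ww a])
    show "\<bar>cross w w'\<bar> \<le> int R"
      using cross_bounds(2)[OF ww a] unfolding R_def by linarith
  next
    fix q assume q: "1 \<le> q" "q \<le> R"
    have "real q \<le> (real M + 1) * E\<^sup>2 * H ^ (2 * m)"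
    proof -
      have "0 \<le> (real M + 1) * E\<^sup>2 * H ^ (2 * m)" using H1 by (intro mult_nonneg_nonneg) auto
      then have "real R \<le> (real M + 1) * E\<^sup>2 * H ^ (2 * m)" unfolding R_def by (simp add: of_nat_nat)
      then show ?thesis using q by linarith
    qed
    also have "\<dots> * 1 \<le> ((real M + 1) * E\<^sup>2 * H ^ (2 * m)) * H\<^sup>2"
      using H1 by (intro mult_left_mono mult_nonneg_nonneg) auto
    finally have "real q \<le> ((real M + 1) * E\<^sup>2 * H\<^sup>2) * H ^ (2 * m)" by (simp add: ac_simps)
    from exists_scale[OF this] obtain j where j: "j \<le> m" "j = 0 \<or> E\<^sup>2 * H ^ (2 * j) \<le> real q" "real q \<le> C * H ^ (2 * j)"
      unfolding C_def by blast
    have bj: "(H ^ (2 * j)) powr \<sigma> \<le> b ^ j"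
    proof -
      have "(H ^ (2 * j)) powr \<sigma> = (H powr (2 * \<sigma>)) ^ j"
        using H1 by (simp add: powr_powr powr_realpow[symmetric] mult_ac)
      also have "\<dots> \<le> b ^ j" unfolding b_def using \<sigma>(2) by (intro power_mono) auto
      finally show ?thesis .
    qed
    have "real q powr \<sigma> \<le> (C * H ^ (2 * j)) powr \<sigma>" using j(3) \<sigma>(1) by (intro powr_mono2) auto
    also have "\<dots> = C powr \<sigma> * (H ^ (2 * j)) powr \<sigma>" using C0 H1 by (simp add: powr_mult)
    also have "\<dots> \<le> C powr \<sigma> * b ^ j" using bj by (intro mult_left_mono) auto
    finally have "1 \<le> C powr \<sigma> * real q powr - \<sigma> * b ^ j"
      using q by (simp add: powr_minus field_simps)
    then have "b ^ (m - j) * 1 \<le> b ^ (m - j) * (C powr \<sigma> * real q powr - \<sigma> * b ^ j)"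
      using b by (intro mult_left_mono) auto
    also have "\<dots> = C powr \<sigma> * real q powr - \<sigma> * (b ^ (m - j) * b ^ j)" by simp
    also have "b ^ (m - j) * b ^ j = b ^ m" using j(1) by (simp add: power_add[symmetric])
    finally have bm: "b ^ (m - j) \<le> C powr \<sigma> * real q powr - \<sigma> * b ^ m" by simp
    have "real (card {(w, w'). w \<in> W a m \<and> w' \<in> W a' m \<and> int q dvd cross w w'}) \<le> real (card B ^ m * card B ^ (m - j))"
      using card_divisible_le[OF fA a(1,2) j(1,2)] by (simp only: of_nat_le_iff)
    also have "\<dots> = b ^ m * b ^ (m - j)" unfolding b_def by simp
    also have "\<dots> \<le> b ^ m * (C powr \<sigma> * real q powr - \<sigma> * b ^ m)" using bm b by (intro mult_left_mono) auto
    finally show "real (card {(w, w'). w \<in> W a m \<and> w' \<in> W a' m \<and> int q dvd cross w w'})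
        \<le> C powr \<sigma> * real q powr - \<sigma> * (b ^ m * b ^ m)" by (simp add: ac_simps)
  qed (rule finW)+
  also have "\<dots> = C powr \<sigma> * (\<Sum>q=1..R. primitive_energy ?D q * real q powr - \<sigma>) * (b ^ m * b ^ m)"
    by (simp add: sum_distrib_left sum_distrib_right ac_simps)
  also have "real (card (V k)) = b ^ k" unfolding card_V b_def by simp
  also have "real (card (W a m) * card (W a' m)) = b ^ m * b ^ m" unfolding card_W[OF a(1)] card_W[OF a(2)] b_def by simp
  finally have "T ^ (2 * m) / (real M + 1) * b ^ k \<le> C powr \<sigma> * (\<Sum>q=1..R. primitive_energy ?D q * real q powr - \<sigma>)"
    by (rule mult_right_le_imp_le) (use b in simp)
  then have "T ^ (2 * m) * b ^ k \<le> (real M + 1) * (C powr \<sigma> * (\<Sum>q=1..R. primitive_energy ?D q * real q powr - \<sigma>))"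
    by (simp add: divide_le_eq mult.commute add_nonneg_pos)
  then show ?thesis unfolding C_def b_def by (simp add: ac_simps)
qed

end

section \<open>Asymptotics\<close>

lemma exists_power_bracket:
  fixes H x :: real
  assumes "H > 1" "x \<ge> 1"
  obtains k :: nat where "H ^ k \<le> x" "x < H ^ Suc k"
proof -
  obtain n where n: "x < H ^ n" using real_arch_pow[OF assms(1)] by blast
  define n0 where "n0 = (LEAST n. x < H ^ n)"
  have n0: "x < H ^ n0" unfolding n0_def using n by (rule LeastI)
  then obtain k where k: "n0 = Suc k" using assms(2) by (cases n0) auto
  have "\<not> x < H ^ k" using not_less_Least[of k "\<lambda>n. x < H ^ n"] k unfolding n0_def by simp
  then show ?thesis using that[of k] n0 k by simp
qed

lemma finite_cf_denoms_upto: "finite (cf_denoms_upto A N)"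
  unfolding cf_denoms_upto_def by auto

lemma card_cf_denoms_upto_le: "card (cf_denoms_upto A N) \<le> N"
  using card_mono[of "{1..N}" "cf_denoms_upto A N"] unfolding cf_denoms_upto_def by auto

text \<open>With the largest \<open>k\<close> such that H^k E <= N, \<open>card_squared_ge\<close>
  gives at least H^(k s) denominators for s = \<open>cf_dim A - z\<close>; rounding N / E down to a
  power of \<open>H\<close> costs only a constant.\<close>

lemma card_cf_denoms_ge:
  assumes A: "finite A" "0 \<notin> A" "a0 \<in> A" and z: "0 < z" "z < cf_dim A"
  obtains c where "c > 0" "\<forall>\<^sub>F N in sequentially. c * real N powr (cf_dim A - z) \<le> real (card (cf_denoms_upto A N))"
proof -
  obtain B l H where H: "H \<ge> 2" "H \<ge> 1" and B: "B \<subseteq> {as. set as \<subseteq> A \<and> length as = l}"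
    "\<And>as. as \<in> B \<Longrightarrow> H powr (1 - z) \<le> real_of_int (continuant as)"
    "\<And>as. as \<in> B \<Longrightarrow> 2 * real_of_int (continuant as) \<le> H"
    "H powr (2 * (cf_dim A - z)) \<le> real (card B)"
    by (rule exists_block_set[OF A(1,2) z, of 2], rule that) assumption+
  obtain M where M: "\<And>a. a \<in> A \<Longrightarrow> a \<le> M" using A(1) finite_nat_set_iff_bounded_le by auto
  interpret cf_blocks A B l M a0 1 H
  proof
    show "1 \<le> real_of_int (continuant x)" if "x \<in> B" for x
    proof -
      have "0 \<notin> set x" using that B(1) A(2) by auto
      from continuant_ge_1[OF this] show ?thesis by simp
    qed
  qed (use A B H M in auto)
  define s where "s = cf_dim A - z"
  have s: "s > 0" using z s_def by simp
  have HE: "H * E > 0" using H E1 by (intro mult_pos_pos) auto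
  define c where "c = (1 / (H * E)) powr s"
  have "1 / (H * E) > 0" using HE by (rule divide_pos_pos[OF zero_less_one])
  then have "c > 0" unfolding c_def powr_gt_zero by linarith
  moreover have "c * real N powr s \<le> real (card (cf_denoms_upto A N))" if N: "real N \<ge> E" for N
  proof -
    have "real N / E \<ge> 1" using N E1 by simp
    then obtain k where k: "H ^ k \<le> real N / E" "real N / E < H ^ Suc k"
      using exists_power_bracket[of H "real N / E"] H by auto
    have kN: "H ^ k * E \<le> real N" using k(1) E1 by (simp add: field_simps)
    have lower: "real N / (H * E) \<le> H ^ k" using k(2) E1 H by (simp add: field_simps)
    have "c * real N powr s = (real N / (H * E)) powr s"
      unfolding c_def using HE by (simp add: powr_mult[symmetric])
    also have "\<dots> \<le> (H ^ k) powr s" using lower s HE by (intro powr_mono2) auto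
    finally have le: "c * real N powr s \<le> (H ^ k) powr s" .
    have "((H ^ k) powr s)\<^sup>2 = (H powr (2 * s)) ^ k"
      using H by (simp add: powr_powr powr_realpow[symmetric] mult_ac)
    also have "\<dots> \<le> real (card B) ^ k" using B(4) s_def by (intro power_mono) auto
    also have "\<dots> \<le> (real (card (cf_denoms_upto A N)))\<^sup>2"
      using card_squared_ge[OF kN] by (metis of_nat_le_iff of_nat_power)
    finally have "(H ^ k) powr s \<le> real (card (cf_denoms_upto A N))" by (rule power2_le_imp_le) simp
    with le show ?thesis by linarith
  qed
  then have "\<forall>\<^sub>F N in sequentially. c * real N powr s \<le> real (card (cf_denoms_upto A N))"
    using eventually_ge_at_top[of "nat \<lceil>E\<rceil>"] by (rule eventually_mono[rotated]) linarith
  ultimately show ?thesis using that unfolding s_def by blast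
qed

text \<open>A dimension above 1 would give more than \<open>N\<close> denominators up to
  \<open>N\<close> by \<open>card_cf_denoms_ge\<close>.\<close>

lemma cf_dim_le_1:
  assumes A: "finite A" "0 \<notin> A" "a0 \<in> A"
  shows "cf_dim A \<le> 1"
proof (rule ccontr)
  assume "\<not> cf_dim A \<le> 1"
  define z where "z = (cf_dim A - 1) / 2"
  define s where "s = cf_dim A - z"
  have z: "0 < z" "z < cf_dim A" and s: "s > 1" using \<open>\<not> cf_dim A \<le> 1\<close> unfolding s_def z_def by (auto simp: field_simps)
  obtain c where c: "c > 0" "\<forall>\<^sub>F N in sequentially. c * real N powr s \<le> real (card (cf_denoms_upto A N))"
    using card_cf_denoms_ge[OF A z] unfolding s_def by blast
  have "\<forall>\<^sub>F N::nat in sequentially. c * real N powr s > real N" using c(1) s by real_asymp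
  with c(2) have "\<forall>\<^sub>F N::nat in sequentially. False"
  proof eventually_elim
    case (elim N)
    moreover have "real (card (cf_denoms_upto A N)) \<le> real N" unfolding of_nat_le_iff by (rule card_cf_denoms_upto_le)
    ultimately show ?case by linarith
  qed
  then show False by simp
qed

text \<open>With H^(4 m) about N, 3 m blocks for \<open>V\<close> and m blocks for each
  \<open>W\<close>, \<open>main_inequality\<close> and \<open>weighted_energy_le\<close> bound
  N^\<rho> by a constant times N^(1 - \<sigma> + z) d^(1 + \<sigma>), where d is the number of
  denominators; the exponent comes from solving for d.\<close>

lemma card_cf_denoms_ge_of_dim_gt_half:
  assumes A: "finite A" "0 \<notin> A" "a0 \<in> A" and z: "0 < z" "z < 1" "1 / 2 < cf_dim A - z"
  defines "\<sigma> \<equiv> cf_dim A - z"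
  obtains c where "c > 0"
    "\<forall>\<^sub>F N in sequentially. c * real N powr (((5 * \<sigma> - 1 - 3 * z) / 2) / (1 + \<sigma>)) \<le> real (card (cf_denoms_upto A N))"
proof -
  have z_less: "z < cf_dim A" using z by linarith
  have \<sigma>: "1 / 2 < \<sigma>" "\<sigma> \<le> 1" using z cf_dim_le_1[OF A] unfolding \<sigma>_def by auto
  obtain B l H where H: "H \<ge> 2" "H \<ge> 1" and B: "B \<subseteq> {as. set as \<subseteq> A \<and> length as = l}"
    "\<And>as. as \<in> B \<Longrightarrow> H powr (1 - z) \<le> real_of_int (continuant as)"
    "\<And>as. as \<in> B \<Longrightarrow> 2 * real_of_int (continuant as) \<le> H"
    "H powr (2 * \<sigma>) \<le> real (card B)"
    by (rule exists_block_set[OF A(1,2) z(1) z_less, of 2, folded \<sigma>_def], rule that) assumption+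
  obtain M where M: "\<And>a. a \<in> A \<Longrightarrow> a \<le> M" using A(1) finite_nat_set_iff_bounded_le by auto
  interpret cf_blocks A B l M a0 "H powr (1 - z)" H
  proof
    show "1 \<le> H powr (1 - z)" using H z by (intro ge_one_powr_ge_zero) auto
  qed (use A B H M in auto)
  obtain a a' where a: "a \<in> A" "a' \<in> A" "a < a'"
  proof -
    \<comment> \<open>A single letter allows only one word of each length, while \<open>B\<close>
      has at least H^(2 \<sigma>) >= H >= 2 words.\<close>
    have "\<exists>a\<in>A. a \<noteq> a0"
    proof (rule ccontr)
      assume "\<not> ?thesis"
      then have "B \<subseteq> {replicate l a0}" using B(1) by (auto intro!: replicate_eqI)
      then have "card B \<le> 1" using card_mono[of "{replicate l a0}" B] by simp
      moreover have "H powr 1 \<le> H powr (2 * \<sigma>)" using H \<sigma> by (intro powr_mono) auto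
      ultimately show False using B(4) H by simp
    qed
    then show ?thesis using A(3) that by (metis linorder_neqE_nat)
  qed
  define c0 where "c0 = 2 * (real M + 1) * E\<^sup>2"
  have E2: "E\<^sup>2 \<ge> 1" using E1 by simp
  have c0: "c0 \<ge> 1" unfolding c0_def using mult_mono[of 1 "2 * (real M + 1)" 1 "E\<^sup>2"] E2 by simp
  have half: "(real M + 1) * E\<^sup>2 \<le> c0" "(real M + 1) * E\<^sup>2 \<ge> 1"
    unfolding c0_def using E2 mult_mono[of 1 "real M + 1" 1 "E\<^sup>2"] by (auto intro: mult_right_mono)
  \<comment> \<open>The bound with exponent \<sigma> > 1/2 serves as a priori information: the
    number of denominators is at least of order sqrt N, the size of the largest modulus
    \<open>R\<close>.\<close>
  obtain c1 where c1: "c1 > 0" "\<forall>\<^sub>F N in sequentially. c1 * real N powr \<sigma> \<le> real (card (cf_denoms_upto A N))"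
    using card_cf_denoms_ge[OF A z(1) z_less] unfolding \<sigma>_def by blast
  obtain C\<tau> where C\<tau>: "C\<tau> > 0" "\<And>n. n > 0 \<Longrightarrow> real (card {d. d dvd n}) \<le> C\<tau> * real n powr z"
    using divisor_bound[OF z(1)] by blast
  define C2 where "C2 = 4 * (c0 / c1 + C\<tau>) + (1 + 4 * c0\<^sup>2)"
  define C3 where "C3 = (real M + 1) * ((real M + 1) * E\<^sup>2 * H\<^sup>2) powr \<sigma>"
  \<comment> \<open>Chosen so that H^(4 m \<rho>) is T^(2 m) H^(6 m \<sigma>) for T = H^(1 - z), a
    lower bound of the left side of \<open>main_inequality\<close> with k = 3 m.\<close>
  define \<rho> where "\<rho> = (1 - z + 3 * \<sigma>) / 2"
  define c4 where "c4 = (1 / (c0 * H ^ 4)) powr \<rho>"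
  define p where "p = (5 * \<sigma> - 1 - 3 * z) / 2"
  have C2: "C2 > 0" unfolding C2_def using c0 c1 C\<tau> by (intro add_pos_pos mult_pos_pos) auto
  have C3: "C3 > 0" unfolding C3_def using half H by (intro mult_pos_pos) (auto simp: zero_less_mult_iff)
  have c0H: "c0 * H ^ 4 > 0" using c0 H by simp
  have "1 / (c0 * H ^ 4) > 0" using c0H by (rule divide_pos_pos[OF zero_less_one])
  then have c4: "c4 > 0" unfolding c4_def powr_gt_zero by linarith
  have \<rho>: "\<rho> > 0" unfolding \<rho>_def using z \<sigma> by simp
  define c where "c = (c4 / (C3 * C2)) powr (1 / (1 + \<sigma>))"
  have c: "c > 0" unfolding c_def using c4 C2 C3 by simp
  have "\<forall>\<^sub>F N::nat in sequentially. 1 + ln (c0\<^sup>2 * real N) \<le> real N powr z"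
    using z(1) c0 by real_asymp
  moreover have "\<forall>\<^sub>F N::nat in sequentially. real N \<ge> c0" by real_asymp
  ultimately have "\<forall>\<^sub>F N in sequentially. c * real N powr (p / (1 + \<sigma>)) \<le> real (card (cf_denoms_upto A N))"
    using c1(2)
  proof eventually_elim
    case (elim N)
    define D where "D = cf_denoms_upto A N"
    define d where "d = real (card D)"
    have N1: "real N \<ge> 1" using elim(2) c0 by linarith
    have D: "D \<subseteq> {1..N}" unfolding D_def cf_denoms_upto_def by auto
    have Nz: "real N powr z \<ge> 1" using N1 z by (intro ge_one_powr_ge_zero) auto
    have "sqrt (real N) = real N powr (1 / 2)" by (simp add: powr_half_sqrt)
    also have "\<dots> \<le> real N powr \<sigma>" using N1 \<sigma> by (intro powr_mono) auto
    finally have d1: "c1 * sqrt (real N) \<le> d" using elim(3) c1(1) unfolding d_def D_def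
      by (meson mult_left_mono order_less_imp_le order_trans)
    have "c1 * sqrt (real N) > 0" using c1 N1 by simp
    then have d0: "d > 0" using d1 by linarith
    then have Dne: "D \<noteq> {}" unfolding d_def by auto
    \<comment> \<open>The largest \<open>m\<close> for which the 4 m blocks fit below
      \<open>N\<close>; it loses at most a factor H^4.\<close>
    obtain m where m: "(H ^ 4) ^ m \<le> real N / c0" "real N / c0 < (H ^ 4) ^ Suc m"
    proof (rule exists_power_bracket[of "H ^ 4" "real N / c0"])
      show "1 < H ^ 4" using H by (intro one_less_power) auto
      show "1 \<le> real N / c0" using elim(2) c0 by simp
    qed
    have H4: "(H ^ 4) ^ m = H ^ (4 * m)" by (simp add: power_mult)
    have mN: "c0 * H ^ (3 * m + m) \<le> real N" using m(1) c0 unfolding H4 by (simp add: field_simps)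
    have HN: "H ^ (4 * m) \<le> real N"
    proof -
      have "1 * H ^ (4 * m) \<le> c0 * H ^ (4 * m)" using c0 H by (intro mult_right_mono) auto
      then show ?thesis using mN by simp
    qed
    define R where "R = nat \<lfloor>(real M + 1) * E\<^sup>2 * H ^ (2 * m)\<rfloor>"
    have Rle: "real R \<le> c0 * H ^ (2 * m)"
    proof -
      have "0 \<le> (real M + 1) * E\<^sup>2 * H ^ (2 * m)" using H by (intro mult_nonneg_nonneg) auto
      then have "real R \<le> (real M + 1) * E\<^sup>2 * H ^ (2 * m)" unfolding R_def by (simp add: of_nat_nat)
      also have "\<dots> \<le> c0 * H ^ (2 * m)" using half H by (intro mult_right_mono) auto
      finally show ?thesis .
    qed
    have R1: "R \<ge> 1"
    proof -
      have "1 * 1 \<le> ((real M + 1) * E\<^sup>2) * H ^ (2 * m)" using half H by (intro mult_mono) auto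
      then show ?thesis unfolding R_def by (simp add: le_nat_iff le_floor_iff)
    qed
    have R2: "real (R\<^sup>2) \<le> c0\<^sup>2 * real N"
    proof -
      have "real (R\<^sup>2) = (real R)\<^sup>2" by simp
      also have "\<dots> \<le> (c0 * H ^ (2 * m))\<^sup>2" using Rle by (intro power_mono) auto
      also have "\<dots> = c0\<^sup>2 * H ^ (4 * m)" by (simp add: power_mult_distrib power_mult[symmetric] mult.commute)
      also have "\<dots> \<le> c0\<^sup>2 * real N" using HN by (intro mult_left_mono) auto
      finally show ?thesis .
    qed
    have Rs: "real R \<le> c0 * sqrt (real N)"
    proof (rule power2_le_imp_le)
      show "(real R)\<^sup>2 \<le> (c0 * sqrt (real N))\<^sup>2" using R2 by (simp add: power_mult_distrib)
      show "0 \<le> c0 * sqrt (real N)" using c0 by simp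
    qed
    have harm: "harm (R\<^sup>2) \<le> real N powr z"
    proof -
      have "R\<^sup>2 > 0" using R1 by simp
      then have "harm (R\<^sup>2) \<le> 1 + ln (real (R\<^sup>2))" using euler_mascheroni_sequence_decreasing[of 1 "R\<^sup>2"] by (simp add: harm_def)
      also have "ln (real (R\<^sup>2)) \<le> ln (c0\<^sup>2 * real N)" using R2 \<open>R\<^sup>2 > 0\<close> by (intro ln_mono) auto
      finally show ?thesis using elim(1) by linarith
    qed
    have "(H powr (1 - z)) ^ (2 * m) * real (card B) ^ (3 * m) \<le> C3 * (\<Sum>q=1..R. primitive_energy D q * real q powr - \<sigma>)"
      unfolding C3_def R_def D_def
      by (rule main_inequality[OF A(1) a _ B(4)]) (use \<sigma> mN c0_def in auto)
    also have "(\<Sum>q=1..R. primitive_energy D q * real q powr - \<sigma>)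
       \<le> (real N / d) powr (1 - \<sigma>) * (4 * (real R * d + d\<^sup>2 * (C\<tau> * real N powr z)))
       + (real N / d) powr - \<sigma> * ((real N + 4 * (real (R\<^sup>2) * harm (R\<^sup>2))) * d)"
      unfolding d_def
    proof (rule weighted_energy_le[OF D Dne R1])
      fix h assume h: "1 \<le> h" "h \<le> N"
      have "real (card {m. m dvd h}) \<le> C\<tau> * real h powr z" using C\<tau>(2)[of h] h by simp
      also have "\<dots> \<le> C\<tau> * real N powr z" using h C\<tau>(1) z by (intro mult_left_mono powr_mono2) auto
      finally show "real (card {m. m dvd h}) \<le> C\<tau> * real N powr z" .
    qed (use \<sigma> C\<tau> in auto)
    \<comment> \<open>At the threshold N / d both terms have the same main part \<open>X\<close>;
      the loss N^z covers the divisor bound and the harmonic sum.\<close>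
    also have "\<dots> \<le> C2 * real N powr z * ((real N / d) powr (1 - \<sigma>) * d\<^sup>2)"
    proof -
      define X where "X = (real N / d) powr (1 - \<sigma>) * d\<^sup>2"
      have X0: "X \<ge> 0" unfolding X_def by simp
      \<comment> \<open>The a priori bound brings the diagonal term below a constant times d^2, the
        order of the off-diagonal one.\<close>
      have "real R * d \<le> (c0 / c1 * d) * d"
      proof (rule mult_right_mono)
        have "c0 * sqrt (real N) \<le> c0 * (d / c1)" using d1 c1(1) c0 by (intro mult_left_mono) (auto simp: field_simps)
        then show "real R \<le> c0 / c1 * d" using Rs by simp
      qed (use d0 in simp)
      also have "\<dots> = c0 / c1 * d\<^sup>2 * 1" by (simp add: power2_eq_square)
      also have "\<dots> \<le> c0 / c1 * d\<^sup>2 * real N powr z" using Nz c0 c1(1) by (intro mult_left_mono) auto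
      finally have "4 * (real R * d + d\<^sup>2 * (C\<tau> * real N powr z))
          \<le> 4 * (c0 / c1 * d\<^sup>2 * real N powr z + d\<^sup>2 * (C\<tau> * real N powr z))"
        by (intro mult_left_mono add_right_mono) simp_all
      also have "\<dots> = (4 * (c0 / c1 + C\<tau>) * real N powr z) * d\<^sup>2" by (simp add: algebra_simps)
      finally have "4 * (real R * d + d\<^sup>2 * (C\<tau> * real N powr z)) \<le> (4 * (c0 / c1 + C\<tau>) * real N powr z) * d\<^sup>2" .
      then have "(real N / d) powr (1 - \<sigma>) * (4 * (real R * d + d\<^sup>2 * (C\<tau> * real N powr z)))
         \<le> (real N / d) powr (1 - \<sigma>) * ((4 * (c0 / c1 + C\<tau>) * real N powr z) * d\<^sup>2)" by (intro mult_left_mono) auto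
      also have "\<dots> = 4 * (c0 / c1 + C\<tau>) * real N powr z * X" unfolding X_def by simp
      finally have b1: "(real N / d) powr (1 - \<sigma>) * (4 * (real R * d + d\<^sup>2 * (C\<tau> * real N powr z)))
         \<le> 4 * (c0 / c1 + C\<tau>) * real N powr z * X" .
      have "real (R\<^sup>2) * harm (R\<^sup>2) \<le> (c0\<^sup>2 * real N) * real N powr z"
        using R2 harm by (intro mult_mono) (auto simp: harm_nonneg)
      moreover have "real N * 1 \<le> real N * real N powr z" using Nz by (intro mult_left_mono) auto
      ultimately have "real N + 4 * (real (R\<^sup>2) * harm (R\<^sup>2))
          \<le> real N * real N powr z + 4 * ((c0\<^sup>2 * real N) * real N powr z)" by linarith
      also have "\<dots> = (1 + 4 * c0\<^sup>2) * real N powr z * real N" by (simp add: algebra_simps)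
      finally have "real N + 4 * (real (R\<^sup>2) * harm (R\<^sup>2)) \<le> (1 + 4 * c0\<^sup>2) * real N powr z * real N" .
      then have "(real N / d) powr - \<sigma> * ((real N + 4 * (real (R\<^sup>2) * harm (R\<^sup>2))) * d)
         \<le> (real N / d) powr - \<sigma> * (((1 + 4 * c0\<^sup>2) * real N powr z * real N) * d)"
        using d0 by (intro mult_left_mono mult_right_mono) auto
      also have "\<dots> = (1 + 4 * c0\<^sup>2) * real N powr z * ((real N / d) powr - \<sigma> * (real N * d))" by simp
      also have "(real N / d) powr - \<sigma> * (real N * d) = X"
      proof -
        have "(real N / d) powr (1 - \<sigma>) = (real N / d) powr - \<sigma> * (real N / d)"
          using N1 d0 by (simp add: powr_diff powr_minus field_simps)
        then show ?thesis unfolding X_def using d0 by (simp add: power2_eq_square)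
      qed
      finally have b2: "(real N / d) powr - \<sigma> * ((real N + 4 * (real (R\<^sup>2) * harm (R\<^sup>2))) * d)
         \<le> (1 + 4 * c0\<^sup>2) * real N powr z * X" .
      show ?thesis using add_mono[OF b1 b2] unfolding C2_def X_def[symmetric] by (simp only: distrib_right)
    qed
    also have "(real N / d) powr (1 - \<sigma>) * d\<^sup>2 = real N powr (1 - \<sigma>) * d powr (1 + \<sigma>)"
    proof -
      have "d\<^sup>2 = d powr 2" using d0 by (simp add: powr_numeral)
      then have "d\<^sup>2 = d powr (1 - \<sigma>) * d powr (1 + \<sigma>)" by (simp add: powr_add[symmetric])
      then show ?thesis using d0 N1 by (simp add: powr_divide)
    qed
    finally have up: "(H powr (1 - z)) ^ (2 * m) * real (card B) ^ (3 * m)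
       \<le> C3 * (C2 * real N powr z * (real N powr (1 - \<sigma>) * d powr (1 + \<sigma>)))"
      using C3 by (simp add: mult_left_mono)
    have "c4 * real N powr \<rho> = (real N / (c0 * H ^ 4)) powr \<rho>"
      unfolding c4_def using c0H by (simp add: powr_mult[symmetric])
    also have "\<dots> \<le> (H ^ (4 * m)) powr \<rho>"
    proof (rule powr_mono2)
      have "real N / c0 < H ^ 4 * H ^ (4 * m)" using m(2) by (simp add: power_mult)
      then show "real N / (c0 * H ^ 4) \<le> H ^ (4 * m)" using c0 H by (simp add: field_simps)
    qed (use \<rho> c0H in auto)
    also have "\<dots> = (H powr (1 - z)) ^ (2 * m) * (H powr (2 * \<sigma>)) ^ (3 * m)"
    proof -
      have "(H ^ (4 * m)) powr \<rho> = H powr (real (4 * m) * \<rho>)" using H by (simp add: powr_powr powr_realpow[symmetric])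
      also have "real (4 * m) * \<rho> = (1 - z) * real (2 * m) + 2 * \<sigma> * real (3 * m)" by (simp add: \<rho>_def field_simps)
      finally show ?thesis using H by (simp add: powr_add powr_powr powr_realpow[symmetric])
    qed
    also have "\<dots> \<le> (H powr (1 - z)) ^ (2 * m) * real (card B) ^ (3 * m)"
      using B(4) by (intro mult_left_mono power_mono) auto
    finally have "c4 * real N powr \<rho> \<le> C3 * (C2 * real N powr z * (real N powr (1 - \<sigma>) * d powr (1 + \<sigma>)))"
      using up by linarith
    also have "\<dots> = (C3 * C2) * d powr (1 + \<sigma>) * real N powr (z + 1 - \<sigma>)" by (simp add: powr_add powr_diff)
    finally have "c4 / (C3 * C2) * (real N powr \<rho> / real N powr (z + 1 - \<sigma>)) \<le> d powr (1 + \<sigma>)"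
      using C2 C3 N1 by (simp add: field_simps)
    also have "real N powr \<rho> / real N powr (z + 1 - \<sigma>) = real N powr p"
      unfolding powr_diff[symmetric] by (rule arg_cong[where f = "\<lambda>x. real N powr x"]) (simp add: \<rho>_def p_def field_simps)
    finally have "(c4 / (C3 * C2) * real N powr p) powr (1 / (1 + \<sigma>)) \<le> (d powr (1 + \<sigma>)) powr (1 / (1 + \<sigma>))"
      using c4 C2 C3 \<sigma> by (intro powr_mono2) auto
    also have "\<dots> = d" using d0 \<sigma> by (simp add: powr_powr)
    also have "(c4 / (C3 * C2) * real N powr p) powr (1 / (1 + \<sigma>)) = c * real N powr (p / (1 + \<sigma>))"
      unfolding c_def powr_mult powr_powr by simp
    finally show ?case unfolding d_def D_def .
  qed
  then show ?thesis using that c unfolding p_def by blast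
qed

theorem theorem1p23:
  fixes A :: "nat set" and \<delta> \<epsilon> :: real
  assumes "finite A" and "A \<noteq> {}" and "0 \<notin> A"
    and "\<delta> = cf_dim A"
    and "\<epsilon> > 0"
  shows "(\<lambda>N::nat. real (card (cf_denoms_upto A N)))
           \<in> \<Omega>(\<lambda>N. real N powr (\<delta> + (2 * \<delta> - 1) * (1 - \<delta>) / (5 - \<delta>) - \<epsilon>))"
proof -
  define t where "t = \<delta> + (2 * \<delta> - 1) * (1 - \<delta>) / (5 - \<delta>) - \<epsilon>"
  obtain a0 where a0: "a0 \<in> A" using assms(2) by blast
  note A = assms(1,3) a0
  have \<delta>: "0 \<le> \<delta>" "\<delta> \<le> 1" using cf_dim_le_1[OF A] unfolding assms(4) cf_dim_def by auto
  have "\<exists>c>0. \<exists>s\<ge>t. \<forall>\<^sub>F N in sequentially. c * real N powr s \<le> real (card (cf_denoms_upto A N))"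
  proof (cases "\<delta> \<le> 1 / 2")
    case True
    \<comment> \<open>For dimension at most 1/2 the correction term is not positive, so the exponent
      \<delta> - \<epsilon> is enough.\<close>
    have "(2 * \<delta> - 1) * (1 - \<delta>) / (5 - \<delta>) \<le> 0"
      using True \<delta> by (intro divide_nonpos_pos mult_nonpos_nonneg) auto
    then have t: "t \<le> \<delta> - \<epsilon>" unfolding t_def by simp
    show ?thesis
    proof (cases "\<delta> = 0")
      case True
      \<comment> \<open>Dimension 0 leaves no room for 0 < z < \<delta>; the single denominator
        \<open>a0\<close> suffices since the exponent \<open>t\<close> is not positive.\<close>
      have "1 * real N powr 0 \<le> real (card (cf_denoms_upto A N))" if N: "N \<ge> a0" for N
      proof -
        have a01: "a0 \<ge> 1" using a0 assms(3) by (metis One_nat_def Suc_leI gr0I)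
        have "nat (continuant [a0]) \<in> cf_denoms A" using a0 assms(3) by (intro continuant_in_cf_denoms) auto
        then have "a0 \<in> cf_denoms_upto A N" using a01 N unfolding cf_denoms_upto_def by (simp add: continuant_def)
        then have "card (cf_denoms_upto A N) > 0" using finite_cf_denoms_upto by (auto simp: card_gt_0_iff)
        then show ?thesis by simp
      qed
      then have "\<forall>\<^sub>F N in sequentially. 1 * real N powr 0 \<le> real (card (cf_denoms_upto A N))"
        using eventually_ge_at_top[of a0] by (rule eventually_mono[rotated])
      moreover have "t \<le> 0" using t True assms(5) by simp
      ultimately show ?thesis using zero_less_one by blast
    next
      case False
      define z where "z = min \<epsilon> (\<delta> / 2)"
      have z: "0 < z" "z < cf_dim A" "z \<le> \<epsilon>" using False \<delta> assms(4,5) unfolding z_def by auto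
      obtain c where "c > 0" "\<forall>\<^sub>F N in sequentially. c * real N powr (\<delta> - z) \<le> real (card (cf_denoms_upto A N))"
        using card_cf_denoms_ge[OF A z(1,2)] unfolding assms(4) by blast
      moreover have "t \<le> \<delta> - z" using t z by simp
      ultimately show ?thesis by blast
    qed
  next
    case False
    \<comment> \<open>The first bound keeps the total loss 4 z below \<epsilon>, the second keeps
      \<delta> - z above 1/2, and the third keeps the numerator (5 \<delta> - 1) / 2 - 4 z
      positive.\<close>
    define z where "z = min (\<epsilon> / 4) (min ((\<delta> - 1 / 2) / 2) (1 / 16))"
    define \<sigma> where "\<sigma> = \<delta> - z"
    have z: "0 < z" "z < 1" "1 / 2 < \<delta> - z" "4 * z \<le> \<epsilon>" "8 * z \<le> 1 / 2"
      using False assms(5) unfolding z_def by (auto simp: min_def field_simps)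
    define s where "s = ((5 * \<sigma> - 1 - 3 * z) / 2) / (1 + \<sigma>)"
    obtain c where "c > 0" "\<forall>\<^sub>F N in sequentially. c * real N powr s \<le> real (card (cf_denoms_upto A N))"
      using card_cf_denoms_ge_of_dim_gt_half[OF A z(1,2)] z(3) unfolding s_def \<sigma>_def assms(4) by blast
    moreover have "t \<le> s"
    proof -
      have p: "(2 * \<delta> - 1) * (1 - \<delta>) \<ge> 0" using False \<delta> by (intro mult_nonneg_nonneg) auto
      \<comment> \<open>The required exponent is at most the one obtained, because 2 (1 + \<delta>)
        <= 5 - \<delta> for \<delta> <= 1.\<close>
      have "(2 * \<delta> - 1) * (1 - \<delta>) / (5 - \<delta>) \<le> (2 * \<delta> - 1) * (1 - \<delta>) / (2 * (1 + \<delta>))"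
        using p \<delta> by (intro divide_left_mono mult_pos_pos) auto
      moreover have "\<delta> + (2 * \<delta> - 1) * (1 - \<delta>) / (2 * (1 + \<delta>)) = (5 * \<delta> - 1) / 2 / (1 + \<delta>)"
        using \<delta> by (simp add: field_simps)
      moreover have "4 * z / (1 + \<delta>) \<le> 4 * z" using z \<delta> by (simp add: field_simps)
      moreover have "((5 * \<delta> - 1) / 2 - 4 * z) / (1 + \<delta>) = (5 * \<delta> - 1) / 2 / (1 + \<delta>) - 4 * z / (1 + \<delta>)"
        by (simp add: diff_divide_distrib)
      moreover have "((5 * \<delta> - 1) / 2 - 4 * z) / (1 + \<delta>) \<le> ((5 * \<delta> - 1) / 2 - 4 * z) / (1 + \<sigma>)"
        using False \<delta> z unfolding \<sigma>_def by (intro divide_left_mono mult_pos_pos) auto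
      moreover have "((5 * \<delta> - 1) / 2 - 4 * z) / (1 + \<sigma>) = s" unfolding s_def \<sigma>_def by (simp add: field_simps)
      ultimately show ?thesis unfolding t_def using z(4) by linarith
    qed
    ultimately show ?thesis by blast
  qed
  then obtain c s where c: "c > 0" "s \<ge> t" "\<forall>\<^sub>F N in sequentially. c * real N powr s \<le> real (card (cf_denoms_upto A N))"
    by blast
  have "\<forall>\<^sub>F N in sequentially. norm (real (card (cf_denoms_upto A N))) \<ge> c * norm (real N powr t)"
    using c(3) eventually_ge_at_top[of 1]
  proof eventually_elim
    case (elim N)
    have "c * real N powr t \<le> c * real N powr s" using c elim(2) by (intro mult_left_mono powr_mono) auto
    then show ?case using elim(1) by simp
  qed
  then show ?thesis unfolding t_def[symmetric] using c(1) by (intro landau_omega.bigI)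
qed

end
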